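(* (Decidability of synthesis for right continuous signals.) Given an $\mathit{MSO}[<]$ formula $\Psi(X,Y)$ (with $X$ ranging over signals over a finite input alphabet $\Sigma_{in}$ and $Y$ over signals over a finite output alphabet $\Sigma_{out}$), it is decidable whether there exists a C-operator $F$ from right continuous $\Sigma_{in}$-signals to right continuous $\Sigma_{out}$-signals such that $\mathit{Rsig}\models \forall X.\ \Psi(X,F(X))$.
   Context: A right continuous signal over a finite set $\Sigma$ is a function $f:\mathbb{R}^{\geq 0}\to\Sigma$ for which there is an unbounded strictly increasing sequence $0=\tau_0<\tau_1<\cdots$ of reals such that $f$ is constant on every half-open interval $[\tau_i,\tau_{i+1})$; signals over a finite $\Sigma$ are coded in the standard way by tuples of boolean signals. $\mathit{MSO}[<]$ is monadic second-order logic with atomic formulas $t<v$ and $X(t)$, boolean connectives, and first- and second-order quantifiers. $\mathit{Rsig}$ is the structure in which first-order variables range over $\mathbb{R}^{\geq 0}$ with its usual order and monadic second-order variables range over right continuous boolean signals. An operator $F$ (a function from signals to signals) is a C-operator if for every $t\geq 0$ and all input signals $X_1,X_2$ that agree on $[0,t]$, $F(X_1)(t)=F(X_2)(t)$. *)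

theory Defs
  imports Complex_Main "HOL-Library.FuncSet" "HOL-Library.Nat_Bijection"
begin

section \<open>Right continuous signals and C-operators\<close>

text \<open>
  A function on the nonnegative reals is represented by an extensional function on
  \<open>{0..}\<close>, so that equality of signals is equality of terms.
\<close>

definition signals :: "'a set \<Rightarrow> (real \<Rightarrow> 'a) set" where
  "signals \<Sigma> = {f \<in> {0..} \<rightarrow>\<^sub>E \<Sigma>. \<exists>\<tau>::nat \<Rightarrow> real. \<tau> 0 = 0 \<and> strict_mono \<tau> \<and>
      \<not> bdd_above (range \<tau>) \<and> (\<forall>i. \<exists>a. \<forall>t\<in>{\<tau> i..<\<tau> (Suc i)}. f t = a)}"

definition C_operator ::
    "'a set \<Rightarrow> 'b set \<Rightarrow> ((real \<Rightarrow> 'a) \<Rightarrow> (real \<Rightarrow> 'b)) \<Rightarrow> bool" where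
  "C_operator \<Sigma> \<Delta> F \<longleftrightarrow> F \<in> signals \<Sigma> \<rightarrow> signals \<Delta> \<and>
     (\<forall>t\<ge>0. \<forall>X\<^sub>1\<in>signals \<Sigma>. \<forall>X\<^sub>2\<in>signals \<Sigma>.
        (\<forall>s\<in>{0..t}. X\<^sub>1 s = X\<^sub>2 s) \<longrightarrow> F X\<^sub>1 t = F X\<^sub>2 t)"


section \<open>Monadic second-order logic of order over the structure Rsig\<close>

text \<open>
  First- and second-order variables are two disjoint families, each indexed by \<open>nat\<close>.
  \<open>Less x y\<close> is the atom \<open>x < y\<close>, and \<open>Pred X x\<close> is the atom \<open>X(x)\<close>.
\<close>

datatype mso =
    Less nat nat
  | Pred nat nat
  | Neg mso
  | Conj mso mso
  | Disj mso mso
  | Ex1 nat mso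
  | All1 nat mso
  | Ex2 nat mso
  | All2 nat mso

primrec free1 :: "mso \<Rightarrow> nat set" where
  "free1 (Less x y) = {x, y}"
| "free1 (Pred X x) = {x}"
| "free1 (Neg \<phi>) = free1 \<phi>"
| "free1 (Conj \<phi> \<psi>) = free1 \<phi> \<union> free1 \<psi>"
| "free1 (Disj \<phi> \<psi>) = free1 \<phi> \<union> free1 \<psi>"
| "free1 (Ex1 x \<phi>) = free1 \<phi> - {x}"
| "free1 (All1 x \<phi>) = free1 \<phi> - {x}"
| "free1 (Ex2 X \<phi>) = free1 \<phi>"
| "free1 (All2 X \<phi>) = free1 \<phi>"

primrec free2 :: "mso \<Rightarrow> nat set" where
  "free2 (Less x y) = {}"
| "free2 (Pred X x) = {X}"
| "free2 (Neg \<phi>) = free2 \<phi>"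
| "free2 (Conj \<phi> \<psi>) = free2 \<phi> \<union> free2 \<psi>"
| "free2 (Disj \<phi> \<psi>) = free2 \<phi> \<union> free2 \<psi>"
| "free2 (Ex1 x \<phi>) = free2 \<phi>"
| "free2 (All1 x \<phi>) = free2 \<phi>"
| "free2 (Ex2 X \<phi>) = free2 \<phi> - {X}"
| "free2 (All2 X \<phi>) = free2 \<phi> - {X}"

primrec Rsig_sat :: "(nat \<Rightarrow> real) \<Rightarrow> (nat \<Rightarrow> real \<Rightarrow> bool) \<Rightarrow> mso \<Rightarrow> bool" where
  "Rsig_sat v V (Less x y) \<longleftrightarrow> v x < v y"
| "Rsig_sat v V (Pred X x) \<longleftrightarrow> V X (v x)"
| "Rsig_sat v V (Neg \<phi>) \<longleftrightarrow> \<not> Rsig_sat v V \<phi>"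
| "Rsig_sat v V (Conj \<phi> \<psi>) \<longleftrightarrow> Rsig_sat v V \<phi> \<and> Rsig_sat v V \<psi>"
| "Rsig_sat v V (Disj \<phi> \<psi>) \<longleftrightarrow> Rsig_sat v V \<phi> \<or> Rsig_sat v V \<psi>"
| "Rsig_sat v V (Ex1 x \<phi>) \<longleftrightarrow> (\<exists>t\<in>{0..}. Rsig_sat (v(x := t)) V \<phi>)"
| "Rsig_sat v V (All1 x \<phi>) \<longleftrightarrow> (\<forall>t\<in>{0..}. Rsig_sat (v(x := t)) V \<phi>)"
| "Rsig_sat v V (Ex2 X \<phi>) \<longleftrightarrow> (\<exists>S\<in>signals UNIV. Rsig_sat v (V(X := S)) \<phi>)"
| "Rsig_sat v V (All2 X \<phi>) \<longleftrightarrow> (\<forall>S\<in>signals UNIV. Rsig_sat v (V(X := S)) \<phi>)"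


section \<open>Coding signals over a finite alphabet by tuples of boolean signals\<close>

text \<open>
  A finite alphabet is presented by the list \<open>C\<close> of the code words of its letters: the
  letters are the numbers \<open>a < length C\<close>, and letter \<open>a\<close> is coded by the bit vector \<open>C ! a\<close>.
  Any injective coding by bit vectors of a fixed width (binary, one-hot, or the identity on
  \<open>{0,1}\<^sup>m\<close>) is an instance.
\<close>

definition is_coding :: "bool list list \<Rightarrow> bool" where
  "is_coding C \<longleftrightarrow> C \<noteq> [] \<and> distinct C \<and> (\<forall>w\<in>set C. length w = length (hd C))"

definition width :: "bool list list \<Rightarrow> nat" where
  "width C = length (hd C)"

definition alphabet :: "bool list list \<Rightarrow> nat set" where
  "alphabet C = {..<length C}"

definition component :: "bool list list \<Rightarrow> (real \<Rightarrow> nat) \<Rightarrow> nat \<Rightarrow> (real \<Rightarrow> bool)" where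
  "component C f i = (\<lambda>t\<in>{0..}. C ! f t ! i)"

text \<open>
  In a formula \<open>\<Psi>(X,Y)\<close> the second-order variables \<open>0, \<dots>, width Cin - 1\<close> stand for the
  components of \<open>X\<close>, and the next \<open>width Cout\<close> ones for the components of \<open>Y\<close>.
\<close>

definition spec_formula :: "bool list list \<Rightarrow> bool list list \<Rightarrow> mso \<Rightarrow> bool" where
  "spec_formula Cin Cout \<Psi> \<longleftrightarrow> free1 \<Psi> = {} \<and> free2 \<Psi> \<subseteq> {..<width Cin + width Cout}"

text \<open>
  The values given here to first-order variables, and to second-order variables with index at
  least \<open>width Cin + width Cout\<close>, are irrelevant for formulas satisfying \<open>spec_formula\<close>.
\<close>

definition Rsig_models ::
    "bool list list \<Rightarrow> bool list list \<Rightarrow> mso \<Rightarrow> (real \<Rightarrow> nat) \<Rightarrow> (real \<Rightarrow> nat) \<Rightarrow> bool" where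
  "Rsig_models Cin Cout \<Psi> X Y \<longleftrightarrow>
     Rsig_sat (\<lambda>_. 0)
       (\<lambda>i. if i < width Cin then component Cin X i
            else if i < width Cin + width Cout then component Cout Y (i - width Cin)
            else (\<lambda>t\<in>{0..}. False)) \<Psi>"


section \<open>Decidability\<close>

text \<open>
  Partial recursive functions: \<open>rec_computes f xs y\<close> means that \<open>f\<close> is defined on the
  arguments \<open>xs\<close> with value \<open>y\<close>.  The recursion argument of \<open>PrimRec\<close> and the search
  argument of \<open>Mu\<close> come first.
\<close>

datatype recfn =
    Zero
  | Succ
  | Proj nat
  | Comp recfn "recfn list"
  | PrimRec recfn recfn
  | Mu recfn

inductive rec_computes :: "recfn \<Rightarrow> nat list \<Rightarrow> nat \<Rightarrow> bool" where
  Zero: "rec_computes Zero xs 0"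
| Succ: "rec_computes Succ [x] (Suc x)"
| Proj: "i < length xs \<Longrightarrow> rec_computes (Proj i) xs (xs ! i)"
| Comp: "list_all2 (\<lambda>g y. rec_computes g xs y) gs ys \<Longrightarrow> rec_computes f ys z \<Longrightarrow>
         rec_computes (Comp f gs) xs z"
| PrimRec_0: "rec_computes f xs y \<Longrightarrow> rec_computes (PrimRec f g) (0 # xs) y"
| PrimRec_Suc: "rec_computes (PrimRec f g) (n # xs) r \<Longrightarrow> rec_computes g (n # r # xs) y \<Longrightarrow>
         rec_computes (PrimRec f g) (Suc n # xs) y"
| Mu: "rec_computes f (n # xs) 0 \<Longrightarrow> (\<And>m. m < n \<Longrightarrow> \<exists>y. rec_computes f (m # xs) (Suc y)) \<Longrightarrow>
         rec_computes (Mu f) xs n"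

definition decidable :: "nat set \<Rightarrow> bool" where
  "decidable A \<longleftrightarrow> (\<exists>f. \<forall>n. rec_computes f [n] (if n \<in> A then 1 else 0))"

primrec mso_encode :: "mso \<Rightarrow> nat" where
  "mso_encode (Less x y) = prod_encode (0, prod_encode (x, y))"
| "mso_encode (Pred X x) = prod_encode (1, prod_encode (X, x))"
| "mso_encode (Neg \<phi>) = prod_encode (2, mso_encode \<phi>)"
| "mso_encode (Conj \<phi> \<psi>) = prod_encode (3, prod_encode (mso_encode \<phi>, mso_encode \<psi>))"
| "mso_encode (Disj \<phi> \<psi>) = prod_encode (4, prod_encode (mso_encode \<phi>, mso_encode \<psi>))"
| "mso_encode (Ex1 x \<phi>) = prod_encode (5, prod_encode (x, mso_encode \<phi>))"
| "mso_encode (All1 x \<phi>) = prod_encode (6, prod_encode (x, mso_encode \<phi>))"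
| "mso_encode (Ex2 X \<phi>) = prod_encode (7, prod_encode (X, mso_encode \<phi>))"
| "mso_encode (All2 X \<phi>) = prod_encode (8, prod_encode (X, mso_encode \<phi>))"

definition coding_encode :: "bool list list \<Rightarrow> nat" where
  "coding_encode C = list_encode (map (\<lambda>w. list_encode (map of_bool w)) C)"

definition instance_encode :: "bool list list \<Rightarrow> bool list list \<Rightarrow> mso \<Rightarrow> nat" where
  "instance_encode Cin Cout \<Psi> =
     prod_encode (coding_encode Cin, prod_encode (coding_encode Cout, mso_encode \<Psi>))"

inductive_cases rec_computes_ZeroE: "rec_computes Zero xs y"
inductive_cases rec_computes_SuccE: "rec_computes Succ xs y"
inductive_cases rec_computes_ProjE: "rec_computes (Proj i) xs y"
inductive_cases rec_computes_CompE: "rec_computes (Comp f gs) xs y"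
inductive_cases rec_computes_PrimRec_0E: "rec_computes (PrimRec f g) (0 # xs) y"
inductive_cases rec_computes_PrimRec_SucE: "rec_computes (PrimRec f g) (Suc n # xs) y"
inductive_cases rec_computes_MuE: "rec_computes (Mu f) xs y"

lemma rec_computes_unique:
  "rec_computes f xs y \<Longrightarrow> rec_computes f xs z \<Longrightarrow> z = y"
proof (induction arbitrary: z rule: rec_computes.induct)
  case (Zero xs)
  then show ?case by (rule rec_computes_ZeroE)
next
  case (Succ x)
  then show ?case by (rule rec_computes_SuccE) simp
next
  case (Proj i xs)
  from Proj.prems show ?case by (rule rec_computes_ProjE)
next
  case (Comp xs gs ys f z')
  from Comp.prems obtain ys' where
    ys': "list_all2 (\<lambda>g y. rec_computes g xs y) gs ys'" "rec_computes f ys' z"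
    by (rule rec_computes_CompE)
  have "ys' = ys"
  proof (rule nth_equalityI)
    show "length ys' = length ys"
      using Comp.IH(1) ys'(1) by (simp add: list_all2_conv_all_nth)
    show "ys' ! i = ys ! i" if "i < length ys'" for i
      using Comp.IH(1) ys'(1) that by (simp add: list_all2_conv_all_nth)
  qed
  with ys' Comp.IH(2) show ?case by blast
next
  case (PrimRec_0 f xs y g)
  from PrimRec_0.prems have "rec_computes f xs z"
    by (rule rec_computes_PrimRec_0E)
  then show ?case by (rule PrimRec_0.IH)
next
  case (PrimRec_Suc f g n xs r y)
  from PrimRec_Suc.prems obtain r' where
    "rec_computes (PrimRec f g) (n # xs) r'" "rec_computes g (n # r' # xs) z"
    by (rule rec_computes_PrimRec_SucE)
  with PrimRec_Suc.IH show ?case by blast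
next
  case (Mu f n xs)
  from Mu.prems have z: "rec_computes f (z # xs) 0"
    "\<And>m. m < z \<Longrightarrow> \<exists>y. rec_computes f (m # xs) (Suc y)"
    by (blast elim: rec_computes_MuE)+
  show ?case
  proof (rule linorder_cases[of z n])
    assume "z < n"
    then obtain y where "\<And>w. rec_computes f (z # xs) w \<Longrightarrow> w = Suc y"
      using Mu.IH(2) by blast
    with z(1) show ?thesis by fastforce
  next
    assume "n < z"
    then obtain y where "rec_computes f (n # xs) (Suc y)"
      using z(2) by blast
    from Mu.IH(1)[OF this] show ?thesis by simp
  qed
qed

lemma mso_encode_inject: "mso_encode \<phi> = mso_encode \<psi> \<longleftrightarrow> \<phi> = \<psi>"
proof
  show "mso_encode \<phi> = mso_encode \<psi> \<Longrightarrow> \<phi> = \<psi>"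
    by (induction \<phi> arbitrary: \<psi>; case_tac \<psi>; simp)
qed simp

lemma coding_encode_inject: "coding_encode C = coding_encode D \<longleftrightarrow> C = D"
proof -
  have "inj (of_bool :: bool \<Rightarrow> nat)"
    by (rule injI) (simp add: of_bool_def split: if_splits)
  then have "inj (\<lambda>w. list_encode (map of_bool w) :: nat)"
    by (simp add: inj_def list_encode_eq inj_map_eq_map)
  then show ?thesis
    by (simp add: coding_encode_def list_encode_eq inj_map_eq_map)
qed

lemma instance_encode_inject:
  "instance_encode Cin Cout \<Psi> = instance_encode Cin' Cout' \<Psi>' \<longleftrightarrow>
     Cin = Cin' \<and> Cout = Cout' \<and> \<Psi> = \<Psi>'"
  by (simp add: instance_encode_def mso_encode_inject coding_encode_inject)

end

theory Submission
  imports Defs "HOL-Library.Ramsey"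
begin

text \<open>
  Over right continuous signals, the truth of a formula on a half-open interval is captured by an element of a
  finite semigroup in which the value of a constant piece is idempotent, and the truth on the whole half line by
  a linked pair \<open>(s, e)\<close> with value \<open>s e e e \<dots>\<close>; second-order quantification corresponds to passing to sets of
  elements.

  A C-operator exists iff the output player wins the following discrete game. In every round the input
  player names a letter and the output player answers with a letter and possibly the request of a checkpoint, which
  is passed if the input does not change in the next round. The output player has to satisfy the formula if
  infinitely many checkpoints are passed; otherwise he wins iff the input changes infinitely often.
  Checkpoints are needed because a signal changes finitely often in a bounded time: an operator that retries
  a spontaneous change of the output after shorter and shorter delays cannot be interrupted forever.

  The winning condition of the game is given by a finite semigroup. Following the classes of positions of a play
  that have the same value up to now, ordered by age, turns it into a parity condition, so that one of the players wins
  with finite memory. Such a strategy has a finite certificate, whose validity is checked on linked pairs.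
  The decision procedure searches for a certificate of either player.
\<close>

section \<open>Computable functions\<close>

text \<open>The search for a certificate is unbounded: determinacy provides a certificate of one
  kind, so minimisation halts, and two soundness theorems make its kind the answer. Hence the input
  player needs certificates as well, and validity must be finite arithmetic. A finite-memory
  strategy still generates infinitely many infinite plays; closing the values of its segments under
  composition leaves a finite set, and Ramsey's theorem reduces every play to one linked pair from
  it. Finite memory comes from positional determinacy, which needs a condition on recurring colours,
  while a linked pair belongs to a whole play; determinisation bridges the two. It is sound only if
  all factorisations of one sequence are accepted alike, and this comes from the logic: any two
  pairs of a sequence decide the truth of one formula for one pair of signals. Finally,
  \<open>MSO[<]\<close> has no metric, so a sequence of letters stands for signals that run through
  it at any speed, and the moments of the moves can be chosen so that accumulating moves contradict
  finite variability.\<close>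

definition rcomp :: "nat \<Rightarrow> (nat list \<Rightarrow> nat) \<Rightarrow> bool" where
  "rcomp k f \<longleftrightarrow> (\<exists>r. \<forall>xs. length xs = k \<longrightarrow> rec_computes r xs (f xs))"

lemma rcomp_cong: "rcomp k f \<Longrightarrow> (\<And>xs. length xs = k \<Longrightarrow> f xs = g xs) \<Longrightarrow> rcomp k g"
  unfolding rcomp_def by force

lemma rcomp_zero: "rcomp k (\<lambda>xs. 0)"
  unfolding rcomp_def using rec_computes.Zero by blast

lemma rcomp_nth: "i < k \<Longrightarrow> rcomp k (\<lambda>xs. xs ! i)"
  unfolding rcomp_def using rec_computes.Proj by blast

lemma rcomp_comp:
  assumes g: "rcomp (length fs) g" and fs: "\<forall>f\<in>set fs. rcomp k f"
  shows "rcomp k (\<lambda>xs. g (map (\<lambda>f. f xs) fs))"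
proof -
  obtain G where G: "\<And>xs. length xs = length fs \<Longrightarrow> rec_computes G xs (g xs)"
    using g unfolding rcomp_def by blast
  obtain H where H: "\<And>f xs. f \<in> set fs \<Longrightarrow> length xs = k \<Longrightarrow> rec_computes (H f) xs (f xs)"
    using fs unfolding rcomp_def by metis
  have "rec_computes (Comp G (map H fs)) xs (g (map (\<lambda>f. f xs) fs))" if "length xs = k" for xs
    by (rule rec_computes.Comp[where ys = "map (\<lambda>f. f xs) fs"])
      (use that G H in \<open>auto simp: list_all2_conv_all_nth\<close>)
  then show ?thesis unfolding rcomp_def by blast
qed

lemma rcomp_comp1:
  assumes "rcomp (Suc 0) (\<lambda>ys. g (ys ! 0))" "rcomp k f"
  shows "rcomp k (\<lambda>xs. g (f xs))"
  using rcomp_comp[of "[f]" "\<lambda>ys. g (ys ! 0)" k] assms by simp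

lemma rcomp_comp2:
  assumes "rcomp (Suc (Suc 0)) (\<lambda>ys. g (ys ! 0) (ys ! 1))" "rcomp k f1" "rcomp k f2"
  shows "rcomp k (\<lambda>xs. g (f1 xs) (f2 xs))"
  using rcomp_comp[of "[f1, f2]" "\<lambda>ys. g (ys ! 0) (ys ! 1)" k] assms by simp

lemma rcomp_Suc: assumes "rcomp k f" shows "rcomp k (\<lambda>xs. Suc (f xs))"
proof (rule rcomp_comp1[OF _ assms])
  have "rec_computes Succ xs (Suc (xs ! 0))" if "length xs = Suc 0" for xs
    using that by (cases xs) (auto intro: rec_computes.Succ)
  then show "rcomp (Suc 0) (\<lambda>ys. Suc (ys ! 0))" unfolding rcomp_def by blast
qed

lemma rcomp_const: "rcomp k (\<lambda>xs. c)"
  by (induction c) (auto intro: rcomp_zero rcomp_Suc)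

lemma rcomp_rec:
  assumes b: "rcomp k b" and s: "rcomp (Suc (Suc k)) s"
  shows "rcomp (Suc k) (\<lambda>ys. rec_nat (b (tl ys)) (\<lambda>i r. s (i # r # tl ys)) (hd ys))"
proof -
  obtain B where B: "\<And>xs. length xs = k \<Longrightarrow> rec_computes B xs (b xs)"
    using b unfolding rcomp_def by blast
  obtain S where S: "\<And>xs. length xs = Suc (Suc k) \<Longrightarrow> rec_computes S xs (s xs)"
    using s unfolding rcomp_def by blast
  have *: "rec_computes (PrimRec B S) (n # xs) (rec_nat (b xs) (\<lambda>i r. s (i # r # xs)) n)"
    if "length xs = k" for n xs
  proof (induction n)
    case 0
    show ?case using rec_computes.PrimRec_0[OF B[OF that]] by simp
  next
    case (Suc n)
    show ?case using rec_computes.PrimRec_Suc[OF Suc] S that by simp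
  qed
  have "rec_computes (PrimRec B S) ys (rec_nat (b (tl ys)) (\<lambda>i r. s (i # r # tl ys)) (hd ys))"
    if "length ys = Suc k" for ys
    using *[of "tl ys" "hd ys"] that by (cases ys) auto
  then show ?thesis unfolding rcomp_def by blast
qed

lemma rcomp_least:
  assumes f: "rcomp (Suc k) f" and ex: "\<And>xs. length xs = k \<Longrightarrow> \<exists>n. f (n # xs) = 0"
  shows "rcomp k (\<lambda>xs. LEAST n. f (n # xs) = 0)"
proof -
  obtain F where F: "\<And>xs. length xs = Suc k \<Longrightarrow> rec_computes F xs (f xs)"
    using f unfolding rcomp_def by blast
  have "rec_computes (Mu F) xs (LEAST n. f (n # xs) = 0)" if l: "length xs = k" for xs
  proof (rule rec_computes.Mu)
    have "f ((LEAST n. f (n # xs) = 0) # xs) = 0" using LeastI_ex[OF ex[OF l]] .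
    then show "rec_computes F ((LEAST n. f (n # xs) = 0) # xs) 0"
      using F[of "(LEAST n. f (n # xs) = 0) # xs"] l by simp
  next
    fix m assume "m < (LEAST n. f (n # xs) = 0)"
    then have "f (m # xs) \<noteq> 0" using not_less_Least by blast
    then show "\<exists>y. rec_computes F (m # xs) (Suc y)"
      using F[of "m # xs"] l by (metis length_Cons not0_implies_Suc)
  qed
  then show ?thesis unfolding rcomp_def by blast
qed

lemma length2: "length xs = Suc (Suc 0) \<Longrightarrow> \<exists>a b. xs = [a, b]"
  by (auto simp: length_Suc_conv)

lemma length1: "length xs = Suc 0 \<Longrightarrow> \<exists>a. xs = [a]"
  by (auto simp: length_Suc_conv)

lemma rcomp_add: assumes "rcomp k f" "rcomp k g" shows "rcomp k (\<lambda>xs. f xs + g xs)"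
proof (rule rcomp_comp2[OF _ assms])
  have "rec_nat b (\<lambda>i r. Suc r) a = a + b" for a b by (induction a) auto
  with rcomp_rec[of "Suc 0" "\<lambda>xs. xs ! 0" "\<lambda>xs. Suc (xs ! 1)"]
  show "rcomp (Suc (Suc 0)) (\<lambda>ys. ys ! 0 + ys ! 1)"
    by (fastforce elim!: rcomp_cong intro: rcomp_nth rcomp_Suc dest: length2)
qed

lemma rcomp_pred: assumes "rcomp k f" shows "rcomp k (\<lambda>xs. f xs - 1)"
proof (rule rcomp_comp1[OF _ assms])
  have "rec_nat 0 (\<lambda>i r. i) a = a - 1" for a :: nat by (induction a) auto
  with rcomp_rec[of 0 "\<lambda>xs. 0" "\<lambda>xs. xs ! 0"]
  show "rcomp (Suc 0) (\<lambda>ys. ys ! 0 - 1)"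
    by (fastforce elim!: rcomp_cong intro: rcomp_nth rcomp_zero dest: length1)
qed

lemma rcomp_diff: assumes "rcomp k f" "rcomp k g" shows "rcomp k (\<lambda>xs. f xs - g xs)"
proof (rule rcomp_comp2[OF _ assms(2,1)])
  have "rec_nat b (\<lambda>i r. r - 1) a = b - a" for a b :: nat by (induction a) auto
  with rcomp_rec[of "Suc 0" "\<lambda>xs. xs ! 0" "\<lambda>xs. (xs ! 1) - 1"]
  show "rcomp (Suc (Suc 0)) (\<lambda>ys. ys ! 1 - ys ! 0)"
    by (fastforce elim!: rcomp_cong intro: rcomp_nth rcomp_pred dest: length2)
qed

lemma rcomp_triangle: assumes "rcomp k f" shows "rcomp k (\<lambda>xs. triangle (f xs))"
proof (rule rcomp_comp1[OF _ assms])
  have "rec_nat 0 (\<lambda>i r. r + Suc i) a = triangle a" for a :: nat by (induction a) auto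
  with rcomp_rec[of 0 "\<lambda>xs. 0" "\<lambda>xs. xs ! 1 + Suc (xs ! 0)"]
  show "rcomp (Suc 0) (\<lambda>ys. triangle (ys ! 0))"
    by (fastforce elim!: rcomp_cong intro: rcomp_nth rcomp_zero rcomp_add rcomp_Suc dest: length1)
qed

section \<open>Cantor pairing and its projections\<close>

definition pfst :: "nat \<Rightarrow> nat" where "pfst z = fst (prod_decode z)"
definition psnd :: "nat \<Rightarrow> nat" where "psnd z = snd (prod_decode z)"

abbreviation pr :: "nat \<Rightarrow> nat \<Rightarrow> nat" where "pr a b \<equiv> prod_encode (a, b)"

lemma pfst_pr [simp]: "pfst (pr a b) = a" and psnd_pr [simp]: "psnd (pr a b) = b"
  by (simp_all add: pfst_def psnd_def)

lemma pr_pfst_psnd [simp]: "pr (pfst z) (psnd z) = z"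
  by (simp add: pfst_def psnd_def)

lemma pfst_le: "pfst z \<le> z" and psnd_le: "psnd z \<le> z"
  using le_prod_encode_1[of "pfst z" "psnd z"] le_prod_encode_2[of "psnd z" "pfst z"] by simp_all

lemma rcomp_pr: "rcomp k f \<Longrightarrow> rcomp k g \<Longrightarrow> rcomp k (\<lambda>xs. pr (f xs) (g xs))"
  by (auto simp: prod_encode_def intro!: rcomp_add rcomp_triangle)

text \<open>Since \<open>pr m n = triangle (m + n) + m\<close>, the diagonal \<open>m + n\<close> is
  the least \<open>k\<close> with \<open>pr m n < triangle (Suc k)\<close>. Minimisation finds it,
  and both projections are differences computed from it.\<close>

definition diag :: "nat \<Rightarrow> nat" where "diag z = (LEAST k. Suc z - triangle (Suc k) = 0)"

lemma triangle_mono: "m \<le> n \<Longrightarrow> triangle m \<le> triangle n"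
  by (induction n) (auto simp: le_Suc_eq)

lemma diag_pr: "diag (pr m n) = m + n"
  unfolding diag_def
proof (rule Least_equality)
  show "Suc (pr m n) - triangle (Suc (m + n)) = 0" by (simp add: prod_encode_def)
  fix k assume "Suc (pr m n) - triangle (Suc k) = 0"
  then have "triangle (m + n) < triangle (Suc k)" by (simp add: prod_encode_def)
  then show "m + n \<le> k" by (metis triangle_mono not_less not_less_eq_eq)
qed

lemma rcomp_diag: assumes "rcomp k f" shows "rcomp k (\<lambda>xs. diag (f xs))"
proof (rule rcomp_comp1[OF _ assms])
  have "\<exists>n. Suc z - triangle (Suc n) = 0" for z
    by (rule exI[of _ z]) (induction z; simp)
  then have "rcomp (Suc 0) (\<lambda>xs. LEAST n. Suc ((n # xs) ! 1) - triangle (Suc ((n # xs) ! 0)) = 0)"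
    by (intro rcomp_least rcomp_diff rcomp_Suc rcomp_triangle rcomp_nth) auto
  then show "rcomp (Suc 0) (\<lambda>ys. diag (ys ! 0))"
    unfolding diag_def by (auto elim!: rcomp_cong)
qed

lemma pfst_diag: "pfst z = z - triangle (diag z)" and psnd_diag: "psnd z = diag z - pfst z"
proof -
  obtain m n where "z = pr m n" by (metis pr_pfst_psnd)
  then show "pfst z = z - triangle (diag z)" "psnd z = diag z - pfst z"
    by (simp_all only: diag_pr pfst_pr psnd_pr) (simp_all add: prod_encode_def)
qed

lemma rcomp_pfst: "rcomp k f \<Longrightarrow> rcomp k (\<lambda>xs. pfst (f xs))"
  unfolding pfst_diag by (intro rcomp_diff rcomp_triangle rcomp_diag)

lemma rcomp_psnd: "rcomp k f \<Longrightarrow> rcomp k (\<lambda>xs. psnd (f xs))"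
  unfolding psnd_diag by (intro rcomp_diff rcomp_diag rcomp_pfst)

text \<open>An environment of several numbers is a single number, the iterated pairing of them; the rules
  for binders below extend the environment by one component.\<close>

definition cmp :: "(nat \<Rightarrow> nat) \<Rightarrow> bool" where
  "cmp f \<longleftrightarrow> rcomp (Suc 0) (\<lambda>xs. f (xs ! 0))"

definition dec :: "(nat \<Rightarrow> bool) \<Rightarrow> bool" where
  "dec P \<longleftrightarrow> cmp (\<lambda>x. of_bool (P x))"

named_theorems cmp_intros

lemma cmp_rec_computes: "cmp f \<Longrightarrow> \<exists>r. \<forall>n. rec_computes r [n] (f n)"
  unfolding cmp_def rcomp_def by (metis length_Cons list.size(3) nth_Cons_0)

lemma cmp_compose: "cmp g \<Longrightarrow> cmp f \<Longrightarrow> cmp (\<lambda>x. g (f x))"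
  unfolding cmp_def by (rule rcomp_comp1)

lemma dec_compose: "dec P \<Longrightarrow> cmp f \<Longrightarrow> dec (\<lambda>x. P (f x))"
  unfolding dec_def by (rule cmp_compose)

lemma cmp_id [cmp_intros]: "cmp (\<lambda>x. x)"
  unfolding cmp_def by (rule rcomp_nth) simp

lemma cmp_const [cmp_intros]: "cmp (\<lambda>x. c)"
  unfolding cmp_def by (rule rcomp_const)

lemma cmp_Suc [cmp_intros]: "cmp f \<Longrightarrow> cmp (\<lambda>x. Suc (f x))"
  unfolding cmp_def by (rule rcomp_Suc)

lemma cmp_pfst [cmp_intros]: "cmp f \<Longrightarrow> cmp (\<lambda>x. pfst (f x))"
  unfolding cmp_def by (rule rcomp_pfst)

lemma cmp_psnd [cmp_intros]: "cmp f \<Longrightarrow> cmp (\<lambda>x. psnd (f x))"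
  unfolding cmp_def by (rule rcomp_psnd)

lemma cmp_pr [cmp_intros]: "cmp f \<Longrightarrow> cmp g \<Longrightarrow> cmp (\<lambda>x. pr (f x) (g x))"
  unfolding cmp_def by (rule rcomp_pr)

lemma cmp_add [cmp_intros]: "cmp f \<Longrightarrow> cmp g \<Longrightarrow> cmp (\<lambda>x. f x + g x)"
  unfolding cmp_def by (rule rcomp_add)

lemma cmp_diff [cmp_intros]: "cmp f \<Longrightarrow> cmp g \<Longrightarrow> cmp (\<lambda>x. f x - g x)"
  unfolding cmp_def by (rule rcomp_diff)

lemma cmp_compose2:
  assumes "cmp (\<lambda>z. F (pfst z) (psnd z))" "cmp f" "cmp g"
  shows "cmp (\<lambda>x. F (f x) (g x))"
  using cmp_compose[OF assms(1) cmp_pr[OF assms(2,3)]] by simp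

lemma cmp_compose3:
  assumes "cmp (\<lambda>z. F (pfst z) (pfst (psnd z)) (psnd (psnd z)))" "cmp f" "cmp g" "cmp h"
  shows "cmp (\<lambda>x. F (f x) (g x) (h x))"
  using cmp_compose[OF assms(1) cmp_pr[OF assms(2) cmp_pr[OF assms(3,4)]]] by simp

lemma dec_compose2:
  assumes "dec (\<lambda>z. P (pfst z) (psnd z))" "cmp f" "cmp g"
  shows "dec (\<lambda>x. P (f x) (g x))"
  using dec_compose[OF assms(1) cmp_pr[OF assms(2,3)]] by simp

text \<open>The parameter stays available in every step: \<open>x\<close>, the counter and the
  previous value are packed as \<open>pr x (pr i r)\<close>, so that one unary notion of
  computability is closed under recursion.\<close>

lemma cmp_rec [cmp_intros]:
  assumes b: "cmp b" and s: "cmp (\<lambda>z. s (pfst z) (pfst (psnd z)) (psnd (psnd z)))" and n: "cmp n"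
  shows "cmp (\<lambda>x. rec_nat (b x) (\<lambda>i r. s x i r) (n x))"
proof -
  have "rcomp (Suc (Suc (Suc 0))) (\<lambda>ys. s (ys ! 2) (ys ! 0) (ys ! 1))"
    using rcomp_comp1[OF s[unfolded cmp_def], of "Suc (Suc (Suc 0))"
        "\<lambda>ys. pr (ys ! 2) (pr (ys ! 0) (ys ! 1))"]
    by (simp add: rcomp_pr rcomp_nth)
  then have "rcomp (Suc (Suc 0)) (\<lambda>ys. rec_nat (b (tl ys ! 0)) (\<lambda>i r. s (tl ys ! 0) i r) (hd ys))"
    using rcomp_rec[OF b[unfolded cmp_def], of "\<lambda>ys. s (ys ! 2) (ys ! 0) (ys ! 1)"] by simp
  then have "rcomp (Suc (Suc 0)) (\<lambda>ys. rec_nat (b (ys ! 1)) (\<lambda>i r. s (ys ! 1) i r) (ys ! 0))"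
    by (rule rcomp_cong) (auto dest: length2)
  from rcomp_comp2[OF this n[unfolded cmp_def] rcomp_nth[of 0]] show ?thesis
    unfolding cmp_def by simp
qed

section \<open>Decidable predicates, bounded quantifiers and minimisation\<close>

lemma dec_not [cmp_intros]: assumes "dec P" shows "dec (\<lambda>x. \<not> P x)"
proof -
  have "(of_bool (\<not> P x) :: nat) = 1 - of_bool (P x)" for x by simp
  then show ?thesis using cmp_diff[OF cmp_const[of 1] assms[unfolded dec_def]]
    unfolding dec_def by simp
qed

lemma dec_zero: assumes "cmp f" shows "dec (\<lambda>x. f x = 0)"
proof -
  have "(of_bool (f x = 0) :: nat) = 1 - f x" for x by simp
  then show ?thesis using cmp_diff[OF cmp_const[of 1] assms] unfolding dec_def by simp
qed

lemma dec_nonzero: "cmp f \<Longrightarrow> dec (\<lambda>x. f x \<noteq> 0)"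
  using dec_not[OF dec_zero] .

lemma dec_cong: "dec P \<Longrightarrow> (\<And>x. P x \<longleftrightarrow> Q x) \<Longrightarrow> dec Q"
  by (simp add: dec_def)

lemma dec_disj [cmp_intros]: "dec P \<Longrightarrow> dec Q \<Longrightarrow> dec (\<lambda>x. P x \<or> Q x)"
  using dec_nonzero[of "\<lambda>x. of_bool (P x) + of_bool (Q x)"] cmp_add
  by (simp add: dec_def)

lemma dec_conj [cmp_intros]: "dec P \<Longrightarrow> dec Q \<Longrightarrow> dec (\<lambda>x. P x \<and> Q x)"
  using dec_not[OF dec_disj[OF dec_not[of P] dec_not[of Q]]] by simp

lemma dec_imp [cmp_intros]: "dec P \<Longrightarrow> dec Q \<Longrightarrow> dec (\<lambda>x. P x \<longrightarrow> Q x)"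
  using dec_disj[OF dec_not[of P], of Q] by simp

lemma dec_le [cmp_intros]: "cmp f \<Longrightarrow> cmp g \<Longrightarrow> dec (\<lambda>x. f x \<le> g x)"
  using dec_zero[OF cmp_diff[of f g]] by simp

lemma dec_less [cmp_intros]: "cmp f \<Longrightarrow> cmp g \<Longrightarrow> dec (\<lambda>x. f x < g x)"
  using dec_not[OF dec_le[of g f]] by (simp add: not_le)

lemma dec_eq [cmp_intros]: "cmp f \<Longrightarrow> cmp g \<Longrightarrow> dec (\<lambda>x. f x = g x)"
  using dec_conj[OF dec_le[of f g] dec_le[of g f]] by (simp add: eq_iff)

lemma dec_iff [cmp_intros]: "dec P \<Longrightarrow> dec Q \<Longrightarrow> dec (\<lambda>x. P x \<longleftrightarrow> Q x)"
  by (rule dec_cong[OF dec_conj[OF dec_imp[of P Q] dec_imp[of Q P]]]) auto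

lemma dec_const [cmp_intros]: "dec (\<lambda>x. c)"
  unfolding dec_def by (rule cmp_const)

lemma cmp_if [cmp_intros]:
  assumes "dec P" "cmp f" "cmp g" shows "cmp (\<lambda>x. if P x then f x else g x)"
proof -
  have "cmp (\<lambda>x. rec_nat (g x) (\<lambda>i r. f x) (of_bool (P x)))"
    by (intro cmp_rec assms[unfolded dec_def] cmp_compose[OF assms(2)] cmp_intros)
  moreover have "rec_nat (g x) (\<lambda>i r. f x) (of_bool (P x)) = (if P x then f x else g x)" for x
    by simp
  ultimately show ?thesis by simp
qed

lemma dec_if [cmp_intros]:
  assumes "dec P" "dec Q" "dec R" shows "dec (\<lambda>x. if P x then Q x else R x)"
  by (rule dec_cong[of "\<lambda>x. (P x \<longrightarrow> Q x) \<and> (\<not> P x \<longrightarrow> R x)"]) (intro cmp_intros assms, auto)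

lemma cmp_of_bool [cmp_intros]: "dec P \<Longrightarrow> cmp (\<lambda>x. of_bool (P x))"
  by (simp add: dec_def)

lemma cmp_mult [cmp_intros]:
  assumes "cmp f" "cmp g" shows "cmp (\<lambda>x. f x * g x)"
proof -
  have "cmp (\<lambda>x. rec_nat 0 (\<lambda>i r. r + g x) (f x))"
    by (intro cmp_intros assms cmp_compose[OF assms(2)])
  moreover have "rec_nat 0 (\<lambda>i r. r + b) a = a * b" for a b :: nat by (induction a) auto
  ultimately show ?thesis by simp
qed

lemma cmp_power [cmp_intros]:
  assumes "cmp f" "cmp g" shows "cmp (\<lambda>x. f x ^ g x)"
proof -
  have "cmp (\<lambda>x. rec_nat 1 (\<lambda>i r. r * f x) (g x))"
    by (intro cmp_intros assms cmp_compose[OF assms(1)])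
  moreover have "rec_nat 1 (\<lambda>i r. r * a) b = a ^ b" for a b :: nat by (induction b) auto
  ultimately show ?thesis by simp
qed

lemma dec_ball_less [cmp_intros]:
  assumes "cmp f" "dec (\<lambda>z. P (pfst z) (psnd z))"
  shows "dec (\<lambda>x. \<forall>k<f x. P x k)"
proof -
  have P: "cmp (\<lambda>z. of_bool (P (pfst z) (pfst (psnd z))))"
    using dec_compose2[of P, OF assms(2), of pfst "\<lambda>z. pfst (psnd z)"]
    by (simp add: dec_def cmp_intros)
  have "cmp (\<lambda>x. rec_nat 1 (\<lambda>k r. r * of_bool (P x k)) (f x))"
    by (intro cmp_intros assms P)
  moreover have "rec_nat (1::nat) (\<lambda>k r. r * of_bool (P x k)) n = of_bool (\<forall>k<n. P x k)" for x n
    by (induction n) (auto simp: less_Suc_eq)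
  ultimately show ?thesis by (simp add: dec_def)
qed

lemma dec_bex_less [cmp_intros]:
  assumes "cmp f" "dec (\<lambda>z. P (pfst z) (psnd z))"
  shows "dec (\<lambda>x. \<exists>k<f x. P x k)"
  using dec_not[OF dec_ball_less[OF assms(1) dec_not[OF assms(2)]]] by simp

text \<open>The premise \<open>ex\<close> keeps the search total. \<open>Mu\<close> searches in its
  first argument, which is why the two arguments of \<open>P\<close> change places.\<close>

lemma cmp_Least [cmp_intros]:
  assumes ex: "\<And>x. \<exists>n. P x n" and P: "dec (\<lambda>z. P (pfst z) (psnd z))"
  shows "cmp (\<lambda>x. LEAST n. P x n)"
proof -
  have "rcomp (Suc (Suc 0)) (\<lambda>ys. of_bool (\<not> P (ys ! 1) (ys ! 0)))"
    using rcomp_comp1[OF dec_not[OF P, unfolded dec_def cmp_def], of "Suc (Suc 0)"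
        "\<lambda>ys. pr (ys ! 1) (ys ! 0)"]
    by (simp add: rcomp_pr rcomp_nth)
  from rcomp_least[OF this] ex
  have "rcomp (Suc 0) (\<lambda>xs. LEAST n. of_bool (\<not> P ((n # xs) ! 1) ((n # xs) ! 0)) = (0::nat))"
    by simp
  then show ?thesis by (simp add: cmp_def)
qed

text \<open>The disjunct \<open>y = 0\<close> makes the search stop at 0, the value of division by
  zero.\<close>

lemma div_Least: "(x::nat) div y = (LEAST q. y = 0 \<or> x < Suc q * y)"
proof (rule Least_equality[symmetric])
  show "y = 0 \<or> x < Suc (x div y) * y"
    using dividend_less_div_times[of y x] by auto
  fix q assume "y = 0 \<or> x < Suc q * y"
  then show "x div y \<le> q"
    by (metis div_by_0 le0 less_mult_imp_div_less less_Suc_eq_le)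
qed

lemma cmp_div [cmp_intros]:
  assumes "cmp f" "cmp g" shows "cmp (\<lambda>x. f x div g x)"
proof (rule cmp_compose2[OF _ assms])
  have "\<exists>q. y = 0 \<or> x < Suc q * y" for x y :: nat
    by (rule exI[of _ x]) (cases y; simp)
  then show "cmp (\<lambda>z. pfst z div psnd z)"
    unfolding div_Least by (intro cmp_Least cmp_intros)
qed

lemma cmp_mod [cmp_intros]: "cmp f \<Longrightarrow> cmp g \<Longrightarrow> cmp (\<lambda>x. f x mod g x)"
  unfolding modulo_nat_def by (intro cmp_intros)

lemma dec_dvd [cmp_intros]: "cmp f \<Longrightarrow> cmp g \<Longrightarrow> dec (\<lambda>x. f x dvd g x)"
  unfolding dvd_eq_mod_eq_0 by (intro cmp_intros)

lemma dec_set_decode [cmp_intros]: "cmp f \<Longrightarrow> cmp g \<Longrightarrow> dec (\<lambda>x. f x \<in> set_decode (g x))"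
  unfolding set_decode_def mem_Collect_eq by (intro cmp_intros)

text \<open>A code is at least \<open>2 ^ a\<close> for every member \<open>a\<close>. Hence
  quantifiers over coded sets are bounded ones.\<close>

lemma set_decode_less: "a \<in> set_decode x \<Longrightarrow> a < x"
  using subset_decode_imp_le[of "2 ^ a" x] set_encode_inverse[of "{a}"] less_exp[of a]
  by (simp add: set_encode_def) (meson less_exp less_le_trans)

lemma dec_ball_decode [cmp_intros]:
  assumes "cmp f" "dec (\<lambda>z. P (pfst z) (psnd z))"
  shows "dec (\<lambda>x. \<forall>a\<in>set_decode (f x). P x a)"
proof -
  have "dec (\<lambda>x. \<forall>a<f x. a \<in> set_decode (f x) \<longrightarrow> P x a)"
    by (intro cmp_intros assms cmp_compose[OF assms(1)])
  then show ?thesis by (rule dec_cong) (auto dest: set_decode_less)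
qed

lemma dec_bex_decode [cmp_intros]:
  assumes "cmp f" "dec (\<lambda>z. P (pfst z) (psnd z))"
  shows "dec (\<lambda>x. \<exists>a\<in>set_decode (f x). P x a)"
  using dec_not[OF dec_ball_decode[OF assms(1) dec_not[OF assms(2)]]] by simp

lemma cmp_funpow:
  assumes "cmp F" "cmp f" "cmp g" shows "cmp (\<lambda>x. (F ^^ f x) (g x))"
proof -
  have "cmp (\<lambda>x. rec_nat (g x) (\<lambda>i r. F r) (f x))"
    by (intro cmp_intros assms cmp_compose[OF assms(1)])
  moreover have "rec_nat b (\<lambda>i r. F r) a = (F ^^ a) b" for a b by (induction a) auto
  ultimately show ?thesis by simp
qed

subsection \<open>Course-of-values recursion\<close>

text \<open>The history of the values below \<open>z\<close> is a stack with the most recent value on top.\<close>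

definition look :: "nat \<Rightarrow> nat \<Rightarrow> nat \<Rightarrow> nat" where
  "look z h y = (if y < z then pfst ((psnd ^^ (z - 1 - y)) h) else 0)"

lemma cmp_look [cmp_intros]: "cmp f \<Longrightarrow> cmp g \<Longrightarrow> cmp h \<Longrightarrow> cmp (\<lambda>x. look (f x) (g x) (h x))"
  unfolding look_def by (intro cmp_intros cmp_funpow) (auto intro: cmp_intros)

text \<open>Primitive recursion carries one number, so the recursion computes the whole stack of
  earlier values and \<open>F\<close> reads its top. Reading at or above \<open>z\<close> yields 0,
  which makes the equation for \<open>F\<close> unconditional. The parameter \<open>p\<close> stays
  fixed throughout.\<close>

theorem course_of_values:
  assumes G: "cmp (\<lambda>w. G (pfst w) (pfst (psnd w)) (look (pfst (psnd w)) (psnd (psnd w))))"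
  obtains F where "cmp (\<lambda>x. F (pfst x) (psnd x))"
    "\<And>p z. F p z = G p z (\<lambda>y. if y < z then F p y else 0)"
proof -
  define H where "H p z = rec_nat 0 (\<lambda>i r. pr (G p i (look i r)) r) z" for p z
  define F where "F p z = pfst (H p (Suc z))" for p z
  have H_Suc: "H p (Suc z) = pr (G p z (look z (H p z))) (H p z)" for p z
    by (simp add: H_def)
  have look: "look z (H p z) = (\<lambda>y. if y < z then F p y else 0)" for p z
  proof -
    have "(psnd ^^ k) (H p (k + y)) = H p y" for k y
      by (induction k) (simp_all add: H_Suc funpow_Suc_right del: funpow.simps)
    then have "(psnd ^^ (z - 1 - y)) (H p z) = H p (Suc y)" if "y < z" for y
      using that by (metis Suc_eq_plus1 Suc_leI diff_diff_left le_add_diff_inverse2 add.commute plus_1_eq_Suc)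
    then show ?thesis by (auto simp: look_def F_def fun_eq_iff)
  qed
  have "cmp (\<lambda>x. F (pfst x) (psnd x))"
    unfolding F_def H_def
    by (intro cmp_pfst cmp_rec cmp_const cmp_Suc cmp_psnd cmp_id cmp_pr)
      (rule cmp_compose3[OF G]; intro cmp_intros)
  moreover have "F p z = G p z (\<lambda>y. if y < z then F p y else 0)" for p z
    by (simp add: F_def H_Suc look)
  ultimately show ?thesis by (rule that)
qed

section \<open>Products in finite semigroups\<close>

text \<open>Product of the factors from \<open>i\<close> up to but not including \<open>j\<close>. A
  semigroup has no unit, so empty ranges take the default value \<open>x i\<close>; the test
  \<open>j \<le> i\<close>, made where the bound is \<open>Suc j\<close>, merges this default with
  the genuine one-factor product.\<close>

fun sprod :: "('a \<Rightarrow> 'a \<Rightarrow> 'a) \<Rightarrow> (nat \<Rightarrow> 'a) \<Rightarrow> nat \<Rightarrow> nat \<Rightarrow> 'a" where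
  "sprod m x i 0 = x i"
| "sprod m x i (Suc j) = (if j \<le> i then x i else m (sprod m x i j) (x j))"

lemma sprod_Suc_self [simp]: "sprod m x i (Suc i) = x i"
  by simp

text \<open>A Ramsey factorisation of the infinite word \<open>x\<close>: a prefix with product
  \<open>s\<close>, then blocks with the idempotent product \<open>e\<close>. The first cut is
  positive so that the prefix is non-empty.\<close>

definition factor :: "('a \<Rightarrow> 'a \<Rightarrow> 'a) \<Rightarrow> (nat \<Rightarrow> 'a) \<Rightarrow> (nat \<Rightarrow> nat) \<Rightarrow> 'a \<Rightarrow> 'a \<Rightarrow> bool" where
  "factor m x \<rho> s e \<longleftrightarrow> strict_mono \<rho> \<and> 0 < \<rho> 0 \<and> sprod m x 0 (\<rho> 0) = s \<and>
     (\<forall>i. sprod m x (\<rho> i) (\<rho> (Suc i)) = e) \<and> m s e = s \<and> m e e = e"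

locale fin_semigroup =
  fixes mul :: "'a \<Rightarrow> 'a \<Rightarrow> 'a" and C :: "'a set"
  assumes assoc: "mul (mul a b) c = mul a (mul b c)"
    and fin: "finite C"
    and closed: "a \<in> C \<Longrightarrow> b \<in> C \<Longrightarrow> mul a b \<in> C"
begin

lemma sprod_split: "i < j \<Longrightarrow> j < k \<Longrightarrow> sprod mul x i k = mul (sprod mul x i j) (sprod mul x j k)"
proof (induction k)
  case (Suc k)
  show ?case
  proof (cases "k = j")
    case False
    with Suc show ?thesis by (simp add: assoc)
  qed (use Suc in simp)
qed simp

lemma sprod_in: "i < j \<Longrightarrow> (\<And>k. i \<le> k \<Longrightarrow> k < j \<Longrightarrow> x k \<in> C) \<Longrightarrow> sprod mul x i j \<in> C"
proof (induction j)
  case (Suc j)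
  then show ?case by (cases "j = i") (auto intro: closed)
qed simp

text \<open>Ramsey's theorem for the colouring of \<open>i < j\<close> by the product of the segment
  and the state at \<open>i\<close>. A constant state at the cuts makes each block a loop, which is
  how certificates are applied.\<close>

lemma factor_exists_state:
  assumes x: "\<And>i. x i \<in> C" and Q: "finite Q" "\<And>i. q i \<in> Q"
  obtains \<rho> s e p where "factor mul x \<rho> s e" "\<And>i. q (\<rho> i) = p" "s \<in> C" "e \<in> C"
proof -
  obtain f :: "'a \<times> 'b \<Rightarrow> nat" and n where f: "f ` (C \<times> Q) = {i. i < n}" "inj_on f (C \<times> Q)"
    using finite_imp_inj_to_nat_seg[of "C \<times> Q"] fin Q(1) by auto
  \<comment> \<open>The colouring lives on two-element sets and uses numbers as colours: minimum and
    maximum restore the order, and \<open>f\<close> numbers the pairs of product and state.\<close>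
  define c where "c Z = f (sprod mul x (Min Z) (Max Z), q (Min Z))" for Z :: "nat set"
  have c: "c {i, j} = f (sprod mul x i j, q i)" if "i < j" for i j
    using that by (simp add: c_def min_def max_def)
  have cn: "c {i, j} < n" if "i < j" for i j
    using f(1) sprod_in[OF that, of x] x Q(2)[of i] c[OF that] by auto
  have "\<forall>i\<in>UNIV. \<forall>j\<in>UNIV. i \<noteq> j \<longrightarrow> c {i, j} < n"
  proof (intro ballI impI)
    fix i j :: nat assume "i \<noteq> j"
    then show "c {i, j} < n" using cn[of i j] cn[of j i] by (auto simp: neq_iff insert_commute)
  qed
  from Ramsey2[OF infinite_UNIV_nat this] obtain Y t where "infinite Y"
    and "\<forall>i\<in>Y. \<forall>j\<in>Y. i \<noteq> j \<longrightarrow> c {i, j} = t" by auto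
  then have Y: "infinite Y" "\<And>i j. i \<in> Y \<Longrightarrow> j \<in> Y \<Longrightarrow> i \<noteq> j \<Longrightarrow> c {i, j} = t" by auto
  \<comment> \<open>The least element of \<open>Y\<close> is held back: it makes
    \<open>\<rho> 0\<close> positive and lets \<open>s\<close> end in a factor \<open>e\<close>,
    whence \<open>s e = s\<close>.\<close>
  define \<rho> where "\<rho> i = enumerate Y (Suc i)" for i
  have mono: "strict_mono \<rho>"
    unfolding \<rho>_def strict_mono_def using Y(1) by (simp add: enumerate_mono)
  have mem: "\<rho> i \<in> Y" for i unfolding \<rho>_def using Y(1) by (rule enumerate_in_set)
  have pos: "enumerate Y 0 < \<rho> 0" "enumerate Y 0 \<in> Y"
    unfolding \<rho>_def using Y(1) by (auto simp: enumerate_in_set enumerate_mono)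
  define e where "e = sprod mul x (\<rho> 0) (\<rho> 1)"
  have eq: "sprod mul x i j = e \<and> q i = q (\<rho> 0)" if "i \<in> Y" "j \<in> Y" "i < j" for i j
  proof -
    have lt: "\<rho> 0 < \<rho> 1" using mono by (simp add: strict_mono_less)
    have "c {i, j} = c {\<rho> 0, \<rho> 1}" using Y(2) that mem lt by (metis nat_neq_iff)
    then have "f (sprod mul x i j, q i) = f (e, q (\<rho> 0))"
      using c[OF that(3)] c[OF lt] by (simp add: e_def)
    moreover have "(sprod mul x i j, q i) \<in> C \<times> Q" "(e, q (\<rho> 0)) \<in> C \<times> Q"
      using that lt x Q(2) by (auto simp: e_def intro: sprod_in)
    ultimately show ?thesis using f(2) by (auto dest: inj_onD)
  qed
  have ee: "mul e e = e"
  proof -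
    have "\<rho> 0 < \<rho> 1" "\<rho> 1 < \<rho> 2" using mono by (simp_all add: strict_mono_less)
    then show ?thesis
      using sprod_split[of "\<rho> 0" "\<rho> 1" "\<rho> 2" x] eq mem by (metis order.strict_trans)
  qed
  define s where "s = sprod mul x 0 (\<rho> 0)"
  have se: "mul s e = s"
  proof (cases "enumerate Y 0 = 0")
    case True
    then show ?thesis using eq[of 0 "\<rho> 0"] pos mem ee by (simp add: s_def)
  next
    case False
    then have "s = mul (sprod mul x 0 (enumerate Y 0)) e"
      using sprod_split[of 0 "enumerate Y 0" "\<rho> 0" x] eq[of "enumerate Y 0" "\<rho> 0"] pos mem
      by (simp add: s_def)
    then show ?thesis by (simp add: assoc ee)
  qed
  have "\<rho> i < \<rho> (Suc i)" for i using mono by (simp add: strict_mono_less)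
  then have "factor mul x \<rho> s e"
    unfolding factor_def using mono pos eq mem s_def se ee by auto
  moreover have "q (\<rho> i) = q (\<rho> 0)" for i
    using eq mem \<open>\<And>i. \<rho> i < \<rho> (Suc i)\<close> by blast
  moreover have "s \<in> C" "e \<in> C"
    using x pos mono by (auto simp: s_def e_def strict_mono_less intro: sprod_in)
  ultimately show ?thesis by (rule that)
qed

lemma factor_exists:
  assumes "\<And>i. x i \<in> C"
  obtains \<rho> s e where "factor mul x \<rho> s e" "s \<in> C" "e \<in> C"
  using factor_exists_state[of x "{()}" "\<lambda>_. ()"] assms by (metis finite.emptyI finite_insert insertI1)

end

section \<open>Right continuous signals\<close>

text \<open>Local form of the definition of signals: constancy to the right of each point expresses
  right continuity, constancy to the left excludes an accumulation of changes. Unlike a sequence of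
  breakpoints it passes to compositions and gluings at once.\<close>

definition lconst :: "(real \<Rightarrow> 'a) \<Rightarrow> bool" where
  "lconst f \<longleftrightarrow> (\<forall>t\<ge>0. \<exists>\<epsilon>>0. \<exists>a. \<forall>s\<in>{t..<t+\<epsilon>}. f s = a) \<and>
     (\<forall>t>0. \<exists>\<epsilon>>0. \<exists>a. \<forall>s\<in>{t-\<epsilon>..<t}. 0 \<le> s \<longrightarrow> f s = a)"

lemma lconst_right:
  assumes "lconst f" "0 \<le> t"
  obtains \<epsilon> where "\<epsilon> > 0" "\<And>s. s \<in> {t..<t+\<epsilon>} \<Longrightarrow> f s = f t"
proof -
  have "\<exists>\<epsilon>>0. \<exists>a. \<forall>s\<in>{t..<t+\<epsilon>}. f s = a" using assms by (simp add: lconst_def)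
  then obtain \<epsilon> a where *: "\<epsilon> > 0" "\<forall>s\<in>{t..<t+\<epsilon>}. f s = a" by (elim exE conjE)
  show ?thesis
  proof (rule that[OF *(1)])
    fix s assume "s \<in> {t..<t+\<epsilon>}"
    then have "f s = a" using *(2) by blast
    moreover have "f t = a" using * by simp
    ultimately show "f s = f t" by simp
  qed
qed

lemma lconst_left:
  assumes "lconst f" "0 < t"
  obtains \<epsilon> a where "\<epsilon> > 0" "\<And>s. s \<in> {t-\<epsilon>..<t} \<Longrightarrow> 0 \<le> s \<Longrightarrow> f s = a"
proof -
  have "\<exists>\<epsilon>>0. \<exists>a. \<forall>s\<in>{t-\<epsilon>..<t}. 0 \<le> s \<longrightarrow> f s = a" using assms by (simp add: lconst_def)
  then obtain \<epsilon> a where "\<epsilon> > 0" "\<forall>s\<in>{t-\<epsilon>..<t}. 0 \<le> s \<longrightarrow> f s = a" by (elim exE conjE)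
  then show ?thesis by (intro that[of \<epsilon> a]) blast+
qed

lemma interval_index:
  fixes \<tau> :: "nat \<Rightarrow> real"
  assumes "\<not> bdd_above (range \<tau>)" "\<tau> 0 \<le> t"
  obtains i where "\<tau> i \<le> t" "t < \<tau> (Suc i)"
proof -
  obtain j where "t < \<tau> j" using assms(1) by (auto simp: bdd_above_def not_le)
  define k where "k = (LEAST j. t < \<tau> j)"
  have "t < \<tau> k" unfolding k_def using \<open>t < \<tau> j\<close> by (rule LeastI)
  then obtain i where i: "k = Suc i" using assms(2) by (cases k) auto
  then have "\<not> t < \<tau> i" using not_less_Least[of i "\<lambda>j. t < \<tau> j"] by (simp add: k_def)
  then show ?thesis using that[of i] \<open>t < \<tau> k\<close> i by simp
qed

lemma interval_index':
  fixes \<tau> :: "nat \<Rightarrow> real"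
  assumes "\<not> bdd_above (range \<tau>)" "\<tau> 0 < t"
  obtains i where "\<tau> i < t" "t \<le> \<tau> (Suc i)"
proof -
  obtain j where "t \<le> \<tau> j" using assms(1) by (auto simp: bdd_above_def not_le intro: less_imp_le)
  define k where "k = (LEAST j. t \<le> \<tau> j)"
  have "t \<le> \<tau> k" unfolding k_def using \<open>t \<le> \<tau> j\<close> by (rule LeastI)
  then obtain i where i: "k = Suc i" using assms(2) by (cases k) auto
  then have "\<not> t \<le> \<tau> i" using not_less_Least[of i "\<lambda>j. t \<le> \<tau> j"] by (simp add: k_def)
  then show ?thesis using that[of i] \<open>t \<le> \<tau> k\<close> i by simp
qed

text \<open>The sequence converges from the left to its supremum, and the signal is constant just
  before it. Both directions of the game argument use this against infinitely many changes in
  bounded time.\<close>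

lemma lconst_no_zeno:
  fixes \<tau> :: "nat \<Rightarrow> real"
  assumes f: "lconst f" and \<tau>: "strict_mono \<tau>" "0 \<le> \<tau> 0" "bdd_above (range \<tau>)"
  obtains N where "\<And>i. N \<le> i \<Longrightarrow> f (\<tau> i) = f (\<tau> N)"
proof -
  define T where "T = (SUP i. \<tau> i)"
  have lt: "\<tau> i < T" for i
  proof -
    have "\<tau> i < \<tau> (Suc i)" using \<tau>(1) by (simp add: strict_mono_less)
    also have "\<dots> \<le> T" unfolding T_def using \<tau>(3) by (intro cSUP_upper) auto
    finally show ?thesis .
  qed
  have "0 < T" using lt[of 0] \<tau>(2) by simp
  then obtain \<epsilon> a where \<epsilon>: "\<epsilon> > 0" "\<And>s. s \<in> {T-\<epsilon>..<T} \<Longrightarrow> 0 \<le> s \<Longrightarrow> f s = a"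
    using lconst_left[OF f] by blast
  obtain N where "T - \<epsilon> < \<tau> N"
    using less_cSUP_iff[of UNIV \<tau> "T - \<epsilon>"] \<tau>(3) \<epsilon>(1) by (auto simp: T_def)
  have "f (\<tau> i) = a" if "N \<le> i" for i
  proof (rule \<epsilon>(2))
    have "\<tau> N \<le> \<tau> i" "\<tau> 0 \<le> \<tau> i" using \<tau>(1) that by (simp_all add: strict_mono_less_eq)
    then show "\<tau> i \<in> {T-\<epsilon>..<T}" "0 \<le> \<tau> i" using lt[of i] \<open>T - \<epsilon> < \<tau> N\<close> \<tau>(2) by auto
  qed
  then show ?thesis using that[of N] by simp
qed

text \<open>Including \<open>p\<close> makes the set non-empty, so the infimum is the first change
  after \<open>t\<close> or the deadline \<open>p\<close>, whichever comes first.\<close>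

definition nxt :: "(real \<Rightarrow> 'a) \<Rightarrow> real \<Rightarrow> real \<Rightarrow> real" where
  "nxt f t p = Inf ({s. t < s \<and> f s \<noteq> f t} \<union> {p})"

lemma nxt_le: "t < p \<Longrightarrow> nxt f t p \<le> p"
  unfolding nxt_def by (rule cInf_lower) (auto intro!: bdd_belowI[of _ t])

lemma nxt_const: assumes "t < p" "s \<in> {t..<nxt f t p}" shows "f s = f t"
proof (rule ccontr)
  assume "f s \<noteq> f t"
  then have "nxt f t p \<le> s" unfolding nxt_def
    using assms by (intro cInf_lower) (auto intro!: bdd_belowI[of _ t] simp: less_le)
  then show False using assms by simp
qed

lemma nxt_greater: assumes "lconst f" "0 \<le> t" "t < p" shows "t < nxt f t p"
proof -
  obtain \<epsilon> where \<epsilon>: "\<epsilon> > 0" "\<And>s. s \<in> {t..<t+\<epsilon>} \<Longrightarrow> f s = f t"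
    using lconst_right[OF assms(1,2)] by blast
  have "min p (t + \<epsilon>) \<le> s" if "s \<in> {s. t < s \<and> f s \<noteq> f t} \<union> {p}" for s
  proof (cases "s = p")
    case False
    then have "t < s" "f s \<noteq> f t" using that by auto
    then have "s \<notin> {t..<t+\<epsilon>}" using \<epsilon>(2) by blast
    then show ?thesis using \<open>t < s\<close> by auto
  qed simp
  then have "min p (t + \<epsilon>) \<le> nxt f t p" unfolding nxt_def by (intro cInf_greatest) auto
  then show ?thesis using \<epsilon>(1) assms(3) by linarith
qed

text \<open>By right continuity the infimum of the later points with another value is itself such a
  point.\<close>

lemma nxt_change:
  assumes "lconst f" "0 \<le> t" "t < p" "nxt f t p < p" shows "f (nxt f t p) \<noteq> f t"
proof
  assume eq: "f (nxt f t p) = f t"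
  have "0 \<le> nxt f t p" using nxt_greater[OF assms(1-3)] assms(2) by simp
  then obtain \<epsilon> where \<epsilon>: "\<epsilon> > 0" "\<And>s. s \<in> {nxt f t p..<nxt f t p+\<epsilon>} \<Longrightarrow> f s = f (nxt f t p)"
    using lconst_right[OF assms(1)] by blast
  have "min p (nxt f t p + \<epsilon>) \<le> s" if "s \<in> {s. t < s \<and> f s \<noteq> f t} \<union> {p}" for s
  proof (cases "s = p")
    case False
    then have s: "t < s" "f s \<noteq> f t" using that by auto
    then have "s \<notin> {nxt f t p..<nxt f t p+\<epsilon>}" using \<epsilon>(2)[of s] eq by argo
    moreover have "s \<notin> {t..<nxt f t p}" using s(2) nxt_const[OF assms(3), of s f] by blast
    ultimately show ?thesis using s(1) by auto
  qed simp
  then have "min p (nxt f t p + \<epsilon>) \<le> nxt f t p"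
    by (subst (2) nxt_def, intro cInf_greatest) auto
  then show False using \<epsilon>(1) assms(4) by linarith
qed

text \<open>A change is known once it has happened: its time depends only on the part of the signal
  up to it. This yields the causality of the operator that is built from ticks.\<close>

lemma nxt_cong:
  assumes "\<And>s. s \<in> {t..<q} \<Longrightarrow> f s = g s" "t < q" "t < p"
  shows "nxt f t p < q \<longleftrightarrow> nxt g t p < q" "nxt f t p < q \<Longrightarrow> nxt f t p = nxt g t p"
proof -
  have *: "nxt g t p \<le> nxt f t p" if lt: "nxt f t p < q" and eq: "\<And>s. s \<in> {t..<q} \<Longrightarrow> f s = g s"
    for f g :: "real \<Rightarrow> 'a"
  proof -
    have "nxt g t p \<le> s" if "s \<in> {s. t < s \<and> f s \<noteq> f t} \<union> {p}" "s < q" for s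
      unfolding nxt_def using that eq[of s] eq[of t] assms(2)
      by (intro cInf_lower) (auto intro!: bdd_belowI[of _ t] simp: assms(3) less_imp_le)
    then have "nxt g t p \<le> s \<or> q \<le> s" if "s \<in> {s. t < s \<and> f s \<noteq> f t} \<union> {p}" for s
      using that by force
    then have "min (nxt g t p) q \<le> nxt f t p"
      by (subst (2) nxt_def, intro cInf_greatest) (auto simp: min_le_iff_disj)
    then show ?thesis using lt by linarith
  qed
  show "nxt f t p < q \<longleftrightarrow> nxt g t p < q" using *[of f g] *[of g f] assms(1) by fastforce
  then show "nxt f t p = nxt g t p" if "nxt f t p < q"
    using *[of f g] *[of g f] assms(1) that by fastforce
qed

text \<open>For the converse, each breakpoint moves on to the next change, but by at most one unit,
  since there may be none. Accumulating breakpoints would eventually carry a constant value, hence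
  be full units apart, and so would not accumulate.\<close>

lemma signals_iff: "f \<in> signals \<Sigma> \<longleftrightarrow> f \<in> {0..} \<rightarrow>\<^sub>E \<Sigma> \<and> lconst f"
proof
  assume "f \<in> signals \<Sigma>"
  then have E: "f \<in> {0..} \<rightarrow>\<^sub>E \<Sigma>" and "\<exists>\<tau>::nat \<Rightarrow> real. \<tau> 0 = 0 \<and> strict_mono \<tau> \<and>
      \<not> bdd_above (range \<tau>) \<and> (\<forall>i. \<exists>a. \<forall>t\<in>{\<tau> i..<\<tau> (Suc i)}. f t = a)"
    unfolding signals_def by auto
  then obtain \<tau> :: "nat \<Rightarrow> real" where \<tau>: "\<tau> 0 = 0" "strict_mono \<tau>" "\<not> bdd_above (range \<tau>)"
    "\<And>i. \<exists>a. \<forall>t\<in>{\<tau> i..<\<tau> (Suc i)}. f t = a"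
    by auto
  have "lconst f" unfolding lconst_def
  proof (intro conjI allI impI)
    fix t :: real assume "0 \<le> t"
    then obtain i where i: "\<tau> i \<le> t" "t < \<tau> (Suc i)" using interval_index[OF \<tau>(3)] \<tau>(1) by metis
    obtain a where "\<forall>t\<in>{\<tau> i..<\<tau> (Suc i)}. f t = a" using \<tau>(4) by blast
    then show "\<exists>\<epsilon>>0. \<exists>a. \<forall>s\<in>{t..<t+\<epsilon>}. f s = a"
      using i by (intro exI[of _ "\<tau> (Suc i) - t"] conjI exI[of _ a]) auto
  next
    fix t :: real assume "0 < t"
    then obtain i where i: "\<tau> i < t" "t \<le> \<tau> (Suc i)" using interval_index'[OF \<tau>(3)] \<tau>(1) by metis
    obtain a where "\<forall>t\<in>{\<tau> i..<\<tau> (Suc i)}. f t = a" using \<tau>(4) by blast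
    then show "\<exists>\<epsilon>>0. \<exists>a. \<forall>s\<in>{t-\<epsilon>..<t}. 0 \<le> s \<longrightarrow> f s = a"
      using i by (intro exI[of _ "t - \<tau> i"] conjI exI[of _ a]) auto
  qed
  with E show "f \<in> {0..} \<rightarrow>\<^sub>E \<Sigma> \<and> lconst f" by simp
next
  assume f: "f \<in> {0..} \<rightarrow>\<^sub>E \<Sigma> \<and> lconst f"
  define \<tau> where "\<tau> i = ((\<lambda>t. nxt f t (t + 1)) ^^ i) 0" for i :: nat
  have \<tau>0: "\<tau> 0 = 0" and \<tau>S: "\<tau> (Suc i) = nxt f (\<tau> i) (\<tau> i + 1)" for i
    by (simp_all add: \<tau>_def)
  have \<tau>pos: "0 \<le> \<tau> i" for i
  proof (induction i)
    case (Suc i)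
    then show ?case using nxt_greater[of f "\<tau> i" "\<tau> i + 1"] f by (simp add: \<tau>S)
  qed (simp add: \<tau>0)
  have mono: "strict_mono \<tau>"
    unfolding strict_mono_Suc_iff using nxt_greater[of f "\<tau> i" "\<tau> i + 1" for i] f \<tau>pos by (simp add: \<tau>S)
  have "\<not> bdd_above (range \<tau>)"
  proof
    assume b: "bdd_above (range \<tau>)"
    obtain N where N: "\<And>i. N \<le> i \<Longrightarrow> f (\<tau> i) = f (\<tau> N)"
      using lconst_no_zeno[OF _ mono _ b] f \<tau>pos by metis
    have step: "\<tau> (Suc i) = \<tau> i + 1" if "N \<le> i" for i
    proof -
      have "\<not> nxt f (\<tau> i) (\<tau> i + 1) < \<tau> i + 1"
        using nxt_change[of f "\<tau> i" "\<tau> i + 1"] f \<tau>pos N[of i] N[of "Suc i"] that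
        by (auto simp: \<tau>S)
      then show ?thesis using nxt_le[of "\<tau> i" "\<tau> i + 1" f] by (simp add: \<tau>S)
    qed
    have *: "\<tau> (N + k) = \<tau> N + real k" for k by (induction k) (auto simp: step)
    obtain M where M: "\<tau> i \<le> M" for i using b by (auto simp: bdd_above_def)
    obtain k :: nat where "M - \<tau> N < real k" using reals_Archimedean2 by blast
    then show False using *[of k] M[of "N + k"] by linarith
  qed
  moreover have "\<exists>a. \<forall>t\<in>{\<tau> i..<\<tau> (Suc i)}. f t = a" for i
    unfolding \<tau>S using nxt_const[of "\<tau> i" "\<tau> i + 1" _ f] less_add_one by blast
  ultimately show "f \<in> signals \<Sigma>"
    unfolding signals_def using f \<tau>0 mono by (intro CollectI conjI exI[of _ \<tau>] allI) auto
qed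

section \<open>Closure properties and gluing of signals\<close>

lemma lconst_const: "lconst (\<lambda>_. c)"
  unfolding lconst_def using zero_less_one by blast

lemma lconst_cong: "lconst f \<Longrightarrow> (\<And>t. 0 \<le> t \<Longrightarrow> f t = g t) \<Longrightarrow> lconst g"
  unfolding lconst_def by (fastforce)

lemma lconst_compose: "lconst f \<Longrightarrow> lconst (\<lambda>t. h (f t))"
  unfolding lconst_def by metis

text \<open>\<open>lconst\<close> relative to \<open>{u..<v}\<close>: the neighbourhoods are cut off
  at the ends, so pieces can be built separately and glued.\<close>

definition pc :: "(real \<Rightarrow> 'a) \<Rightarrow> real \<Rightarrow> real \<Rightarrow> bool" where
  "pc f u v \<longleftrightarrow> (\<forall>t\<in>{u..<v}. \<exists>\<epsilon>>0. \<exists>a. \<forall>s\<in>{t..<t+\<epsilon>}. s < v \<longrightarrow> f s = a) \<and>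
     (\<forall>t\<in>{u<..v}. \<exists>\<epsilon>>0. \<exists>a. \<forall>s\<in>{t-\<epsilon>..<t}. u \<le> s \<longrightarrow> f s = a)"

lemma pc_const: "pc (\<lambda>_. c) u v"
  unfolding pc_def using zero_less_one by blast

lemma pc_glue:
  fixes \<kappa> :: "nat \<Rightarrow> real"
  assumes \<kappa>: "strict_mono \<kappa>" "\<kappa> 0 = 0" "\<not> bdd_above (range \<kappa>)"
    and f: "\<And>i. pc (f i) (\<kappa> i) (\<kappa> (Suc i))"
    and g: "\<And>i t. t \<in> {\<kappa> i..<\<kappa> (Suc i)} \<Longrightarrow> g t = f i t"
  shows "lconst g"
  unfolding lconst_def
proof (intro conjI allI impI)
  fix t :: real assume "0 \<le> t"
  then obtain i where i: "t \<in> {\<kappa> i..<\<kappa> (Suc i)}" using interval_index[OF \<kappa>(3)] \<kappa>(2) by force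
  then obtain \<epsilon> a where "\<epsilon> > 0" "\<forall>s\<in>{t..<t+\<epsilon>}. s < \<kappa> (Suc i) \<longrightarrow> f i s = a"
    using f[of i] unfolding pc_def by blast
  then show "\<exists>\<epsilon>>0. \<exists>a. \<forall>s\<in>{t..<t+\<epsilon>}. g s = a"
    using i g[of _ i] by (intro exI[of _ "min \<epsilon> (\<kappa> (Suc i) - t)"] conjI exI[of _ a]) auto
next
  fix t :: real assume "0 < t"
  then obtain i where i: "t \<in> {\<kappa> i<..\<kappa> (Suc i)}" using interval_index'[OF \<kappa>(3)] \<kappa>(2) by force
  then obtain \<epsilon> a where "\<epsilon> > 0" "\<forall>s\<in>{t-\<epsilon>..<t}. \<kappa> i \<le> s \<longrightarrow> f i s = a"
    using f[of i] unfolding pc_def by blast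
  then show "\<exists>\<epsilon>>0. \<exists>a. \<forall>s\<in>{t-\<epsilon>..<t}. 0 \<le> s \<longrightarrow> g s = a"
    using i g[of _ i] by (intro exI[of _ "min \<epsilon> (t - \<kappa> i)"] conjI exI[of _ a]) auto
qed

lemma pc_concat:
  assumes f: "pc f u m" and g: "pc g m v"
  shows "pc (\<lambda>t. if t < m then f t else g t) u v"
  unfolding pc_def
proof (intro conjI ballI)
  fix t assume t: "t \<in> {u..<v}"
  show "\<exists>\<epsilon>>0. \<exists>a. \<forall>s\<in>{t..<t+\<epsilon>}. s < v \<longrightarrow> (if s < m then f s else g s) = a"
  proof (cases "t < m")
    case True
    then obtain \<epsilon> a where "\<epsilon> > 0" "\<forall>s\<in>{t..<t+\<epsilon>}. s < m \<longrightarrow> f s = a"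
      using f t unfolding pc_def by (meson atLeastLessThan_iff)
    then show ?thesis using True by (intro exI[of _ "min \<epsilon> (m - t)"] conjI exI[of _ a]) auto
  next
    case False
    then obtain \<epsilon> a where "\<epsilon> > 0" "\<forall>s\<in>{t..<t+\<epsilon>}. s < v \<longrightarrow> g s = a"
      using g t unfolding pc_def by (metis atLeastLessThan_iff not_less)
    then show ?thesis using False by (intro exI[of _ \<epsilon>] conjI exI[of _ a]) auto
  qed
next
  fix t assume t: "t \<in> {u<..v}"
  show "\<exists>\<epsilon>>0. \<exists>a. \<forall>s\<in>{t-\<epsilon>..<t}. u \<le> s \<longrightarrow> (if s < m then f s else g s) = a"
  proof (cases "t \<le> m")
    case True
    then obtain \<epsilon> a where "\<epsilon> > 0" "\<forall>s\<in>{t-\<epsilon>..<t}. u \<le> s \<longrightarrow> f s = a"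
      using f t unfolding pc_def by (meson greaterThanAtMost_iff)
    then show ?thesis using True by (intro exI[of _ \<epsilon>] conjI exI[of _ a]) auto
  next
    case False
    then obtain \<epsilon> a where "\<epsilon> > 0" "\<forall>s\<in>{t-\<epsilon>..<t}. m \<le> s \<longrightarrow> g s = a"
      using g t unfolding pc_def by (metis greaterThanAtMost_iff not_less)
    then show ?thesis using False by (intro exI[of _ "min \<epsilon> (t - m)"] conjI exI[of _ a]) auto
  qed
qed

section \<open>Monadic logic of signals and finite semigroups\<close>

text \<open>\<open>First x y z\<close> says that \<open>x \<or> y\<close> holds somewhere and that \<open>z\<close> holds at the first such point.
  A first-order variable becomes a signal variable that stands for the first point at which the signal
  is true.\<close>

datatype sform = First nat nat nat | Nand sform sform | ExS nat sform

primrec fvs :: "sform \<Rightarrow> nat set" where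
  "fvs (First x y z) = {x, y, z}"
| "fvs (Nand \<phi> \<psi>) = fvs \<phi> \<union> fvs \<psi>"
| "fvs (ExS X \<phi>) = fvs \<phi> - {X}"

definition first_at :: "(real \<Rightarrow> bool) \<Rightarrow> real \<Rightarrow> bool" where
  "first_at S t \<longleftrightarrow> 0 \<le> t \<and> S t \<and> (\<forall>s. 0 \<le> s \<and> s < t \<longrightarrow> \<not> S s)"

primrec ssat :: "(nat \<Rightarrow> real \<Rightarrow> bool) \<Rightarrow> sform \<Rightarrow> bool" where
  "ssat V (First x y z) \<longleftrightarrow> (\<exists>t. first_at (\<lambda>t. V x t \<or> V y t) t \<and> V z t)"
| "ssat V (Nand \<phi> \<psi>) \<longleftrightarrow> \<not> (ssat V \<phi> \<and> ssat V \<psi>)"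
| "ssat V (ExS X \<phi>) \<longleftrightarrow> (\<exists>S\<in>signals UNIV. ssat (V(X := S)) \<phi>)"

text \<open>For \<open>First\<close>, 0 means that no point has been found yet and is neutral, and
  the values 1 and 2 are final. \<open>Nand\<close> gives the direct product and \<open>ExS\<close>
  the power semigroup, with finite sets coded as numbers.\<close>

primrec smul :: "sform \<Rightarrow> nat \<Rightarrow> nat \<Rightarrow> nat" where
  "smul (First x y z) = (\<lambda>a b. if a = 0 then b else a)"
| "smul (Nand \<phi> \<psi>) = (\<lambda>a b. pr (smul \<phi> (pfst a) (pfst b)) (smul \<psi> (psnd a) (psnd b)))"
| "smul (ExS X \<phi>) = (\<lambda>a b. set_encode ((\<lambda>(c, d). smul \<phi> c d) ` (set_decode a \<times> set_decode b)))"

text \<open>The subsemigroup generated by \<open>G\<close>.\<close>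

inductive_set gen :: "('a \<Rightarrow> 'a \<Rightarrow> 'a) \<Rightarrow> 'a set \<Rightarrow> 'a set" for m G where
  base: "g \<in> G \<Longrightarrow> g \<in> gen m G"
| step: "a \<in> gen m G \<Longrightarrow> b \<in> gen m G \<Longrightarrow> m a b \<in> gen m G"

text \<open>The value of a piece on which exactly the variables in \<open>L\<close> are true. Inside
  such a piece a quantified signal can switch finitely often in any pattern; so \<open>ExS\<close>
  collects all products of the two letters and not just the letters.\<close>

primrec shom :: "sform \<Rightarrow> nat set \<Rightarrow> nat" where
  "shom (First x y z) L = (if x \<in> L \<or> y \<in> L then if z \<in> L then 1 else 2 else 0)"
| "shom (Nand \<phi> \<psi>) L = pr (shom \<phi> L) (shom \<psi> L)"
| "shom (ExS X \<phi>) L = set_encode (gen (smul \<phi>) {shom \<phi> (insert X L), shom \<phi> (L - {X})})"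

primrec scar :: "sform \<Rightarrow> nat set" where
  "scar (First x y z) = {0, 1, 2}"
| "scar (Nand \<phi> \<psi>) = prod_encode ` (scar \<phi> \<times> scar \<psi>)"
| "scar (ExS X \<phi>) = set_encode ` Pow (scar \<phi>)"

text \<open>The verdict of a linked pair on the whole half line. For \<open>First\<close>,
  \<open>s = 0\<close> and \<open>s e = s\<close> force \<open>e = 0\<close>, so nothing is ever
  found. For \<open>ExS\<close>, a pair of sets is accepted if it contains an accepted linked pair
  of members.\<close>

primrec sacc :: "sform \<Rightarrow> nat \<Rightarrow> nat \<Rightarrow> bool" where
  "sacc (First x y z) = (\<lambda>s e. s = 1)"
| "sacc (Nand \<phi> \<psi>) = (\<lambda>s e. \<not> (sacc \<phi> (pfst s) (pfst e) \<and> sacc \<psi> (psnd s) (psnd e)))"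
| "sacc (ExS X \<phi>) = (\<lambda>s e. \<exists>a\<in>set_decode s. \<exists>b\<in>set_decode e.
     smul \<phi> a b = a \<and> smul \<phi> b b = b \<and> sacc \<phi> a b)"

section \<open>The semigroup of a formula is finite\<close>

lemma gen_subset: "G \<subseteq> C \<Longrightarrow> (\<And>a b. a \<in> C \<Longrightarrow> b \<in> C \<Longrightarrow> m a b \<in> C) \<Longrightarrow> gen m G \<subseteq> C"
proof
  fix x assume "x \<in> gen m G" and *: "G \<subseteq> C" "\<And>a b. a \<in> C \<Longrightarrow> b \<in> C \<Longrightarrow> m a b \<in> C"
  then show "x \<in> C" by induction auto
qed

lemma finite_scar: "finite (scar \<phi>)"
  by (induction \<phi>) auto

lemma smul_assoc: "smul \<phi> (smul \<phi> a b) c = smul \<phi> a (smul \<phi> b c)"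
proof (induction \<phi> arbitrary: a b c)
  case (ExS X \<phi>)
  have "(\<lambda>(c, d). smul \<phi> c d) ` ((\<lambda>(c, d). smul \<phi> c d) ` (A \<times> B) \<times> C) =
    (\<lambda>(c, d). smul \<phi> c d) ` (A \<times> (\<lambda>(c, d). smul \<phi> c d) ` (B \<times> C))" (is "?L = ?R") for A B C
  proof (intro set_eqI iffI)
    fix x assume "x \<in> ?L"
    then obtain p q r where "x = smul \<phi> (smul \<phi> p q) r" "p \<in> A" "q \<in> B" "r \<in> C" by auto
    then show "x \<in> ?R" using ExS by force
  next
    fix x assume "x \<in> ?R"
    then obtain p q r where "x = smul \<phi> p (smul \<phi> q r)" "p \<in> A" "q \<in> B" "r \<in> C" by auto
    then show "x \<in> ?L" using ExS[symmetric] by force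
  qed
  then show ?case by simp
qed auto

lemma smul_scar: "a \<in> scar \<phi> \<Longrightarrow> b \<in> scar \<phi> \<Longrightarrow> smul \<phi> a b \<in> scar \<phi>"
proof (induction \<phi> arbitrary: a b)
  case (ExS X \<phi>)
  then obtain A B where AB: "A \<subseteq> scar \<phi>" "B \<subseteq> scar \<phi>" "a = set_encode A" "b = set_encode B" by auto
  then have "finite A" "finite B" using finite_scar finite_subset by metis+
  then have "(\<lambda>(c, d). smul \<phi> c d) ` (set_decode a \<times> set_decode b) \<subseteq> scar \<phi>"
    using AB ExS.IH by auto
  then show ?case by auto
qed auto

lemma shom_scar: "shom \<phi> L \<in> scar \<phi>"
proof (induction \<phi> arbitrary: L)
  case (ExS X \<phi>)
  have "gen (smul \<phi>) {shom \<phi> (insert X L), shom \<phi> (L - {X})} \<subseteq> scar \<phi>"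
    by (rule gen_subset) (use ExS smul_scar in auto)
  then show ?case by auto
qed auto

lemma finite_gen_shom: "finite (gen (smul \<phi>) {shom \<phi> L, shom \<phi> L'})"
proof (rule finite_subset[OF _ finite_scar[of \<phi>]])
  show "gen (smul \<phi>) {shom \<phi> L, shom \<phi> L'} \<subseteq> scar \<phi>"
    by (rule gen_subset) (use shom_scar smul_scar in auto)
qed

lemma fin_semigroup_smul: "fin_semigroup (smul \<phi>) (scar \<phi>)"
  by unfold_locales (auto intro: smul_assoc finite_scar smul_scar)

text \<open>The value does not depend on the subdivision of the interval, but this is never needed.\<close>

inductive val :: "sform \<Rightarrow> (nat \<Rightarrow> real \<Rightarrow> bool) \<Rightarrow> real \<Rightarrow> real \<Rightarrow> nat \<Rightarrow> bool" for \<phi> V where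
  const: "u < v \<Longrightarrow> (\<And>t X. t \<in> {u..<v} \<Longrightarrow> X \<in> fvs \<phi> \<Longrightarrow> V X t \<longleftrightarrow> X \<in> L) \<Longrightarrow> val \<phi> V u v (shom \<phi> L)"
| concat: "val \<phi> V u m a \<Longrightarrow> val \<phi> V m v b \<Longrightarrow> val \<phi> V u v (smul \<phi> a b)"

lemma val_less: "val \<phi> V u v a \<Longrightarrow> u < v"
  by (induction rule: val.induct) auto

lemma val_scar: "val \<phi> V u v a \<Longrightarrow> a \<in> scar \<phi>"
  by (induction rule: val.induct) (auto intro: shom_scar smul_scar)

lemma val_cong:
  "val \<phi> V u v a \<Longrightarrow> (\<And>t X. t \<in> {u..<v} \<Longrightarrow> X \<in> fvs \<phi> \<Longrightarrow> V X t = W X t) \<Longrightarrow> val \<phi> W u v a"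
proof (induction rule: val.induct)
  case (const u v L)
  then show ?case by (intro val.const) auto
next
  case (concat u m a v b)
  have "u < m" "m < v" using concat.hyps val_less by auto
  then show ?case using concat by (intro val.concat[of _ _ _ m]) auto
qed

lemma val_seq:
  assumes "strict_mono \<kappa>" "\<And>i. val \<phi> V (\<kappa> i) (\<kappa> (Suc i)) (x i)" "i < j"
  shows "val \<phi> V (\<kappa> i) (\<kappa> j) (sprod (smul \<phi>) x i j)"
  using assms(3)
proof (induction j)
  case (Suc j)
  then show ?case using assms(2) by (cases "i = j") (auto intro: val.concat)
qed simp

lemma val_First:
  "val (First x y z) V u v a \<Longrightarrow>
     a = 0 \<and> (\<forall>t\<in>{u..<v}. \<not> (V x t \<or> V y t)) \<or>
     a = 1 \<and> (\<exists>t\<in>{u..<v}. (V x t \<or> V y t) \<and> V z t \<and> (\<forall>s\<in>{u..<t}. \<not> (V x s \<or> V y s))) \<or>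
     a = 2 \<and> (\<exists>t\<in>{u..<v}. (V x t \<or> V y t) \<and> \<not> V z t \<and> (\<forall>s\<in>{u..<t}. \<not> (V x s \<or> V y s)))"
proof (induction rule: val.induct)
  case (const u v L)
  then have "V x t \<longleftrightarrow> x \<in> L" "V y t \<longleftrightarrow> y \<in> L" "V z t \<longleftrightarrow> z \<in> L" if "t \<in> {u..<v}" for t
    using that by auto
  then show ?case using const.hyps(1) by (auto intro!: bexI[of _ u])
next
  case (concat u m a v b)
  have lt: "u < m" "m < v" using concat.hyps val_less by auto
  show ?case
  proof (cases "a = 0")
    case True
    then have a: "\<forall>t\<in>{u..<m}. \<not> (V x t \<or> V y t)" using concat.IH by auto
    from concat.IH(2) consider
      "b = 0" "\<forall>t\<in>{m..<v}. \<not> (V x t \<or> V y t)"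
      | t where "b = 1" "t \<in> {m..<v}" "V x t \<or> V y t" "V z t" "\<forall>s\<in>{m..<t}. \<not> (V x s \<or> V y s)"
      | t where "b = 2" "t \<in> {m..<v}" "V x t \<or> V y t" "\<not> V z t" "\<forall>s\<in>{m..<t}. \<not> (V x s \<or> V y s)"
      by blast
    then show ?thesis
    proof cases
      case 1
      have "\<not> (V x t \<or> V y t)" if "t \<in> {u..<v}" for t
        using that a 1 by (cases "t < m") auto
      then show ?thesis using 1 True by simp
    next
      case (2 t)
      have "\<not> (V x s \<or> V y s)" if "s \<in> {u..<t}" for s
        using that a 2 by (cases "s < m") auto
      then show ?thesis using 2 True lt by (auto intro!: bexI[of _ t])
    next
      case (3 t)
      have "\<not> (V x s \<or> V y s)" if "s \<in> {u..<t}" for s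
        using that a 3 by (cases "s < m") auto
      then show ?thesis using 3 True lt by (auto intro!: bexI[of _ t])
    qed
  next
    case False
    have "{u..<m} \<subseteq> {u..<v}" using lt by auto
    then show ?thesis using False concat.IH(1) by auto
  qed
qed

lemma val_Nand:
  "val (Nand \<phi> \<psi>) V u v a \<Longrightarrow> val \<phi> V u v (pfst a) \<and> val \<psi> V u v (psnd a)"
proof (induction rule: val.induct)
  case (const u v L)
  then show ?case by (auto intro!: val.const)
next
  case (concat u m a v b)
  then show ?case by (auto intro: val.concat)
qed

text \<open>On a constant piece the hidden signal is constant on both sides of every point, so
  Bolzano's interval induction composes the piece from intervals on which it is constant; the
  product of their letters lies in \<open>gen\<close>.\<close>

lemma val_ExS_D:
  assumes "val (ExS X \<phi>) V u v A" "0 \<le> u" "lconst S"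
  shows "\<exists>a\<in>set_decode A. val \<phi> (V(X := S)) u v a"
  using assms(1,2)
proof (induction rule: val.induct)
  case (const u v L)
  let ?G = "gen (smul \<phi>) {shom \<phi> (insert X L), shom \<phi> (L - {X})}"
  have piece: "\<exists>a\<in>?G. val \<phi> (V(X := S)) c d a"
    if cd: "c < d" "u \<le> c" "d \<le> v" and S: "\<And>t. t \<in> {c..<d} \<Longrightarrow> S t = B" for c d B
  proof -
    have "val \<phi> (V(X := S)) c d (shom \<phi> (if B then insert X L else L - {X}))"
      using cd const.hyps(2) S by (intro val.const) auto
    moreover have "shom \<phi> (if B then insert X L else L - {X}) \<in> ?G"
      by (auto intro: gen.base)
    ultimately show ?thesis by blast
  qed
  have join: "\<exists>a\<in>?G. val \<phi> (V(X := S)) c d a"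
    if "\<exists>a\<in>?G. val \<phi> (V(X := S)) c m a" "\<exists>a\<in>?G. val \<phi> (V(X := S)) m d a" for c m d
    using that by (meson gen.step val.concat)
  have "u \<le> v" using const.hyps by simp
  then have "u \<le> u \<and> v \<le> v \<and> u < v \<longrightarrow> (\<exists>a\<in>?G. val \<phi> (V(X := S)) u v a)"
  proof (induction rule: Bolzano[where P = "\<lambda>c d. u \<le> c \<and> d \<le> v \<and> c < d \<longrightarrow>
      (\<exists>a\<in>?G. val \<phi> (V(X := S)) c d a)"])
    case (trans a b c)
    then show ?case using join[of a b c] by (cases "a = b"; cases "b = c") auto
  next
    case (local x)
    have "0 \<le> x" using local const.prems by simp
    obtain \<epsilon> where \<epsilon>: "\<epsilon> > 0" "\<And>s. s \<in> {x..<x+\<epsilon>} \<Longrightarrow> S s = S x"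
      using lconst_right[OF assms(3) \<open>0 \<le> x\<close>] by blast
    obtain \<delta> B where \<delta>: "\<delta> > 0" "\<And>s. s \<in> {x-\<delta>..<x} \<Longrightarrow> 0 \<le> s \<Longrightarrow> S s = B"
    proof (cases "0 < x")
      case True
      then show ?thesis using lconst_left[OF assms(3) True] that by blast
    next
      case False
      \<comment> \<open>At \<open>x = 0\<close> there is nothing to the left, so any radius and any
        value will do.\<close>
      then show ?thesis using that[of 1 True] \<open>0 \<le> x\<close> by auto
    qed
    have "\<exists>a\<in>?G. val \<phi> (V(X := S)) c d a"
      if cd: "c \<le> x" "x \<le> d" "d - c < min \<epsilon> \<delta>" "u \<le> c" "d \<le> v" "c < d" for c d
    proof -
      have l: "\<exists>a\<in>?G. val \<phi> (V(X := S)) c x a" if "c < x"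
        by (rule piece[of _ _ B]) (use that cd local const.prems in \<open>auto intro!: \<delta>(2)\<close>)
      have r: "\<exists>a\<in>?G. val \<phi> (V(X := S)) x d a" if "x < d"
        by (rule piece[of _ _ "S x"]) (use that cd local in \<open>auto intro!: \<epsilon>(2)\<close>)
      consider "c = x" | "x = d" | "c < x" "x < d" using cd by linarith
      then show ?thesis
        by cases (use l r cd join[of c x d] in auto)
    qed
    then show ?case using \<epsilon>(1) \<delta>(1) by (intro exI[of _ "min \<epsilon> \<delta>"]) auto
  qed
  then show ?case
    unfolding shom.simps set_encode_inverse[OF finite_gen_shom] using const.hyps(1) by blast
next
  case (concat u m a v b)
  have "u < m" using concat.hyps val_less by blast
  then have "0 \<le> m" using concat.prems by simp
  then obtain c d where "c \<in> set_decode a" "d \<in> set_decode b"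
    and "val \<phi> (V(X := S)) u m c" "val \<phi> (V(X := S)) m v d"
    using concat.IH concat.prems by blast
  moreover from this have "smul \<phi> c d \<in> set_decode (smul (ExS X \<phi>) a b)" by auto
  ultimately show ?case using val.concat by blast
qed

text \<open>Density of the order supplies the room: a product of letters is realised on any
  interval, however short, by halving the interval at each multiplication.\<close>

lemma val_ExS_I_gen:
  assumes "a \<in> gen (smul \<phi>) {shom \<phi> (insert X L), shom \<phi> (L - {X})}"
    "u < v" "\<And>t Y. t \<in> {u..<v} \<Longrightarrow> Y \<in> fvs \<phi> - {X} \<Longrightarrow> V Y t \<longleftrightarrow> Y \<in> L"
  shows "\<exists>S. pc S u v \<and> val \<phi> (V(X := S)) u v a"
  using assms
proof (induction arbitrary: u v rule: gen.induct)
  case (base g)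
  define B where "B \<longleftrightarrow> g = shom \<phi> (insert X L)"
  then have g: "g = shom \<phi> (if B then insert X L else L - {X})" using base by auto
  have "val \<phi> (V(X := (\<lambda>_. B))) u v g"
    unfolding g using base.prems by (intro val.const) auto
  then show ?case by (intro exI[of _ "\<lambda>_. B"] conjI pc_const)
next
  case (step a b)
  define m where "m = (u + v) / 2"
  have m: "u < m" "m < v" using step.prems by (auto simp: m_def)
  obtain S where S: "pc S u m" "val \<phi> (V(X := S)) u m a"
    using step.IH(1)[OF m(1)] step.prems(2) m(2)
    by (metis atLeastLessThan_iff order.strict_trans)
  obtain T where T: "pc T m v" "val \<phi> (V(X := T)) m v b"
    using step.IH(2)[OF m(2)] step.prems(2) m(1)
    by (metis atLeastLessThan_iff less_imp_le order.trans)
  let ?R = "\<lambda>t. if t < m then S t else T t"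
  have "val \<phi> (V(X := ?R)) u m a" "val \<phi> (V(X := ?R)) m v b"
    by (rule val_cong[OF S(2)], simp) (rule val_cong[OF T(2)], simp)
  then show ?case using pc_concat[OF S(1) T(1)] val.concat by blast
qed

lemma val_ExS_I:
  assumes "val (ExS X \<phi>) V u v A" "a \<in> set_decode A"
  shows "\<exists>S. pc S u v \<and> val \<phi> (V(X := S)) u v a"
  using assms
proof (induction arbitrary: a rule: val.induct)
  case (const u v L)
  then show ?case using finite_gen_shom by (intro val_ExS_I_gen[of _ _ _ L]) auto
next
  case (concat u m A v B)
  then obtain c d where cd: "c \<in> set_decode A" "d \<in> set_decode B" "a = smul \<phi> c d" by auto
  obtain S where S: "pc S u m" "val \<phi> (V(X := S)) u m c" using concat.IH(1) cd by blast
  obtain T where T: "pc T m v" "val \<phi> (V(X := T)) m v d" using concat.IH(2) cd by blast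
  let ?R = "\<lambda>t. if t < m then S t else T t"
  have "val \<phi> (V(X := ?R)) u m c" "val \<phi> (V(X := ?R)) m v d"
    by (rule val_cong[OF S(2)], simp) (rule val_cong[OF T(2)], simp)
  then show ?case using pc_concat[OF S(1) T(1)] val.concat cd by blast
qed

lemma unbounded_comp:
  fixes \<kappa> :: "nat \<Rightarrow> real" and \<rho> :: "nat \<Rightarrow> nat"
  assumes "strict_mono \<kappa>" "\<not> bdd_above (range \<kappa>)" "strict_mono \<rho>"
  shows "\<not> bdd_above (range (\<lambda>i. \<kappa> (\<rho> i)))"
proof
  assume "bdd_above (range (\<lambda>i. \<kappa> (\<rho> i)))"
  then obtain M where M: "\<kappa> (\<rho> i) \<le> M" for i by (auto simp: bdd_above_def)
  have "\<kappa> i \<le> M" for i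
    using M[of i] strict_mono_leD[OF assms(1) strict_mono_imp_increasing[OF assms(3), of i]] by simp
  then show False using assms(2) by (auto simp: bdd_above_def)
qed

text \<open>Only \<open>ExS\<close> is delicate. A witness signal gives one member of
  \<open>s\<close> or \<open>e\<close> per block; Ramsey's theorem coarsens the blocks until these
  members form a linked pair. Conversely, an accepted pair \<open>(a, b)\<close> is realised by
  \<open>a\<close> on the first block and \<open>b\<close> on all later ones, and the pieces are
  glued.\<close>

theorem ssat_iff_sacc:
  assumes "\<And>X. lconst (V X)" "strict_mono \<kappa>" "\<not> bdd_above (range \<kappa>)" "0 < \<kappa> 0"
    "val \<phi> V 0 (\<kappa> 0) s" "\<And>i. val \<phi> V (\<kappa> i) (\<kappa> (Suc i)) e"
    "smul \<phi> s e = s" "smul \<phi> e e = e"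
  shows "ssat V \<phi> \<longleftrightarrow> sacc \<phi> s e"
  using assms
proof (induction \<phi> arbitrary: V \<kappa> s e)
  case (First x y z)
  let ?P = "\<lambda>t. V x t \<or> V y t"
  from val_First[OF First.prems(5)] consider
    "s = 0" "\<forall>t\<in>{0..<\<kappa> 0}. \<not> ?P t"
    | t where "s = 1" "t \<in> {0..<\<kappa> 0}" "?P t" "V z t" "\<forall>r\<in>{0..<t}. \<not> ?P r"
    | t where "s = 2" "t \<in> {0..<\<kappa> 0}" "?P t" "\<not> V z t" "\<forall>r\<in>{0..<t}. \<not> ?P r"
    by blast
  then show ?case
  proof cases
    case 1
    have "e = 0" using First.prems(7) 1 by simp
    have "\<not> ?P t" if "0 \<le> t" for t
    proof (cases "t < \<kappa> 0")
      case False
      then obtain i where "\<kappa> i \<le> t" "t < \<kappa> (Suc i)" using interval_index[OF First.prems(3), of t] by auto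
      then show ?thesis using val_First[OF First.prems(6), of i] \<open>e = 0\<close> by auto
    qed (use 1 that in auto)
    then have "\<not> ssat V (First x y z)" unfolding ssat.simps first_at_def by blast
    then show ?thesis using 1(1) by (simp only: sacc.simps) simp
  next
    case (2 t)
    then have "first_at ?P t" by (auto simp: first_at_def)
    then have "ssat V (First x y z)" unfolding ssat.simps using 2(4) by blast
    then show ?thesis using 2(1) by (simp only: sacc.simps refl)
  next
    case (3 t)
    have "t' = t" if "first_at ?P t'" for t'
    proof (rule ccontr)
      assume "t' \<noteq> t"
      then have "t' < t \<or> t < t'" by auto
      then show False using that 3 by (auto simp: first_at_def)
    qed
    then have "\<not> ssat V (First x y z)" unfolding ssat.simps using 3(4) by blast
    then show ?thesis using 3(1) by (simp only: sacc.simps) simp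
  qed
next
  case (Nand \<phi> \<psi>)
  note v = val_Nand[OF Nand.prems(5)] val_Nand[OF Nand.prems(6)]
  have "smul \<phi> (pfst s) (pfst e) = pfst s \<and> smul \<psi> (psnd s) (psnd e) = psnd s"
    "smul \<phi> (pfst e) (pfst e) = pfst e \<and> smul \<psi> (psnd e) (psnd e) = psnd e"
    using arg_cong[OF Nand.prems(7), of pfst] arg_cong[OF Nand.prems(7), of psnd]
      arg_cong[OF Nand.prems(8), of pfst] arg_cong[OF Nand.prems(8), of psnd] by simp_all
  then show ?case
    using Nand.IH(1)[OF Nand.prems(1-4), where s = "pfst s" and e = "pfst e"]
      Nand.IH(2)[OF Nand.prems(1-4), where s = "psnd s" and e = "psnd e"] v by simp
next
  case (ExS X \<phi>)
  interpret fin_semigroup "smul \<phi>" "scar \<phi>" by (rule fin_semigroup_smul)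
  \<comment> \<open>Prepending 0 turns the prefix and the repeated blocks into one sequence of
    blocks.\<close>
  define \<kappa>' where "\<kappa>' i = (case i of 0 \<Rightarrow> 0 | Suc j \<Rightarrow> \<kappa> j)" for i
  have \<kappa>'0: "\<kappa>' 0 = 0" and \<kappa>'S: "\<kappa>' (Suc i) = \<kappa> i" for i by (simp_all add: \<kappa>'_def)
  have mono: "strict_mono \<kappa>'"
    unfolding strict_mono_Suc_iff using ExS.prems(2,4)
    by (auto simp: \<kappa>'_def strict_mono_less split: nat.split)
  have unb: "\<not> bdd_above (range \<kappa>')"
  proof
    assume "bdd_above (range \<kappa>')"
    then have "bdd_above (range \<kappa>)"
      using \<kappa>'S by (metis bdd_above_mono image_subsetI rangeI)
    with ExS.prems(3) show False by simp
  qed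
  define w where "w i = (case i of 0 \<Rightarrow> s | Suc j \<Rightarrow> e)" for i :: nat
  have w: "val (ExS X \<phi>) V (\<kappa>' i) (\<kappa>' (Suc i)) (w i)" for i
    using ExS.prems(5,6) by (cases i) (simp_all add: w_def \<kappa>'_def)
  have pos: "0 \<le> \<kappa>' i" for i using strict_mono_leD[OF mono, of 0 i] \<kappa>'0 by simp
  have dec: "set_decode s = (\<lambda>(c, d). smul \<phi> c d) ` (set_decode s \<times> set_decode e)"
    "set_decode e = (\<lambda>(c, d). smul \<phi> c d) ` (set_decode e \<times> set_decode e)"
    using arg_cong[OF ExS.prems(7), of set_decode] arg_cong[OF ExS.prems(8), of set_decode] by simp_all
  have smul_s: "smul \<phi> c d \<in> set_decode s" if "c \<in> set_decode s" "d \<in> set_decode e" for c d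
    using that by (subst dec(1)) auto
  have smul_e: "smul \<phi> c d \<in> set_decode e" if "c \<in> set_decode e" "d \<in> set_decode e" for c d
    using that by (subst dec(2)) auto
  show ?case
  proof
    assume "ssat V (ExS X \<phi>)"
    then obtain S where S: "S \<in> signals UNIV" "ssat (V(X := S)) \<phi>" by auto
    then have lS: "lconst S" by (simp add: signals_iff)
    have "\<exists>a. a \<in> set_decode (w i) \<and> val \<phi> (V(X := S)) (\<kappa>' i) (\<kappa>' (Suc i)) a" for i
      using val_ExS_D[OF w pos lS] by blast
    then obtain x where x: "\<And>i. x i \<in> set_decode (w i)"
      "\<And>i. val \<phi> (V(X := S)) (\<kappa>' i) (\<kappa>' (Suc i)) (x i)" by metis
    obtain \<rho> a b where f: "factor (smul \<phi>) x \<rho> a b"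
      using factor_exists[of x] val_scar[OF x(2)] by metis
    \<comment> \<open>The products stay in the two sets because \<open>s e = s\<close> and
      \<open>e e = e\<close> hold for the sets themselves.\<close>
    have in_s: "sprod (smul \<phi>) x 0 j \<in> set_decode s" if "0 < j" for j
      using that
    proof (induction j)
      case (Suc j)
      then show ?case using x(1)[of 0] x(1)[of j] smul_s
        by (cases j) (auto simp: w_def)
    qed simp
    have in_e: "sprod (smul \<phi>) x i j \<in> set_decode e" if "0 < i" "i < j" for i j
      using that(2)
    proof (induction j)
      case (Suc j)
      have "x i \<in> set_decode e" "x j \<in> set_decode e" if "0 < j"
        using x(1)[of i] x(1)[of j] \<open>0 < i\<close> that by (auto simp: w_def split: nat.splits)
      then show ?case using Suc \<open>0 < i\<close> smul_e by (cases "i = j") auto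
    qed simp
    have \<rho>: "strict_mono \<rho>" "0 < \<rho> 0" "a = sprod (smul \<phi>) x 0 (\<rho> 0)"
      "\<And>i. sprod (smul \<phi>) x (\<rho> i) (\<rho> (Suc i)) = b" "smul \<phi> a b = a" "smul \<phi> b b = b"
      using f by (auto simp: factor_def)
    have lt: "\<rho> i < \<rho> (Suc i)" for i using \<rho>(1) by (simp add: strict_mono_less)
    have "ssat (V(X := S)) \<phi> \<longleftrightarrow> sacc \<phi> a b"
    proof (rule ExS.IH[where \<kappa> = "\<lambda>i. \<kappa>' (\<rho> i)"])
      show "lconst ((V(X := S)) Y)" for Y using ExS.prems(1) lS by simp
      show "strict_mono (\<lambda>i. \<kappa>' (\<rho> i))" using mono \<rho>(1) by (simp add: strict_mono_def)
      show "\<not> bdd_above (range (\<lambda>i. \<kappa>' (\<rho> i)))" using unbounded_comp[OF mono unb \<rho>(1)] .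
      show "0 < \<kappa>' (\<rho> 0)" using mono \<rho>(2) \<kappa>'0 by (metis strict_monoD)
      show "val \<phi> (V(X := S)) 0 (\<kappa>' (\<rho> 0)) a"
        using val_seq[OF mono x(2) \<rho>(2)] \<rho>(3) \<kappa>'0 by (simp del: fun_upd_apply)
      show "val \<phi> (V(X := S)) (\<kappa>' (\<rho> i)) (\<kappa>' (\<rho> (Suc i))) b" for i
        using val_seq[OF mono x(2) lt[of i]] \<rho>(4) by (simp del: fun_upd_apply)
    qed (use \<rho> in auto)
    moreover have "a \<in> set_decode s" using in_s \<rho> by simp
    moreover have "b \<in> set_decode e" using in_e[OF \<rho>(2) lt] \<rho>(4)[of 0] by simp
    ultimately show "sacc (ExS X \<phi>) s e" using S(2) \<rho> by auto
  next
    assume "sacc (ExS X \<phi>) s e"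
    then obtain a b where ab: "a \<in> set_decode s" "b \<in> set_decode e" "smul \<phi> a b = a"
      "smul \<phi> b b = b" "sacc \<phi> a b" by auto
    define c where "c i = (case i of 0 \<Rightarrow> a | Suc j \<Rightarrow> b)" for i :: nat
    have "c i \<in> set_decode (w i)" for i using ab by (cases i) (auto simp: c_def w_def)
    then have "\<exists>S. pc S (\<kappa>' i) (\<kappa>' (Suc i)) \<and> val \<phi> (V(X := S)) (\<kappa>' i) (\<kappa>' (Suc i)) (c i)" for i
      using val_ExS_I[OF w] by blast
    then obtain f where f: "\<And>i. pc (f i) (\<kappa>' i) (\<kappa>' (Suc i))"
      "\<And>i. val \<phi> (V(X := f i)) (\<kappa>' i) (\<kappa>' (Suc i)) (c i)" by metis
    define S where "S = (\<lambda>t\<in>{0..}. f (LEAST i. t < \<kappa>' (Suc i)) t)"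
    have S: "S t = f i t" if t: "t \<in> {\<kappa>' i..<\<kappa>' (Suc i)}" for i t
    proof -
      have "(LEAST i. t < \<kappa>' (Suc i)) = i"
      proof (rule Least_equality)
        show "t < \<kappa>' (Suc i)" using t by simp
        fix j assume "t < \<kappa>' (Suc j)"
        then have "\<kappa>' i < \<kappa>' (Suc j)" using t by simp
        then show "i \<le> j" using mono by (simp add: strict_mono_less)
      qed
      then show ?thesis using t pos[of i] by (simp add: S_def)
    qed
    have lS: "lconst S" by (rule pc_glue[OF mono \<kappa>'0 unb f(1) S])
    then have "S \<in> signals UNIV" by (simp add: signals_iff S_def)
    have v: "val \<phi> (V(X := S)) (\<kappa>' i) (\<kappa>' (Suc i)) (c i)" for i
      using f(2)[of i] by (rule val_cong) (use S[of _ i] in auto)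
    have "ssat (V(X := S)) \<phi> \<longleftrightarrow> sacc \<phi> a b"
    proof (rule ExS.IH[OF _ ExS.prems(2-4)])
      show "lconst ((V(X := S)) Y)" for Y using ExS.prems(1) lS by simp
      show "val \<phi> (V(X := S)) 0 (\<kappa> 0) a" using v[of 0] by (simp add: c_def \<kappa>'_def del: fun_upd_apply)
      show "val \<phi> (V(X := S)) (\<kappa> i) (\<kappa> (Suc i)) b" for i using v[of "Suc i"] by (simp add: c_def \<kappa>'_def del: fun_upd_apply)
    qed (use ab in auto)
    then show "ssat V (ExS X \<phi>)" using ab \<open>S \<in> signals UNIV\<close> by auto
  qed
qed

subsection \<open>Translation of the logic of Rsig\<close>

abbreviation SNot :: "sform \<Rightarrow> sform" where "SNot \<phi> \<equiv> Nand \<phi> \<phi>"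
text \<open>\<open>First\<close> with three equal arguments says that the signal has a first true
  point, i.e. that it names a point of the half line.\<close>

abbreviation SEx1 :: "nat \<Rightarrow> sform \<Rightarrow> sform" where
  "SEx1 x \<phi> \<equiv> ExS (2*x+1) (SNot (Nand (First (2*x+1) (2*x+1) (2*x+1)) \<phi>))"

text \<open>Even numbers for second-order and odd ones for first-order variables keep the two
  families apart. For \<open>Less\<close>: at the first point where \<open>x\<close> or
  \<open>y\<close> is true, \<open>y\<close> is true iff it starts no later than \<open>x\<close>;
  the negation is \<open>x < y\<close>.\<close>

primrec tr :: "mso \<Rightarrow> sform" where
  "tr (Less x y) = SNot (First (2*x+1) (2*y+1) (2*y+1))"
| "tr (Pred X x) = First (2*x+1) (2*x+1) (2*X)"
| "tr (Neg \<phi>) = SNot (tr \<phi>)"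
| "tr (Conj \<phi> \<psi>) = SNot (Nand (tr \<phi>) (tr \<psi>))"
| "tr (Disj \<phi> \<psi>) = Nand (SNot (tr \<phi>)) (SNot (tr \<psi>))"
| "tr (Ex1 x \<phi>) = SEx1 x (tr \<phi>)"
| "tr (All1 x \<phi>) = SNot (SEx1 x (SNot (tr \<phi>)))"
| "tr (Ex2 X \<phi>) = ExS (2*X) (tr \<phi>)"
| "tr (All2 X \<phi>) = SNot (ExS (2*X) (SNot (tr \<phi>)))"

lemma fvs_tr: "fvs (tr \<phi>) = (\<lambda>X. 2*X) ` free2 \<phi> \<union> (\<lambda>x. 2*x+1) ` free1 \<phi>"
  by (induction \<phi>) (auto; presburger)+

lemma first_at_unique: "first_at S t \<Longrightarrow> first_at S t' \<Longrightarrow> t = t'"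
  unfolding first_at_def by (metis linorder_neqE_linordered_idom)

text \<open>The indicator of a single point is not right continuous; the half line that starts at
  \<open>t\<close> names \<open>t\<close> instead.\<close>

lemma step_signal: "0 \<le> t \<Longrightarrow> (\<lambda>s\<in>{0..}. t \<le> s) \<in> signals (UNIV :: bool set) \<and> first_at (\<lambda>s\<in>{0..}. t \<le> s) t"
proof
  assume t: "0 \<le> t"
  have "lconst (\<lambda>s. t \<le> s)" unfolding lconst_def
  proof (intro conjI allI impI)
    fix r :: real
    show "\<exists>\<epsilon>>0. \<exists>a. \<forall>s\<in>{r..<r+\<epsilon>}. (t \<le> s) = a"
      by (rule exI[of _ "if t \<le> r then 1 else t - r"]) (auto split: if_splits)
    show "\<exists>\<epsilon>>0. \<exists>a. \<forall>s\<in>{r-\<epsilon>..<r}. 0 \<le> s \<longrightarrow> (t \<le> s) = a"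
      by (rule exI[of _ "if t < r then r - t else 1"]) (auto split: if_splits)
  qed
  then show "(\<lambda>s\<in>{0..}. t \<le> s) \<in> signals UNIV"
    unfolding signals_iff by (auto elim!: lconst_cong)
  show "first_at (\<lambda>s\<in>{0..}. t \<le> s) t" using t by (auto simp: first_at_def)
qed

lemma odd_even: "2 * y \<noteq> Suc (2 * x)" "Suc (2 * x) \<noteq> 2 * y"
  by presburger+

lemma Rsig_sat_tr:
  assumes "\<And>X. W (2*X) = V X" "\<And>x. first_at (W (2*x+1)) (v x)"
  shows "Rsig_sat v V \<phi> \<longleftrightarrow> ssat W (tr \<phi>)"
  using assms
proof (induction \<phi> arbitrary: v V W)
  case (Less x y)
  let ?P = "\<lambda>t. W (2*x+1) t \<or> W (2*y+1) t"
  have x: "first_at (W (2*x+1)) (v x)" and y: "first_at (W (2*y+1)) (v y)" using Less by blast+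
  have m: "first_at ?P (min (v x) (v y))" using x y unfolding first_at_def min_def by auto
  have "(\<exists>t. first_at ?P t \<and> W (2*y+1) t) \<longleftrightarrow> W (2*y+1) (min (v x) (v y))"
    using first_at_unique[OF m] m by blast
  also have "\<dots> \<longleftrightarrow> v y \<le> v x" using x y unfolding first_at_def min_def by auto
  finally show ?case by (auto simp: not_le)
next
  case (Pred X x)
  have x: "first_at (W (2*x+1)) (v x)" using Pred by blast
  have "(\<exists>t. first_at (W (2*x+1)) t \<and> W (2*X) t) \<longleftrightarrow> W (2*X) (v x)"
    using first_at_unique[OF x] x by blast
  then show ?case using Pred by simp
next
  case (Ex1 x \<phi>)
  have step: "Rsig_sat (v(x := t)) V \<phi> \<longleftrightarrow> ssat (W(2*x+1 := S)) (tr \<phi>)" if "first_at S t" for t S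
    by (rule Ex1.IH) (use Ex1.prems that odd_even in auto)
  have "ssat W (tr (Ex1 x \<phi>)) \<longleftrightarrow>
      (\<exists>S\<in>signals UNIV. (\<exists>t. first_at S t) \<and> ssat (W(2*x+1 := S)) (tr \<phi>))"
    by (auto simp: first_at_def)
  also have "\<dots> \<longleftrightarrow> (\<exists>t\<in>{0..}. Rsig_sat (v(x := t)) V \<phi>)"
  proof
    assume "\<exists>t\<in>{0..}. Rsig_sat (v(x := t)) V \<phi>"
    then obtain t where "0 \<le> t" "Rsig_sat (v(x := t)) V \<phi>" by auto
    then show "\<exists>S\<in>signals UNIV. (\<exists>t. first_at S t) \<and> ssat (W(2*x+1 := S)) (tr \<phi>)"
      using step_signal[of t] step by blast
  next
    assume "\<exists>S\<in>signals UNIV. (\<exists>t. first_at S t) \<and> ssat (W(2*x+1 := S)) (tr \<phi>)"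
    then obtain S t where "first_at S t" "ssat (W(2*x+1 := S)) (tr \<phi>)" by blast
    moreover from this have "t \<in> {0..}" by (simp add: first_at_def)
    ultimately show "\<exists>t\<in>{0..}. Rsig_sat (v(x := t)) V \<phi>" using step by blast
  qed
  finally show ?case by simp
next
  case (All1 x \<phi>)
  have step: "Rsig_sat (v(x := t)) V \<phi> \<longleftrightarrow> ssat (W(2*x+1 := S)) (tr \<phi>)" if "first_at S t" for t S
    by (rule All1.IH) (use All1.prems that odd_even in auto)
  have "ssat W (tr (All1 x \<phi>)) \<longleftrightarrow>
      (\<forall>S\<in>signals UNIV. (\<exists>t. first_at S t) \<longrightarrow> ssat (W(2*x+1 := S)) (tr \<phi>))"
    by (auto simp: first_at_def)
  also have "\<dots> \<longleftrightarrow> (\<forall>t\<in>{0..}. Rsig_sat (v(x := t)) V \<phi>)"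
  proof
    assume *: "\<forall>S\<in>signals UNIV. (\<exists>t. first_at S t) \<longrightarrow> ssat (W(2*x+1 := S)) (tr \<phi>)"
    show "\<forall>t\<in>{0..}. Rsig_sat (v(x := t)) V \<phi>"
      using * step_signal step by (metis atLeast_iff)
  next
    assume *: "\<forall>t\<in>{0..}. Rsig_sat (v(x := t)) V \<phi>"
    have "ssat (W(2*x+1 := S)) (tr \<phi>)" if "first_at S t" for S t
    proof -
      have "t \<in> {0..}" using that by (simp add: first_at_def)
      then show ?thesis using * step[OF that] by blast
    qed
    then show "\<forall>S\<in>signals UNIV. (\<exists>t. first_at S t) \<longrightarrow> ssat (W(2*x+1 := S)) (tr \<phi>)" by blast
  qed
  finally show ?case by simp
next
  case (Ex2 X \<phi>)
  have "Rsig_sat v (V(X := S)) \<phi> \<longleftrightarrow> ssat (W(2*X := S)) (tr \<phi>)" for S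
    by (rule Ex2.IH) (use Ex2.prems odd_even in auto)
  then show ?case by simp
next
  case (All2 X \<phi>)
  have "Rsig_sat v (V(X := S)) \<phi> \<longleftrightarrow> ssat (W(2*X := S)) (tr \<phi>)" for S
    by (rule All2.IH) (use All2.prems odd_even in auto)
  then show ?case by simp
next
  case (Neg \<phi>)
  show ?case using Neg.IH[OF Neg.prems] by simp
next
  case (Conj \<phi> \<psi>)
  show ?case using Conj.IH(1)[OF Conj.prems] Conj.IH(2)[OF Conj.prems] by simp
next
  case (Disj \<phi> \<psi>)
  show ?case using Disj.IH(1)[OF Disj.prems] Disj.IH(2)[OF Disj.prems] by simp
qed

text \<open>The variables of the translation that are true under the letters \<open>a\<close> and
  \<open>b\<close>; the indices are even because \<open>tr\<close> doubles second-order
  variables.\<close>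

definition letter :: "bool list list \<Rightarrow> bool list list \<Rightarrow> nat \<Rightarrow> nat \<Rightarrow> nat set" where
  "letter Cin Cout a b = {2 * i |i. i < width Cin \<and> Cin ! a ! i} \<union>
     {2 * (width Cin + j) |j. j < width Cout \<and> Cout ! b ! j}"

abbreviation hval :: "bool list list \<Rightarrow> bool list list \<Rightarrow> mso \<Rightarrow> nat \<Rightarrow> nat \<Rightarrow> nat" where
  "hval Cin Cout \<Psi> a b \<equiv> shom (tr \<Psi>) (letter Cin Cout a b)"

text \<open>Truth depends only on the letters passed and not on the times \<open>\<kappa>\<close>: a
  Ramsey factorisation of the letter values is at once a factorisation of the half line.\<close>

theorem Rsig_models_iff_sacc:
  assumes spec: "spec_formula Cin Cout \<Psi>"
    and X: "X \<in> signals (alphabet Cin)" and Y: "Y \<in> signals (alphabet Cout)"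
    and \<kappa>: "\<kappa> 0 = 0" "strict_mono \<kappa>" "\<not> bdd_above (range \<kappa>)"
    and XY: "\<And>i t. t \<in> {\<kappa> i..<\<kappa> (Suc i)} \<Longrightarrow> X t = a i \<and> Y t = b i"
    and f: "factor (smul (tr \<Psi>)) (\<lambda>i. hval Cin Cout \<Psi> (a i) (b i)) \<rho> s e"
  shows "Rsig_models Cin Cout \<Psi> X Y \<longleftrightarrow> sacc (tr \<Psi>) s e"
proof -
  define V where "V i = (if i < width Cin then component Cin X i
            else if i < width Cin + width Cout then component Cout Y (i - width Cin)
            else (\<lambda>t\<in>{0..}. False))" for i
  \<comment> \<open>In \<open>Rsig_models\<close> all first-order variables have the value 0, which
    is the first true point of the constantly true signal.\<close>
  define W where "W i = (if even i then V (i div 2) else (\<lambda>_. True))" for i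
  have pos: "0 \<le> \<kappa> i" for i using strict_mono_leD[OF \<kappa>(2), of 0 i] \<kappa>(1) by simp
  have "Rsig_models Cin Cout \<Psi> X Y \<longleftrightarrow> Rsig_sat (\<lambda>_. 0) V \<Psi>"
    unfolding Rsig_models_def V_def ..
  also have "\<dots> \<longleftrightarrow> ssat W (tr \<Psi>)"
    by (rule Rsig_sat_tr) (auto simp: W_def first_at_def)
  also have "\<dots> \<longleftrightarrow> sacc (tr \<Psi>) s e"
  proof (rule ssat_iff_sacc[where \<kappa> = "\<lambda>i. \<kappa> (\<rho> i)"])
    have \<rho>: "strict_mono \<rho>" "0 < \<rho> 0" using f by (auto simp: factor_def)
    have lX: "lconst X" "lconst Y" using X Y by (auto simp: signals_iff)
    have "lconst (component Cin X i)" "lconst (component Cout Y i)" for i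
      using lconst_cong[OF lconst_compose[OF lX(1), of "\<lambda>c. Cin ! c ! i"]]
        lconst_cong[OF lconst_compose[OF lX(2), of "\<lambda>c. Cout ! c ! i"]]
      by (simp_all add: component_def)
    moreover have "lconst (\<lambda>t\<in>{0..}. False)" by (rule lconst_cong[OF lconst_const[of False]]) auto
    ultimately show "lconst (W Z)" for Z by (simp add: W_def V_def lconst_const)
    show "strict_mono (\<lambda>i. \<kappa> (\<rho> i))" using \<kappa>(2) \<rho>(1) by (simp add: strict_mono_def)
    show "\<not> bdd_above (range (\<lambda>i. \<kappa> (\<rho> i)))" using unbounded_comp[OF \<kappa>(2,3) \<rho>(1)] .
    show "0 < \<kappa> (\<rho> 0)" using \<kappa>(1,2) \<rho>(2) by (metis strict_monoD)
    have v: "val (tr \<Psi>) W (\<kappa> i) (\<kappa> (Suc i)) (hval Cin Cout \<Psi> (a i) (b i))" for i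
    proof (rule val.const)
      show "\<kappa> i < \<kappa> (Suc i)" using \<kappa>(2) by (simp add: strict_mono_less)
      fix t Z assume t: "t \<in> {\<kappa> i..<\<kappa> (Suc i)}" and "Z \<in> fvs (tr \<Psi>)"
      then obtain j where j: "Z = 2 * j" "j < width Cin + width Cout"
        using spec by (auto simp: fvs_tr spec_formula_def)
      have "0 \<le> t" using t pos[of i] by simp
      moreover have "2 * j \<in> letter Cin Cout (a i) (b i) \<longleftrightarrow>
          (if j < width Cin then Cin ! a i ! j else Cout ! b i ! (j - width Cin))"
      proof -
        have "(\<exists>k. j = width Cin + k \<and> k < width Cout \<and> Cout ! b i ! k) \<longleftrightarrow>
            \<not> j < width Cin \<and> Cout ! b i ! (j - width Cin)"
          using j(2) by (auto intro!: exI[of _ "j - width Cin"])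
        then show ?thesis unfolding letter_def Un_iff mem_Collect_eq mult_cancel1 by auto
      qed
      ultimately show "W Z t \<longleftrightarrow> Z \<in> letter Cin Cout (a i) (b i)"
        using j XY[OF t] by (auto simp: W_def V_def component_def)
    qed
    have lt: "\<rho> i < \<rho> (Suc i)" for i using \<rho>(1) by (simp add: strict_mono_less)
    show "val (tr \<Psi>) W 0 (\<kappa> (\<rho> 0)) s" using val_seq[OF \<kappa>(2) v \<rho>(2)] f \<kappa>(1) by (simp add: factor_def)
    show "val (tr \<Psi>) W (\<kappa> (\<rho> i)) (\<kappa> (\<rho> (Suc i))) e" for i
      using val_seq[OF \<kappa>(2) v lt[of i]] f by (simp add: factor_def)
  qed (use f in \<open>auto simp: factor_def\<close>)
  finally show ?thesis .
qed

section \<open>Positional determinacy of finite parity games\<close>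

definition mininf :: "(nat \<Rightarrow> nat) \<Rightarrow> nat" where
  "mininf c = (LEAST k. \<forall>n. \<exists>i\<ge>n. c i = k)"

lemma mininf_shift: "mininf (\<lambda>i. c (N + i)) = mininf c"
proof -
  have "(\<forall>n. \<exists>i\<ge>n. c (N + i) = k) \<longleftrightarrow> (\<forall>n. \<exists>i\<ge>n. c i = k)" for k
  proof
    assume *: "\<forall>n. \<exists>i\<ge>n. c (N + i) = k"
    show "\<forall>n. \<exists>i\<ge>n. c i = k" using * by (meson trans_le_add2)
  next
    assume *: "\<forall>n. \<exists>i\<ge>n. c i = k"
    show "\<forall>n. \<exists>i\<ge>n. c (N + i) = k"
    proof
      fix n
      obtain i where "N + n \<le> i" "c i = k" using * by blast
      then show "\<exists>i\<ge>n. c (N + i) = k" by (intro exI[of _ "i - N"]) auto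
    qed
  qed
  then show ?thesis by (simp add: mininf_def)
qed

definition path :: "('v \<times> 'v) set \<Rightarrow> (nat \<Rightarrow> 'v) \<Rightarrow> bool" where
  "path F p \<longleftrightarrow> (\<forall>i. (p i, p (Suc i)) \<in> F)"

text \<open>The winner is read off the least recurring colour by an arbitrary predicate
  \<open>good\<close> instead of its parity. Attractor arguments only ask who likes the least
  colour, and the freedom lets colours carry further data.\<close>

locale parity_game =
  fixes E :: "('v \<times> 'v) set" and own :: "'v \<Rightarrow> bool" and col :: "'v \<Rightarrow> nat" and good :: "nat \<Rightarrow> bool"
begin

definition arena :: "'v set \<Rightarrow> bool" where
  "arena U \<longleftrightarrow> (\<forall>v\<in>U. \<exists>u\<in>U. (v, u) \<in> E)"

text \<open>\<open>F\<close> is a positional strategy of \<open>pl\<close> together with all moves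
  of the opponent. It may offer several moves to \<open>pl\<close>, and every way of choosing among
  them wins.\<close>

definition dominion :: "'v set \<Rightarrow> bool \<Rightarrow> 'v set \<Rightarrow> ('v \<times> 'v) set \<Rightarrow> bool" where
  "dominion U pl D F \<longleftrightarrow> D \<subseteq> U \<and> F \<subseteq> E \<inter> D \<times> D \<and>
     (\<forall>v\<in>D. own v = pl \<longrightarrow> (\<exists>u. (v, u) \<in> F)) \<and>
     (\<forall>v\<in>D. own v \<noteq> pl \<longrightarrow> (\<forall>u\<in>U. (v, u) \<in> E \<longrightarrow> (v, u) \<in> F)) \<and>
     (\<forall>p. path F p \<longrightarrow> good (mininf (\<lambda>i. col (p i))) = pl)"

section \<open>Attractors\<close>

primrec att :: "bool \<Rightarrow> 'v set \<Rightarrow> 'v set \<Rightarrow> nat \<Rightarrow> 'v set" where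
  "att pl U Z 0 = Z"
| "att pl U Z (Suc n) = att pl U Z n \<union> {v \<in> U. own v = pl \<and> (\<exists>u\<in>att pl U Z n. (v, u) \<in> E)} \<union>
     {v \<in> U. own v \<noteq> pl \<and> (\<forall>u\<in>U. (v, u) \<in> E \<longrightarrow> u \<in> att pl U Z n)}"

definition attr :: "bool \<Rightarrow> 'v set \<Rightarrow> 'v set \<Rightarrow> 'v set" where
  "attr pl U Z = (\<Union>n. att pl U Z n)"

definition rnk :: "bool \<Rightarrow> 'v set \<Rightarrow> 'v set \<Rightarrow> 'v \<Rightarrow> nat" where
  "rnk pl U Z v = (LEAST n. v \<in> att pl U Z n)"

definition attF :: "bool \<Rightarrow> 'v set \<Rightarrow> 'v set \<Rightarrow> ('v \<times> 'v) set" where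
  "attF pl U Z = {(v, u) \<in> E. v \<in> attr pl U Z - Z \<and> u \<in> attr pl U Z \<and> rnk pl U Z u < rnk pl U Z v}"

lemma att_mono: "m \<le> n \<Longrightarrow> att pl U Z m \<subseteq> att pl U Z n"
  by (rule lift_Suc_mono_le[of "att pl U Z"]) auto

lemma attr_subset: "Z \<subseteq> attr pl U Z" "Z \<subseteq> U \<Longrightarrow> attr pl U Z \<subseteq> U"
proof -
  show "Z \<subseteq> attr pl U Z" unfolding attr_def using att.simps(1) by blast
  assume "Z \<subseteq> U"
  then have "att pl U Z n \<subseteq> U" for n by (induction n) auto
  then show "attr pl U Z \<subseteq> U" unfolding attr_def by blast
qed

lemma attr_own:
  assumes "v \<in> U - attr pl U Z" "own v = pl" "(v, u) \<in> E" shows "u \<notin> attr pl U Z"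
proof
  assume "u \<in> attr pl U Z"
  then obtain n where "u \<in> att pl U Z n" unfolding attr_def by blast
  then have "v \<in> att pl U Z (Suc n)" using assms by auto
  then show False using assms(1) unfolding attr_def by blast
qed

lemma rnk_le: "v \<in> att pl U Z n \<Longrightarrow> rnk pl U Z v \<le> n"
  unfolding rnk_def by (rule Least_le)

lemma attr_other:
  assumes "finite U" "v \<in> U - attr pl U Z" "own v \<noteq> pl"
  shows "\<exists>u\<in>U - attr pl U Z. (v, u) \<in> E"
proof (rule ccontr)
  assume *: "\<not> ?thesis"
  define N where "N = Max (insert 0 (rnk pl U Z ` U))"
  have "u \<in> att pl U Z N" if "u \<in> U" "(v, u) \<in> E" for u
  proof -
    have "u \<in> attr pl U Z" using * that by blast
    then have "u \<in> att pl U Z (rnk pl U Z u)"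
      unfolding attr_def rnk_def by (auto intro: LeastI)
    moreover have "rnk pl U Z u \<le> N" unfolding N_def using assms(1) that by (intro Max_ge) auto
    ultimately show ?thesis using att_mono by blast
  qed
  then have "v \<in> att pl U Z (Suc N)" using assms by auto
  then show False using assms(2) unfolding attr_def by blast
qed

lemma attr_decrease:
  assumes "v \<in> attr pl U Z - Z"
  shows "own v = pl \<Longrightarrow> \<exists>u. (v, u) \<in> attF pl U Z"
    "own v \<noteq> pl \<Longrightarrow> u \<in> U \<Longrightarrow> (v, u) \<in> E \<Longrightarrow> (v, u) \<in> attF pl U Z"
proof -
  have v: "v \<in> att pl U Z (rnk pl U Z v)"
    using assms unfolding attr_def rnk_def by (auto intro: LeastI)
  then obtain n where n: "rnk pl U Z v = Suc n" using assms by (cases "rnk pl U Z v") auto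
  have "v \<notin> att pl U Z n" using rnk_le[of v pl U Z n] n by auto
  then have *: "own v = pl \<and> (\<exists>u\<in>att pl U Z n. (v, u) \<in> E) \<or>
      own v \<noteq> pl \<and> (\<forall>u\<in>U. (v, u) \<in> E \<longrightarrow> u \<in> att pl U Z n)"
    using v n by auto
  have **: "(v, u) \<in> attF pl U Z" if "u \<in> att pl U Z n" "(v, u) \<in> E" for u
    using that assms rnk_le[OF that(1)] n unfolding attF_def attr_def by auto
  show "own v = pl \<Longrightarrow> \<exists>u. (v, u) \<in> attF pl U Z" using * ** by blast
  show "own v \<noteq> pl \<Longrightarrow> u \<in> U \<Longrightarrow> (v, u) \<in> E \<Longrightarrow> (v, u) \<in> attF pl U Z" using * ** by blast
qed

lemma attr_reach:
  assumes p: "path F p" and F: "\<And>v u. v \<in> attr pl U Z - Z \<Longrightarrow> (v, u) \<in> F \<Longrightarrow> (v, u) \<in> attF pl U Z"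
  shows "p i \<in> attr pl U Z \<Longrightarrow> \<exists>j\<ge>i. p j \<in> Z"
proof (induction "rnk pl U Z (p i)" arbitrary: i rule: less_induct)
  case less
  show ?case
  proof (cases "p i \<in> Z")
    case False
    then have "(p i, p (Suc i)) \<in> attF pl U Z" using less.prems p F unfolding path_def by blast
    then have "rnk pl U Z (p (Suc i)) < rnk pl U Z (p i)" "p (Suc i) \<in> attr pl U Z"
      by (auto simp: attF_def)
    then obtain j where "Suc i \<le> j" "p j \<in> Z" using less.hyps by blast
    then show ?thesis using Suc_leD by blast
  qed auto
qed

lemma arena_minus_attr: "finite U \<Longrightarrow> arena U \<Longrightarrow> arena (U - attr pl U Z)"
  unfolding arena_def by (metis DiffD1 DiffI attr_other attr_own)

text \<open>Zielonka's recursion. Let \<open>pl\<close> like the least colour \<open>c\<close>, and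
  remove the attractor \<open>A\<close> of \<open>pl\<close> to the vertices of colour
  \<open>c\<close>. If the opponent wins nowhere in the rest, \<open>pl\<close> wins everywhere: a
  play meets \<open>A\<close>, and hence \<open>c\<close>, infinitely often or finally stays in the
  rest. Otherwise the opponent's region in the rest is a trap for \<open>pl\<close> in the whole
  arena, so the opponent also wins its attractor \<open>B\<close>, and the recursion continues
  outside \<open>B\<close>.\<close>

theorem parity_determined:
  assumes "finite U" "arena U"
  shows "\<exists>D F. (\<forall>pl. dominion U pl (D pl) (F pl)) \<and> D True \<union> D False = U"
  using assms
proof (induction U rule: finite_psubset_induct)
  case (psubset U)
  show ?case
  proof (cases "U = {}")
    case True
    then show ?thesis
      by (intro exI[of _ "\<lambda>_. {}"] exI[of _ "\<lambda>_. {}"]) (auto simp: dominion_def path_def)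
  next
    case False
    define c where "c = Min (col ` U)"
    define pl where "pl = good c"
    define op where "op = (\<not> pl)"
    define Z where "Z = {v \<in> U. col v = c}"
    define A where "A = attr pl U Z"
    define U' where "U' = U - A"
    have "c \<in> col ` U" unfolding c_def using False psubset.hyps by (intro Min_in) auto
    then have "Z \<noteq> {}" by (auto simp: Z_def)
    have ZU: "Z \<subseteq> U" by (auto simp: Z_def)
    have ZA: "Z \<subseteq> A" and AU: "A \<subseteq> U" using attr_subset[of Z] ZU by (auto simp: A_def)
    have "U' \<subset> U" using \<open>Z \<noteq> {}\<close> ZA AU by (auto simp: U'_def)
    moreover have "arena U'" unfolding U'_def A_def using psubset by (intro arena_minus_attr)
    ultimately obtain D' F' where
      D': "\<And>pl. dominion U' pl (D' pl) (F' pl)" "D' True \<union> D' False = U'"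
      using psubset.IH by metis
    have D'_un: "D' pl \<union> D' op = U'" using D'(2) unfolding op_def by (cases pl) auto
    show ?thesis
    proof (cases "D' op = {}")
      case True
      then have D'U: "D' pl = U'" using D'_un by simp
      \<comment> \<open>Four kinds of moves: the strategy on the rest, rank-decreasing moves inside
        the attractor, arbitrary moves after colour \<open>c\<close>, and moves by which the
        opponent leaves the rest for \<open>A\<close>.\<close>
      define F where "F = F' pl \<union> attF pl U Z \<union> {(v, u) \<in> E. v \<in> Z \<and> u \<in> U} \<union>
        {(v, u) \<in> E. v \<in> U' \<and> own v \<noteq> pl \<and> u \<in> A}"
      have F'sub: "F' pl \<subseteq> E \<inter> U' \<times> U'" using D'(1)[of pl] D'U by (auto simp: dominion_def)
      have win: "good (mininf (\<lambda>i. col (p i))) = pl" if p: "path F p" for p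
      proof (cases "\<forall>n. \<exists>i\<ge>n. p i \<in> A")
        case True
        have "p i \<in> U" for i
          using p F'sub AU ZU unfolding path_def F_def U'_def attF_def A_def by blast
        then have ge: "c \<le> col (p i)" for i
          unfolding c_def using psubset.hyps by (intro Min_le) auto
        have "(v, u) \<in> attF pl U Z" if "v \<in> attr pl U Z - Z" "(v, u) \<in> F" for v u
          using that F'sub unfolding F_def U'_def A_def by blast
        then have "\<exists>j\<ge>i. p j \<in> Z" if "p i \<in> A" for i
          using attr_reach[OF p, of pl U Z i] that unfolding A_def by blast
        then have "\<exists>j\<ge>n. col (p j) = c" for n
          using True unfolding Z_def by (metis (mono_tags, lifting) mem_Collect_eq order.trans)
        then have "mininf (\<lambda>i. col (p i)) = c"
          unfolding mininf_def using ge by (intro Least_equality) force+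
        then show ?thesis by (simp add: pl_def)
      next
        case False
        then obtain N where N: "\<And>i. N \<le> i \<Longrightarrow> p i \<notin> A" by blast
        have "(p (N + i), p (Suc (N + i))) \<in> F' pl" for i
        proof -
          have "p (N + i) \<notin> A" "p (Suc (N + i)) \<notin> A" using N[of "N + i"] N[of "Suc (N + i)"] by simp_all
          then show ?thesis using p ZA unfolding path_def F_def attF_def A_def by blast
        qed
        then have "path (F' pl) (\<lambda>i. p (N + i))" unfolding path_def by simp
        then have "good (mininf (\<lambda>i. col (p (N + i)))) = pl"
          using D'(1)[of pl] unfolding dominion_def by blast
        then show ?thesis using mininf_shift[of "\<lambda>i. col (p i)" N] by simp
      qed
      have own: "\<exists>u. (v, u) \<in> F" if "v \<in> U" "own v = pl" for v
      proof (cases "v \<in> A")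
        case True
        then show ?thesis
          using that attr_decrease(1)[of v pl U Z] psubset.prems unfolding F_def A_def arena_def
          by (cases "v \<in> Z") blast+
      next
        case False
        then have "v \<in> D' pl" using that D'U by (auto simp: U'_def)
        then show ?thesis using that D'(1)[of pl] unfolding F_def dominion_def by blast
      qed
      have other: "(v, u) \<in> F" if "v \<in> U" "own v \<noteq> pl" "u \<in> U" "(v, u) \<in> E" for v u
      proof (cases "v \<in> A")
        case True
        then show ?thesis
          using that attr_decrease(2)[of v pl U Z u] unfolding F_def A_def
          by (cases "v \<in> Z") blast+
      next
        case False
        then have "v \<in> D' pl" "v \<in> U'" using that D'U by (auto simp: U'_def)
        then show ?thesis using that D'(1)[of pl] unfolding F_def dominion_def U'_def by blast
      qed
      have "F \<subseteq> E \<inter> U \<times> U"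
        using F'sub AU ZU unfolding F_def attF_def A_def U'_def by blast
      then have "dominion U pl U F" unfolding dominion_def using own other win by blast
      moreover have "dominion U op {} {}" by (auto simp: dominion_def path_def)
      ultimately show ?thesis
        by (intro exI[of _ "\<lambda>q. if q = pl then U else {}"] exI[of _ "\<lambda>q. if q = pl then F else {}"])
          (auto simp: op_def split: if_splits)
    next
      case False
      define W where "W = D' op"
      define B where "B = attr op U W"
      define U'' where "U'' = U - B"
      have WU: "W \<subseteq> U'" "W \<subseteq> U" using D'_un by (auto simp: W_def U'_def)
      have WB: "W \<subseteq> B" and BU: "B \<subseteq> U" using attr_subset[of W] WU by (auto simp: B_def)
      have "U'' \<subset> U" using False WB BU by (auto simp: U''_def W_def)
      moreover have "arena U''" unfolding U''_def B_def using psubset by (intro arena_minus_attr)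
      ultimately obtain D'' F'' where
        D'': "\<And>pl. dominion U'' pl (D'' pl) (F'' pl)" "D'' True \<union> D'' False = U''"
        using psubset.IH by metis
      have D''_un: "D'' pl \<union> D'' op = U''" using D''(2) unfolding op_def by (cases pl) auto
      have F'sub: "F' op \<subseteq> E \<inter> W \<times> W" using D'(1)[of op] by (auto simp: dominion_def W_def)
      have F''sub: "F'' q \<subseteq> E \<inter> D'' q \<times> D'' q" for q using D''(1)[of q] by (auto simp: dominion_def)
      have D''sub: "D'' q \<subseteq> U''" for q using D''(1)[of q] by (auto simp: dominion_def)
      define F where "F = F' op \<union> attF op U W \<union> F'' op \<union>
        {(v, u) \<in> E. v \<in> D'' op \<and> own v \<noteq> op \<and> u \<in> B}"
      define D where "D = B \<union> D'' op"
      have win: "good (mininf (\<lambda>i. col (p i))) = op" if p: "path F p" for p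
      proof (cases "\<exists>i. p i \<in> B")
        case True
        have "(v, u) \<in> attF op U W" if "v \<in> attr op U W - W" "(v, u) \<in> F" for v u
          using that F'sub F''sub[of op] D''sub[of op] unfolding F_def U''_def B_def by blast
        then obtain N where N: "p N \<in> W" using attr_reach[OF p, of op U W] True unfolding B_def by blast
        have inW: "(v, u) \<in> F' op" if "v \<in> W" "(v, u) \<in> F" for v u
          using that F''sub[of op] D''sub[of op] WB unfolding F_def U''_def attF_def by blast
        have "p (N + i) \<in> W" for i
        proof (induction i)
          case (Suc i)
          have "(p (N + i), p (Suc (N + i))) \<in> F' op" using inW[OF Suc] p unfolding path_def by blast
          then show ?case using F'sub by auto
        qed (use N in simp)
        then have "path (F' op) (\<lambda>i. p (N + i))" using p inW unfolding path_def by simp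
        then have "good (mininf (\<lambda>i. col (p (N + i)))) = op"
          using D'(1)[of op] unfolding dominion_def by blast
        then show ?thesis using mininf_shift[of "\<lambda>i. col (p i)" N] by simp
      next
        case False
        then have "(p i, p (Suc i)) \<in> F'' op" for i
          using p F'sub WB unfolding path_def F_def attF_def B_def by blast
        then have "path (F'' op) p" unfolding path_def by simp
        then show ?thesis using D''(1)[of op] unfolding dominion_def by blast
      qed
      have own: "\<exists>u. (v, u) \<in> F" if "v \<in> D" "own v = op" for v
      proof (cases "v \<in> B")
        case True
        show ?thesis
        proof (cases "v \<in> W")
          case True
          then show ?thesis using that D'(1)[of op] unfolding F_def dominion_def W_def by blast
        next
          case False
          then show ?thesis using that True attr_decrease(1)[of v op U W] unfolding F_def B_def by blast
        qed
      next
        case False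
        then have "v \<in> D'' op" using that by (auto simp: D_def)
        then show ?thesis using that D''(1)[of op] unfolding F_def dominion_def by blast
      qed
      have other: "(v, u) \<in> F" if "v \<in> D" "own v \<noteq> op" "u \<in> U" "(v, u) \<in> E" for v u
      proof (cases "v \<in> B")
        case True
        show ?thesis
        proof (cases "v \<in> W")
          case True
          \<comment> \<open>A vertex of \<open>pl\<close> outside the attractor of \<open>pl\<close>
            has no edge into it. So \<open>pl\<close> cannot escape from \<open>W\<close> through
            \<open>A\<close>, and \<open>W\<close> is a dominion in all of \<open>U\<close>.\<close>
          have "v \<in> U - attr pl U Z" using True WU by (auto simp: U'_def A_def)
          then have "u \<notin> A" using attr_own[of v U pl Z u] that unfolding A_def op_def by blast
          then have "u \<in> U'" using that by (simp add: U'_def)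
          then show ?thesis using that True D'(1)[of op] unfolding F_def dominion_def W_def by blast
        next
          case False
          then show ?thesis using that True attr_decrease(2)[of v op U W u] unfolding F_def B_def by blast
        qed
      next
        case False
        then have v: "v \<in> D'' op" using that by (auto simp: D_def)
        then show ?thesis using that D''(1)[of op] unfolding F_def dominion_def U''_def by blast
      qed
      have "F \<subseteq> E \<inter> D \<times> D"
        using F'sub F''sub[of op] WB unfolding F_def attF_def D_def B_def by blast
      moreover have "D \<subseteq> U" using BU D''sub[of op] by (auto simp: D_def U''_def)
      ultimately have "dominion U op D F" unfolding dominion_def using own other win by blast
      moreover have "dominion U pl (D'' pl) (F'' pl)"
        unfolding dominion_def
      proof (intro conjI ballI impI)
        fix v u assume vu: "v \<in> D'' pl" "own v \<noteq> pl" "u \<in> U" "(v, u) \<in> E"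
        have "v \<in> U - attr op U W" using vu D''sub[of pl] by (auto simp: U''_def B_def)
        then have "u \<notin> B" using attr_own[of v U op W u] vu unfolding B_def op_def by blast
        then show "(v, u) \<in> F'' pl" using vu D''(1)[of pl] unfolding dominion_def U''_def by blast
      qed (use D''(1)[of pl] in \<open>auto simp: dominion_def U''_def\<close>)
      moreover have "D'' pl \<union> D = U" using D''_un BU by (auto simp: D_def U''_def)
      ultimately show ?thesis
        by (intro exI[of _ "\<lambda>q. if q = pl then D'' pl else D"] exI[of _ "\<lambda>q. if q = pl then F'' pl else F"])
          (auto simp: op_def split: if_splits)
    qed
  qed
qed

end

section \<open>Determinisation\<close>

text \<open>Applied to a list in order of age, this keeps the oldest representative of every value
  of \<open>h\<close>.\<close>

definition kf :: "('i \<Rightarrow> 'k) \<Rightarrow> 'i list \<Rightarrow> 'i list" where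
  "kf h = foldl (\<lambda>acc i. if h i \<in> h ` set acc then acc else acc @ [i]) []"

lemma kf_Nil [simp]: "kf h [] = []"
  by (simp add: kf_def)

lemma kf_snoc: "kf h (ys @ [y]) = (if h y \<in> h ` set (kf h ys) then kf h ys else kf h ys @ [y])"
  by (simp add: kf_def)

lemma kf_map: "kf id (map h ys) = map h (kf h ys)"
  by (induction ys rule: rev_induct) (auto simp: kf_snoc)

lemma kf_append: "\<exists>zs. kf h (ys @ ws) = kf h ys @ zs"
proof (induction ws rule: rev_induct)
  case (snoc w ws)
  then show ?case using kf_snoc[of h "ys @ ws" w] by auto
qed simp

lemma kf_take: "\<exists>zs. kf h ys = kf h (take j ys) @ zs"
  using kf_append[of h "take j ys" "drop j ys"] by simp

lemma distinct_kf: "distinct (map h (kf h ys))"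
  by (induction ys rule: rev_induct) (auto simp: kf_snoc)

lemma set_kf: "set (kf h ys) \<subseteq> set ys"
  by (induction ys rule: rev_induct) (auto simp: kf_snoc)

lemma sorted_kf: "sorted_wrt (<) ys \<Longrightarrow> sorted_wrt (<) (kf h ys)"
proof (induction ys rule: rev_induct)
  case (snoc y ys)
  then show ?case using set_kf[of h ys] by (auto simp: kf_snoc sorted_wrt_append)
qed simp

text \<open>The entry already standing in place \<open>q\<close> of the pruned list absorbs a later
  entry with the same value.\<close>

definition hit :: "('i \<Rightarrow> 'k) \<Rightarrow> 'i list \<Rightarrow> nat \<Rightarrow> bool" where
  "hit h ys q \<longleftrightarrow> (\<exists>j<length ys. q < length (kf h (take j ys)) \<and> h (kf h (take j ys) ! q) = h (ys ! j))"

lemma hit_map: "hit id (map h ys) q \<longleftrightarrow> hit h ys q"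
  unfolding hit_def by (auto simp: take_map kf_map)

lemma hit_length: "hit h ys q \<Longrightarrow> q < length (kf h ys)"
  unfolding hit_def using kf_take[of h ys] by (metis length_append trans_less_add1)

lemma no_hit_take:
  assumes "\<And>q'. q' < q \<Longrightarrow> \<not> hit h ys q'" "n \<le> Suc q"
  shows "kf h (take n ys) = take n ys"
  using assms(2)
proof (induction n)
  case (Suc n)
  then have IH: "kf h (take n ys) = take n ys" by simp
  show ?case
  proof (cases "n < length ys")
    case True
    have "h (ys ! n) \<notin> h ` set (take n ys)"
    proof
      assume "h (ys ! n) \<in> h ` set (take n ys)"
      then obtain q' where "q' < length (take n ys)" "h (take n ys ! q') = h (ys ! n)"
        by (metis (no_types, opaque_lifting) imageE in_set_conv_nth)
      then have "hit h ys q'" "q' < n" unfolding hit_def using IH True by (auto intro!: exI[of _ n])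
      then show False using assms(1)[of q'] Suc.prems by simp
    qed
    then show ?thesis using IH True kf_snoc[of h "take n ys" "ys ! n"] by (simp add: take_Suc_conv_app_nth)
  qed (use IH in simp)
qed simp

text \<open>An entry disappears only by hitting an older place, so without hits below
  \<open>q\<close> the places up to \<open>q\<close> are not shifted. This stability is what makes
  age ranks usable as colours.\<close>

lemma no_hit_prefix:
  assumes "\<And>q'. q' < q \<Longrightarrow> \<not> hit h ys q'" "q' \<le> q" "q' < length ys"
  shows "q' < length (kf h ys)" "kf h ys ! q' = ys ! q'"
proof -
  obtain zs where "kf h ys = take (Suc q) ys @ zs"
    using kf_take[of h ys "Suc q"] no_hit_take[of q h ys "Suc q"] assms(1) by auto
  then show "q' < length (kf h ys)" "kf h ys ! q' = ys ! q'"
    using assms(2,3) by (auto simp: nth_append)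
qed

lemma no_hit_all: "(\<And>q. \<not> hit h ys q) \<Longrightarrow> kf h ys = ys"
  using no_hit_take[of "length ys" h ys "length ys"] by simp

lemma hit_removed:
  assumes "hit h ys q" "sorted_wrt (<) (ys :: nat list)"
  obtains r where "r \<in> set ys" "r \<notin> set (kf h ys)" "h r = h (kf h ys ! q)" "kf h ys ! q < r"
proof -
  obtain j where j: "j < length ys" "q < length (kf h (take j ys))" "h (kf h (take j ys) ! q) = h (ys ! j)"
    using assms(1) unfolding hit_def by blast
  obtain zs where zs: "kf h ys = kf h (take j ys) @ zs" using kf_take by blast
  have q: "kf h ys ! q = kf h (take j ys) ! q" using j(2) by (subst zs) (simp add: nth_append)
  have mem: "kf h (take j ys) ! q \<in> set (take j ys)"
    using set_kf[of h "take j ys"] nth_mem[OF j(2)] by blast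
  have "sorted_wrt (<) (take j ys @ ys ! j # drop (Suc j) ys)"
    using assms(2) id_take_nth_drop[OF j(1)] by metis
  then have "\<forall>u\<in>set (take j ys). u < ys ! j" by (simp add: sorted_wrt_append)
  then have lt: "kf h ys ! q < ys ! j" using mem q by auto
  have hq: "h (kf h ys ! q) = h (ys ! j)" using j q by simp
  have "ys ! j \<notin> set (kf h ys)"
  proof
    assume *: "ys ! j \<in> set (kf h ys)"
    have "kf h ys ! q \<in> set (kf h ys)" using hit_length[OF assms(1)] by simp
    moreover have "inj_on h (set (kf h ys))" using distinct_kf[of h ys] by (simp add: distinct_map)
    ultimately have "kf h ys ! q = ys ! j" using * hq by (meson inj_onD)
    then show False using lt by simp
  qed
  then show ?thesis using that[of "ys ! j"] j(1) hq lt by simp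
qed

section \<open>Values that recur infinitely often\<close>

lemma infinite_often_finite:
  fixes c :: "nat \<Rightarrow> 'c"
  assumes "finite S" "\<forall>n. \<exists>i\<ge>n. c i \<in> S"
  shows "\<exists>k\<in>S. \<forall>n. \<exists>i\<ge>n. c i = k"
proof (rule ccontr)
  assume "\<not> ?thesis"
  then have "\<forall>k\<in>S. \<exists>n. \<forall>i\<ge>n. c i \<noteq> k" by blast
  then obtain N where N: "\<And>k i. k \<in> S \<Longrightarrow> N k \<le> i \<Longrightarrow> c i \<noteq> k" by metis
  obtain i where "Max (insert 0 (N ` S)) \<le> i" "c i \<in> S" using assms(2) by blast
  moreover have "N (c i) \<le> Max (insert 0 (N ` S))" using assms(1) \<open>c i \<in> S\<close> by (intro Max_ge) auto
  ultimately show False using N[of "c i" i] by simp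
qed

lemma mininf_props:
  assumes "\<And>i. c i \<le> M"
  shows "\<forall>n. \<exists>i\<ge>n. c i = mininf c" "\<exists>N. \<forall>i\<ge>N. mininf c \<le> c i"
proof -
  have "\<exists>k\<in>{..M}. \<forall>n. \<exists>i\<ge>n. c i = k"
    by (rule infinite_often_finite) (use assms in auto)
  then have "\<exists>k. \<forall>n. \<exists>i\<ge>n. c i = k" by blast
  then show "\<forall>n. \<exists>i\<ge>n. c i = mininf c" unfolding mininf_def by (rule LeastI_ex)
  show "\<exists>N. \<forall>i\<ge>N. mininf c \<le> c i"
  proof (rule ccontr)
    assume "\<not> ?thesis"
    then have "\<forall>n. \<exists>i\<ge>n. c i \<in> {..<mininf c}" by (auto simp: not_le)
    then obtain k where "k < mininf c" "\<forall>n. \<exists>i\<ge>n. c i = k"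
      using infinite_often_finite[of "{..<mininf c}" c] by auto
    then show False unfolding mininf_def using not_less_Least by blast
  qed
qed

section \<open>The automaton of surviving positions\<close>

context fin_semigroup
begin

definition ystep :: "'a \<Rightarrow> 'a list \<Rightarrow> 'a list" where
  "ystep g xs = map (\<lambda>v. mul v g) xs @ [g]"

definition K :: nat where "K = card (C \<times> C)"

definition idx :: "'a \<times> 'a \<Rightarrow> nat" where
  "idx = (SOME f. bij_betw f (C \<times> C) {0..<K})"

lemma idx: "bij_betw idx (C \<times> C) {0..<K}"
  unfolding idx_def K_def
  by (rule someI_ex[of "\<lambda>f. bij_betw f (C \<times> C) {0..<card (C \<times> C)}"])
    (intro ex_bij_betw_finite_nat finite_SigmaI fin)

text \<open>The rank is the leading digit, so comparing colours compares ranks first. The low digit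
  adds the product of the whole prefix and that of the absorbing class, which the winning predicate
  has to know. Rounds without absorption get \<open>card C * K\<close>, above all other colours,
  since ranks are below \<open>card C\<close>.\<close>

definition colr :: "'a \<Rightarrow> 'a list \<Rightarrow> nat" where
  "colr g xs = (let ys = ystep g xs; q = (LEAST q. hit id ys q) in
     if \<exists>q. hit id ys q then q * K + idx (hd (kf id ys), kf id ys ! q) else card C * K)"

text \<open>\<open>rr x k\<close> lists the oldest members of the classes of positions \<open>i < k\<close> with the same product of
  \<open>x i, \<dots>, x (k - 1)\<close>, and \<open>rx x k\<close> lists these products. The latter is the state of a deterministic
  automaton whose colour is the age rank of the oldest class that absorbs another one.\<close>

primrec rx :: "(nat \<Rightarrow> 'a) \<Rightarrow> nat \<Rightarrow> 'a list" where
  "rx x 0 = []"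
| "rx x (Suc k) = kf id (ystep (x k) (rx x k))"

primrec rr :: "(nat \<Rightarrow> 'a) \<Rightarrow> nat \<Rightarrow> nat list" where
  "rr x 0 = []"
| "rr x (Suc k) = kf (\<lambda>i. sprod mul x i (Suc k)) (rr x k @ [k])"

lemma rr_less: "i \<in> set (rr x k) \<Longrightarrow> i < k"
proof (induction k)
  case (Suc k)
  then show ?case using set_kf[of "\<lambda>i. sprod mul x i (Suc k)" "rr x k @ [k]"]
    by (auto simp del: sprod.simps intro: less_SucI)
qed simp

lemma sorted_rr: "sorted_wrt (<) (rr x k @ [k])"
proof (induction k)
  case (Suc k)
  then have "sorted_wrt (<) (rr x (Suc k))" by (auto intro: sorted_kf simp del: sprod.simps)
  then show ?case using rr_less[of _ x "Suc k"] by (auto simp: sorted_wrt_append simp del: rr.simps)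
qed simp

lemma ystep_rx:
  assumes "rx x k = map (\<lambda>i. sprod mul x i k) (rr x k)"
  shows "ystep (x k) (rx x k) = map (\<lambda>i. sprod mul x i (Suc k)) (rr x k @ [k])"
proof -
  have "mul (sprod mul x i k) (x k) = sprod mul x i (Suc k)" if "i \<in> set (rr x k)" for i
    using rr_less[OF that] by simp
  then show ?thesis by (auto simp: ystep_def assms simp del: sprod.simps)
qed

lemma rx_eq: "rx x k = map (\<lambda>i. sprod mul x i k) (rr x k)"
proof (induction k)
  case (Suc k)
  show ?case by (simp only: rx.simps rr.simps ystep_rx[OF Suc] kf_map)
qed simp

lemma hit_rx: "hit id (ystep (x k) (rx x k)) q \<longleftrightarrow> hit (\<lambda>i. sprod mul x i (Suc k)) (rr x k @ [k]) q"
  unfolding ystep_rx[OF rx_eq] hit_map ..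

text \<open>Position 0 is the oldest and is never absorbed; so the head of \<open>rx\<close> is the
  product of the whole prefix.\<close>

lemma hd_rr: "rr x (Suc k) \<noteq> [] \<and> hd (rr x (Suc k)) = 0"
proof (induction k)
  case 0
  show ?case by (simp add: kf_def)
next
  case (Suc k)
  then obtain ys where ys: "rr x (Suc k) = 0 # ys" by (cases "rr x (Suc k)") auto
  then obtain zs where zs: "rr x (Suc (Suc k)) = kf (\<lambda>i. sprod mul x i (Suc (Suc k))) [0] @ zs"
    using kf_append[of "\<lambda>i. sprod mul x i (Suc (Suc k))" "[0]" "ys @ [Suc k]"]
    by (auto simp del: sprod.simps rr.simps simp: rr.simps(2)[of x "Suc k"])
  then show ?case by (simp add: kf_def del: rr.simps sprod.simps)
qed

lemma rx_in: "range x \<subseteq> C \<Longrightarrow> set (rx x k) \<subseteq> C"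
  using rr_less[of _ x k] by (auto simp: rx_eq intro!: sprod_in simp del: sprod.simps)

lemma distinct_rx: "distinct (rx x k)"
proof (cases k)
  case (Suc j)
  then show ?thesis using distinct_kf[of id "ystep (x j) (rx x j)"] by simp
qed simp

lemma length_rx: "range x \<subseteq> C \<Longrightarrow> length (rx x k) \<le> card C"
  using distinct_card[OF distinct_rx[of x k]] card_mono[OF fin rx_in[of x k]] by simp

lemma colr_hit:
  assumes "hit id (ystep (x k) (rx x k)) q" "\<And>q'. q' < q \<Longrightarrow> \<not> hit id (ystep (x k) (rx x k)) q'"
  shows "colr (x k) (rx x k) = q * K + idx (hd (rx x (Suc k)), rx x (Suc k) ! q)"
proof -
  have "(LEAST q. hit id (ystep (x k) (rx x k)) q) = q"
    by (rule Least_equality) (use assms in \<open>auto simp: not_less[symmetric]\<close>)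
  then show ?thesis using assms(1) by (auto simp: colr_def Let_def)
qed

lemma rx_pair_in:
  assumes "range x \<subseteq> C" "q < length (rx x (Suc k))"
  shows "(hd (rx x (Suc k)), rx x (Suc k) ! q) \<in> C \<times> C"
proof -
  have "rx x (Suc k) ! q \<in> set (rx x (Suc k))" "hd (rx x (Suc k)) \<in> set (rx x (Suc k))"
    using assms(2) by (auto intro: nth_mem hd_in_set simp del: rx.simps)
  then show ?thesis using rx_in[OF assms(1), of "Suc k"] by blast
qed

lemma colr_cases:
  assumes x: "range x \<subseteq> C"
  obtains "\<And>q. \<not> hit id (ystep (x k) (rx x k)) q" "colr (x k) (rx x k) = card C * K"
  | q where "hit id (ystep (x k) (rx x k)) q" "\<And>q'. q' < q \<Longrightarrow> \<not> hit id (ystep (x k) (rx x k)) q'"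
      "colr (x k) (rx x k) div K = q" "colr (x k) (rx x k) < card C * K"
      "colr (x k) (rx x k) mod K = idx (hd (rx x (Suc k)), rx x (Suc k) ! q)"
proof (cases "\<exists>q. hit id (ystep (x k) (rx x k)) q")
  case True
  define q where "q = (LEAST q. hit id (ystep (x k) (rx x k)) q)"
  have q: "hit id (ystep (x k) (rx x k)) q" "\<And>q'. q' < q \<Longrightarrow> \<not> hit id (ystep (x k) (rx x k)) q'"
    unfolding q_def using True LeastI_ex not_less_Least by metis+
  have c: "colr (x k) (rx x k) = q * K + idx (hd (rx x (Suc k)), rx x (Suc k) ! q)"
    by (rule colr_hit) (use q in blast)+
  have lt: "q < length (rx x (Suc k))" using hit_length[OF q(1)] by simp
  have "idx (hd (rx x (Suc k)), rx x (Suc k) ! q) < K"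
    using rx_pair_in[OF x lt] idx by (auto simp: bij_betw_def simp del: rx.simps)
  moreover have "q < card C" using lt length_rx[OF x, of "Suc k"] by (simp del: rx.simps)
  ultimately have "Suc q * K \<le> card C * K" by (intro mult_le_mono1) simp
  then have "colr (x k) (rx x k) < card C * K"
    using \<open>idx _ < K\<close> unfolding c by (simp del: rx.simps)
  moreover have "colr (x k) (rx x k) div K = q"
    "colr (x k) (rx x k) mod K = idx (hd (rx x (Suc k)), rx x (Suc k) ! q)"
    using \<open>idx _ < K\<close> unfolding c by (simp_all del: rx.simps)
  ultimately show ?thesis using that(2) q by blast
next
  case False
  then have "colr (x k) (rx x k) = card C * K" unfolding colr_def Let_def by (rule if_not_P)
  then show ?thesis using that(1) False by blast
qed

lemma colr_le: "range x \<subseteq> C \<Longrightarrow> colr (x k) (rx x k) \<le> card C * K"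
  by (rule colr_cases[of x k]) auto

text \<open>Without hits the list of products grows in every round, but its entries are distinct
  members of \<open>C\<close>.\<close>

lemma hits_infinite:
  assumes x: "range x \<subseteq> C"
  shows "\<exists>k\<ge>n. \<exists>q. hit id (ystep (x k) (rx x k)) q"
proof (rule ccontr)
  assume "\<not> ?thesis"
  then have *: "kf id (ystep (x k) (rx x k)) = ystep (x k) (rx x k)" if "n \<le> k" for k
    using no_hit_all that by blast
  have "length (rx x (n + m)) = length (rx x n) + m" for m
  proof (induction m)
    case (Suc m)
    then show ?case using *[of "n + m"] by (simp add: ystep_def)
  qed simp
  then have "length (rx x (n + Suc (card C))) = length (rx x n) + Suc (card C)" .
  then show False using length_rx[OF x, of "n + Suc (card C)"] by (simp del: rx.simps)
qed

text \<open>If \<open>m\<close> is the least colour seen infinitely often, then a fixed position \<open>i\<close> is merged infinitely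
  often with ever later positions \<open>r\<close>.\<close>

lemma merge_infinite:
  assumes x: "range x \<subseteq> C"
    and m: "m = mininf (\<lambda>k. colr (x k) (rx x k))"
    and tf: "(t, f) \<in> C \<times> C" "idx (t, f) = m mod K"
  obtains i where "\<And>n. \<exists>r k. n \<le> r \<and> i < r \<and> r \<le> k \<and> sprod mul x r (Suc k) = f \<and>
    sprod mul x i (Suc k) = f \<and> sprod mul x 0 (Suc k) = t"
proof -
  let ?c = "\<lambda>k. colr (x k) (rx x k)"
  let ?hit = "\<lambda>k. hit id (ystep (x k) (rx x k))"
  let ?h = "\<lambda>k i. sprod mul x i (Suc k)"
  define q where "q = m div K"
  note mp = mininf_props[of ?c, OF colr_le[OF x], folded m]
  have "m < card C * K"
  proof -
    obtain N where N: "\<And>k. N \<le> k \<Longrightarrow> m \<le> ?c k" using mp(2) by blast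
    obtain k where "N \<le> k" "\<exists>q. ?hit k q" using hits_infinite[OF x] by blast
    then have "m \<le> ?c k" "?c k < card C * K" using N by (auto intro: colr_cases[OF x, of k])
    then show ?thesis by simp
  qed
  obtain N where N: "\<And>k. N \<le> k \<Longrightarrow> m \<le> ?c k" using mp(2) by blast
  have nohit: "\<not> ?hit k q'" if "N \<le> k" "q' < q" for k q'
  proof
    assume h: "?hit k q'"
    show False
    proof (rule colr_cases[OF x, of k])
      fix q0 assume q0: "\<And>q'. q' < q0 \<Longrightarrow> \<not> ?hit k q'" "?c k div K = q0"
      have "q \<le> q0" using N[OF that(1)] div_le_mono[of m "?c k" K] q0(2) by (simp add: q_def)
      then show False using h q0(1) that(2) by (meson less_le_trans)
    qed (use h in blast)
  qed
  have hitm: "?hit k q \<and> hd (rx x (Suc k)) = t \<and> rx x (Suc k) ! q = f" if "?c k = m" for k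
  proof (rule colr_cases[OF x, of k])
    fix q0 assume q0: "?hit k q0" "?c k div K = q0" "?c k mod K = idx (hd (rx x (Suc k)), rx x (Suc k) ! q0)"
    have "q0 = q" using q0(2) that by (simp add: q_def)
    have "q0 < length (rx x (Suc k))" using hit_length[OF q0(1)] by simp
    from rx_pair_in[OF x this] have "(hd (rx x (Suc k)), rx x (Suc k) ! q0) = (t, f)"
      using q0(3) tf that bij_betw_imp_inj_on[OF idx] by (metis inj_onD)
    then show ?thesis using q0(1) \<open>q0 = q\<close> by simp
  qed (use that \<open>m < card C * K\<close> in simp)
  obtain k0 where k0: "N \<le> k0" "?c k0 = m" using mp(1) by blast
  define i where "i = rr x (Suc k0) ! q"
  \<comment> \<open>From \<open>k0\<close> on, no place before \<open>q\<close> is hit, so the same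
    position \<open>i\<close> remains in place \<open>q\<close>.\<close>
  have stable: "q < length (rr x (Suc k0 + n)) \<and> rr x (Suc k0 + n) ! q = i" for n
  proof (induction n)
    case 0
    have "q < length (rx x (Suc k0))" using hit_length[of id] hitm[OF k0(2)] by (metis rx.simps(2))
    then show ?case by (simp add: i_def rx_eq del: rx.simps rr.simps)
  next
    case (Suc n)
    let ?k = "Suc k0 + n"
    have nh: "\<not> hit (?h ?k) (rr x ?k @ [?k]) q'" if "q' < q" for q'
      using nohit[of ?k q'] that k0(1) hit_rx[of x ?k q'] by auto
    have "q < length (rr x ?k @ [?k])" using Suc by simp
    then have "q < length (kf (?h ?k) (rr x ?k @ [?k]))" "kf (?h ?k) (rr x ?k @ [?k]) ! q = (rr x ?k @ [?k]) ! q"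
      using no_hit_prefix[of q "?h ?k" "rr x ?k @ [?k]" q] nh by blast+
    then show ?case unfolding add_Suc_right[of "Suc k0" n] rr.simps(2)[of x ?k]
      using Suc by (simp add: nth_append del: sprod.simps rr.simps)
  qed
  define Ks where "Ks = {k. Suc k0 \<le> k \<and> ?c k = m}"
  have "\<exists>r. r \<in> set (rr x k @ [k]) \<and> r \<notin> set (rr x (Suc k)) \<and> i < r \<and> ?h k r = f \<and> ?h k i = f \<and> ?h k 0 = t"
    if "k \<in> Ks" for k
  proof -
    have k: "Suc k0 \<le> k" "?c k = m" using that by (auto simp: Ks_def)
    have h: "hit (?h k) (rr x k @ [k]) q" using hitm[OF k(2)] hit_rx by blast
    have iq: "rr x (Suc k) ! q = i" "q < length (rr x (Suc k))"
      using stable[of "k - k0"] k(1) by (simp_all del: rr.simps)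
    have f: "?h k i = f" using hitm[OF k(2)] iq by (simp add: rx_eq del: rx.simps rr.simps sprod.simps)
    have t: "?h k 0 = t" using hitm[OF k(2)] hd_rr[of x k]
      by (simp add: rx_eq hd_map del: rx.simps rr.simps sprod.simps)
    obtain r where "r \<in> set (rr x k @ [k])" "r \<notin> set (rr x (Suc k))" "?h k r = ?h k i" "i < r"
      using hit_removed[OF h sorted_rr] iq by (auto simp del: sprod.simps)
    then show ?thesis using f t by metis
  qed
  then obtain r where r: "\<And>k. k \<in> Ks \<Longrightarrow> r k \<in> set (rr x k @ [k]) \<and> r k \<notin> set (rr x (Suc k)) \<and> i < r k \<and>
      ?h k (r k) = f \<and> ?h k i = f \<and> ?h k 0 = t" by metis
  \<comment> \<open>A removed position never returns, so different rounds remove different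
    positions; infinitely many rounds therefore remove arbitrarily late ones.\<close>
  have gone: "r k \<notin> set (rr x (Suc k + n) @ [Suc k + n])" if "k \<in> Ks" for k n
  proof (induction n)
    case 0
    have "r k \<le> k" using r[OF that] rr_less[of "r k" x k] by auto
    then show ?case using r[OF that] by auto
  next
    case (Suc n)
    have "r k < Suc k + Suc n" using r[OF that] rr_less[of "r k" x k] by auto
    moreover have "set (rr x (Suc k + Suc n)) \<subseteq> set (rr x (Suc k + n) @ [Suc k + n])"
      using set_kf[of "?h (Suc k + n)" "rr x (Suc k + n) @ [Suc k + n]"]
      unfolding add_Suc_right[of "Suc k" n] rr.simps(2)[of x "Suc k + n"] .
    ultimately show ?case using Suc by auto
  qed
  have inj: "inj_on r Ks"
  proof (rule linorder_inj_onI)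
    fix k k' assume "k < k'" "k \<in> Ks" "k' \<in> Ks"
    then show "r k \<noteq> r k'" using gone[of k "k' - Suc k"] r[of k'] by auto
  qed auto
  have "infinite Ks"
    unfolding infinite_nat_iff_unbounded_le Ks_def using mp(1)
    by (metis (mono_tags, lifting) mem_Collect_eq nat_le_linear order.trans)
  then have "infinite (r ` Ks)" using inj finite_image_iff by blast
  have "\<exists>r k. n \<le> r \<and> i < r \<and> r \<le> k \<and> ?h k r = f \<and> ?h k i = f \<and> ?h k 0 = t" for n
  proof -
    obtain k where k: "k \<in> Ks" "n \<le> r k"
      using \<open>infinite (r ` Ks)\<close> unfolding infinite_nat_iff_unbounded_le by blast
    have "r k \<le> k" using r[OF k(1)] rr_less[of "r k" x k] by auto
    then show ?thesis using r[OF k(1)] k(2) by blast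
  qed
  then show ?thesis by (rule that)
qed

end

section \<open>From recurring merges to linked pairs\<close>

lemma mininf_double: "mininf (\<lambda>n. c (n div 2)) = mininf c"
proof -
  have "(\<forall>n. \<exists>i\<ge>n. c (i div 2) = k) \<longleftrightarrow> (\<forall>n. \<exists>i\<ge>n. c i = k)" for k
  proof (intro iffI allI)
    fix n assume "\<forall>n. \<exists>i\<ge>n. c (i div 2) = k"
    then obtain i where "2 * n \<le> i" "c (i div 2) = k" by blast
    then show "\<exists>i\<ge>n. c i = k" by (intro exI[of _ "i div 2"]) auto
  next
    fix n assume "\<forall>n. \<exists>i\<ge>n. c i = k"
    then obtain i where "n \<le> i" "c i = k" by blast
    then show "\<exists>i\<ge>n. c (i div 2) = k" by (intro exI[of _ "2 * i"]) auto
  qed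
  then show ?thesis by (simp add: mininf_def)
qed

fun lprod :: "('a \<Rightarrow> 'a \<Rightarrow> 'a) \<Rightarrow> 'a list \<Rightarrow> 'a" where
  "lprod m [] = undefined"
| "lprod m (w # ws) = foldl m w ws"

lemma lprod_snoc: "ws \<noteq> [] \<Longrightarrow> lprod m (ws @ [w]) = m (lprod m ws) w"
  by (cases ws) auto

context fin_semigroup
begin

lemma lprod_append: "us \<noteq> [] \<Longrightarrow> vs \<noteq> [] \<Longrightarrow> lprod mul (us @ vs) = mul (lprod mul us) (lprod mul vs)"
proof (induction vs rule: rev_induct)
  case (snoc v vs)
  show ?case
  proof (cases "vs = []")
    case True
    then show ?thesis using snoc lprod_snoc[of us mul v] by simp
  next
    case False
    then have "lprod mul ((us @ vs) @ [v]) = mul (mul (lprod mul us) (lprod mul vs)) v"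
      using snoc lprod_snoc[of "us @ vs" mul v] by simp
    then show ?thesis using False lprod_snoc[of vs mul v] by (simp add: assoc)
  qed
qed simp

lemma gen_list: "s \<in> gen mul H \<Longrightarrow> \<exists>ws. ws \<noteq> [] \<and> set ws \<subseteq> H \<and> lprod mul ws = s"
proof (induction rule: gen.induct)
  case (base g)
  then show ?case by (intro exI[of _ "[g]"]) simp
next
  case (step a b)
  then obtain us vs where "us \<noteq> []" "vs \<noteq> []" "set us \<subseteq> H" "set vs \<subseteq> H"
    "lprod mul us = a" "lprod mul vs = b" by blast
  then show ?case by (intro exI[of _ "us @ vs"]) (simp add: lprod_append)
qed

lemma sprod_list:
  "ws \<noteq> [] \<Longrightarrow> (\<And>i. i < length ws \<Longrightarrow> x (k + i) = ws ! i) \<Longrightarrow> sprod mul x k (k + length ws) = lprod mul ws"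
proof (induction ws rule: rev_induct)
  case (snoc w ws)
  have w: "x (k + length ws) = w" using snoc.prems(2)[of "length ws"] by simp
  show ?case
  proof (cases "ws = []")
    case False
    have "sprod mul x k (k + length ws) = lprod mul ws"
      using snoc.IH[OF False] snoc.prems(2) by (simp add: nth_append)
    then show ?thesis using False w lprod_snoc[OF False, of mul w] by simp
  qed (use w in simp)
qed simp

text \<open>Every generated element is spelled as a word of generators, and the words are strung
  together. This turns algebraic pairs back into sequences of letters or of moves.\<close>

lemma concat_sequences:
  fixes e :: "nat \<Rightarrow> 'a"
  assumes "\<And>j. e j \<in> gen mul H"
  obtains x \<kappa> where "range x \<subseteq> H" "\<kappa> 0 = 0" "strict_mono \<kappa>"
    "\<And>j. sprod mul x (\<kappa> j) (\<kappa> (Suc j)) = e j"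
proof -
  obtain ws where ws: "\<And>j. ws j \<noteq> []" "\<And>j. set (ws j) \<subseteq> H" "\<And>j. lprod mul (ws j) = e j"
    using gen_list[OF assms] by metis
  define \<kappa> where "\<kappa> j = (\<Sum>i<j. length (ws i))" for j
  have \<kappa>S: "\<kappa> (Suc j) = \<kappa> j + length (ws j)" for j by (simp add: \<kappa>_def)
  have mono: "strict_mono \<kappa>" unfolding strict_mono_Suc_iff using ws(1) by (simp add: \<kappa>S)
  define J where "J n = (LEAST j. n < \<kappa> (Suc j))" for n
  have ex: "\<exists>j. n < \<kappa> (Suc j)" for n
    using strict_mono_imp_increasing[OF mono, of "Suc n"] by (intro exI[of _ n]) simp
  define x where "x n = ws (J n) ! (n - \<kappa> (J n))" for n
  have J: "J (\<kappa> j + i) = j" if "i < length (ws j)" for i j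
    unfolding J_def
  proof (rule Least_equality)
    show "\<kappa> j + i < \<kappa> (Suc j)" using that by (simp add: \<kappa>S)
    fix j' assume "\<kappa> j + i < \<kappa> (Suc j')"
    then have "\<kappa> j < \<kappa> (Suc j')" by simp
    then show "j \<le> j'" using mono by (simp add: strict_mono_less)
  qed
  have x: "x (\<kappa> j + i) = ws j ! i" if "i < length (ws j)" for i j
    unfolding x_def J[OF that] by simp
  have "x n \<in> H" for n
  proof -
    have "n < \<kappa> (Suc (J n))" unfolding J_def using ex[of n] by (rule LeastI_ex)
    moreover have "\<kappa> (J n) \<le> n"
    proof (cases "J n")
      case (Suc j)
      then have "\<not> n < \<kappa> (Suc j)" unfolding J_def using not_less_Least[of j "\<lambda>j. n < \<kappa> (Suc j)"] by auto
      then show ?thesis by (simp add: Suc)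
    qed (simp add: \<kappa>_def)
    ultimately have "n - \<kappa> (J n) < length (ws (J n))" by (simp add: \<kappa>S)
    then show ?thesis unfolding x_def using ws(2) nth_mem by blast
  qed
  moreover have "sprod mul x (\<kappa> j) (\<kappa> (Suc j)) = e j" for j
    unfolding \<kappa>S ws(3)[symmetric] by (rule sprod_list) (use ws(1) x in auto)
  ultimately show ?thesis using that[of x \<kappa>] mono by (auto simp: \<kappa>_def)
qed

lemma sprod_blocks:
  assumes "strict_mono \<kappa>" "\<And>j. z j = sprod mul x (\<kappa> j) (\<kappa> (Suc j))" "i < j"
  shows "sprod mul z i j = sprod mul x (\<kappa> i) (\<kappa> j)"
  using assms(3)
proof (induction j)
  case (Suc j)
  show ?case
  proof (cases "i = j")
    case False
    then have "\<kappa> i < \<kappa> j" "\<kappa> j < \<kappa> (Suc j)" "i < j" using assms(1) Suc by (auto simp: strict_mono_less)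
    then show ?thesis using Suc False sprod_split[of "\<kappa> i" "\<kappa> j" "\<kappa> (Suc j)" x] assms(2) by simp
  qed (use assms(2) in simp)
qed simp

lemma factor_blocks:
  assumes "strict_mono \<kappa>" "\<kappa> 0 = 0" "\<And>j. z j = sprod mul x (\<kappa> j) (\<kappa> (Suc j))" "factor mul z \<rho> s e"
  shows "factor mul x (\<lambda>i. \<kappa> (\<rho> i)) s e"
proof -
  have \<rho>: "strict_mono \<rho>" "0 < \<rho> 0" using assms(4) by (auto simp: factor_def)
  have lt: "\<rho> i < \<rho> (Suc i)" for i using \<rho>(1) by (simp add: strict_mono_less)
  have z: "sprod mul z i j = sprod mul x (\<kappa> i) (\<kappa> j)" if "i < j" for i j
    using sprod_blocks[of \<kappa> z x] assms(1,3) that by blast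
  have "0 < \<kappa> (\<rho> 0)" using strict_monoD[OF assms(1) \<rho>(2)] by simp
  moreover have "strict_mono (\<lambda>i. \<kappa> (\<rho> i))" using assms(1) \<rho>(1) by (simp add: strict_mono_def)
  ultimately show ?thesis
    using assms(4) z[OF \<rho>(2)] z[OF lt] assms(2) unfolding factor_def by (simp del: sprod.simps)
qed

lemma sprod_gen: "range x \<subseteq> H \<Longrightarrow> i < j \<Longrightarrow> sprod mul x i j \<in> gen mul H"
proof (induction j)
  case (Suc j)
  then show ?case by (cases "i = j") (auto intro: gen.intros)
qed simp

text \<open>Each block ends with a segment of product \<open>f\<close> that starts inside it, so
  \<open>e = g f\<close>; its end is also a merge with the older position \<open>i\<close>, so
  \<open>f e = f\<close>. As \<open>t\<close> equals \<open>f\<close> or ends in \<open>f\<close>,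
  whatever fixes \<open>f\<close> on the right also fixes \<open>t\<close>.\<close>

lemma merge_factor:
  assumes x: "range x \<subseteq> H" "H \<subseteq> C"
    and i: "\<And>n. \<exists>r k. n \<le> r \<and> i < r \<and> r \<le> k \<and> sprod mul x r (Suc k) = f \<and>
      sprod mul x i (Suc k) = f \<and> sprod mul x 0 (Suc k) = t"
  obtains \<rho> e g where "factor mul x \<rho> t e" "e = mul g f" "mul f e = f" "g \<in> gen mul H"
    "f \<in> gen mul H" "t \<in> gen mul H" "\<And>e'. mul f e' = f \<Longrightarrow> mul t e' = t"
proof -
  obtain R Kf where R: "\<And>n. n \<le> R n \<and> i < R n \<and> R n \<le> Kf n \<and> sprod mul x (R n) (Suc (Kf n)) = f \<and>
      sprod mul x i (Suc (Kf n)) = f \<and> sprod mul x 0 (Suc (Kf n)) = t"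
    using i by metis
  \<comment> \<open>Each cut is the end of a merge whose late position lies strictly after the
    previous cut; the argument \<open>Suc k\<close> of \<open>Kf\<close> ensures this and keeps the
    factor \<open>g\<close> non-empty.\<close>
  define \<kappa> where "\<kappa> = rec_nat 0 (\<lambda>_ k. Suc (Kf (Suc k)))"
  have \<kappa>0: "\<kappa> 0 = 0" and \<kappa>S: "\<kappa> (Suc j) = Suc (Kf (Suc (\<kappa> j)))" for j by (simp_all add: \<kappa>_def)
  have lt: "\<kappa> j < R (Suc (\<kappa> j))" "R (Suc (\<kappa> j)) < \<kappa> (Suc j)" "i < \<kappa> (Suc j)" for j
    using R[of "Suc (\<kappa> j)"] by (auto simp: \<kappa>S)
  have mono: "strict_mono \<kappa>" unfolding strict_mono_Suc_iff using lt order.strict_trans by blast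
  define z where "z j = sprod mul x (\<kappa> j) (\<kappa> (Suc j))" for j
  have "z j \<in> C" for j
    unfolding z_def using x mono by (intro sprod_in) (auto simp: strict_mono_less)
  then obtain \<rho> s e where fz: "factor mul z \<rho> s e" using factor_exists by metis
  have fx: "factor mul x (\<lambda>i. \<kappa> (\<rho> i)) s e" by (rule factor_blocks[OF mono \<kappa>0 z_def fz])
  have \<rho>: "strict_mono \<rho>" "0 < \<rho> 0" using fz by (auto simp: factor_def)
  obtain a where a: "\<rho> 0 = Suc a" using \<rho>(2) gr0_implies_Suc by blast
  obtain b where b: "\<rho> 1 = Suc b" using \<rho> by (metis gr0_implies_Suc strict_monoD zero_less_one order.strict_trans)
  have ab: "\<rho> 0 < \<rho> 1" using \<rho>(1) by (simp add: strict_mono_less)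
  have s: "s = t" using fx R[of "Suc (\<kappa> a)"] by (simp add: factor_def a \<kappa>S del: sprod.simps)
  have e: "e = sprod mul x (\<kappa> (\<rho> 0)) (\<kappa> (\<rho> 1))" using fx unfolding factor_def by (metis One_nat_def)
  have "\<kappa> (\<rho> 0) \<le> \<kappa> b" using mono ab b by (simp add: strict_mono_less_eq)
  then have r: "\<kappa> (\<rho> 0) < R (Suc (\<kappa> b))" "R (Suc (\<kappa> b)) < \<kappa> (\<rho> 1)" using lt[of b] b by auto
  define g where "g = sprod mul x (\<kappa> (\<rho> 0)) (R (Suc (\<kappa> b)))"
  have fb: "sprod mul x (R (Suc (\<kappa> b))) (\<kappa> (\<rho> 1)) = f" "sprod mul x i (\<kappa> (\<rho> 1)) = f"
    unfolding b \<kappa>S using R[of "Suc (\<kappa> b)"] by (simp_all del: sprod.simps)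
  have fa: "sprod mul x i (\<kappa> (\<rho> 0)) = f" "sprod mul x 0 (\<kappa> (\<rho> 0)) = t" "i < \<kappa> (\<rho> 0)"
    using R[of "Suc (\<kappa> a)"] lt(3)[of a] by (simp_all add: a \<kappa>S del: sprod.simps)
  have "e = mul g f" using sprod_split[OF r, of x] fb by (simp add: e g_def)
  moreover have "mul f e = f"
    using sprod_split[of i "\<kappa> (\<rho> 0)" "\<kappa> (\<rho> 1)" x] fa fb r by (simp add: e)
  moreover have "g \<in> gen mul H" "f \<in> gen mul H" "t \<in> gen mul H"
    using sprod_gen[OF x(1) r(1)] sprod_gen[OF x(1) r(2)] sprod_gen[OF x(1), of 0 "\<kappa> (\<rho> 0)"] fa fb
    by (auto simp: g_def)
  moreover have "mul t e' = t" if "mul f e' = f" for e'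
  proof (cases "i = 0")
    case False
    then have "t = mul (sprod mul x 0 i) f" using sprod_split[of 0 i "\<kappa> (\<rho> 0)" x] fa by simp
    then show ?thesis using that by (simp add: assoc)
  qed (use fa that in simp)
  ultimately show ?thesis using that fx s by blast
qed

definition saturated :: "'a set \<Rightarrow> ('a \<Rightarrow> 'a \<Rightarrow> bool) \<Rightarrow> bool" where
  "saturated H acc \<longleftrightarrow> (\<forall>x \<rho> s e \<rho>' s' e'. range x \<subseteq> H \<longrightarrow> factor mul x \<rho> s e \<longrightarrow>
     factor mul x \<rho>' s' e' \<longrightarrow> acc s e = acc s' e')"

text \<open>Since \<open>e1 e2 = e1\<close> and \<open>e2 e1 = e2\<close>, the word
  \<open>t e1 e2 e1 e2 ...\<close> has both pairs as factorisations, depending on where it is cut.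
  So acceptance depends on \<open>t\<close> and \<open>f\<close> alone, and it suffices that a
  colour records these two.\<close>

lemma saturated_agree:
  assumes sat: "saturated H acc"
    and el: "t \<in> gen mul H" "f \<in> gen mul H" "g1 \<in> gen mul H" "g2 \<in> gen mul H"
    and e1: "e1 = mul g1 f" "mul f e1 = f" "mul t e1 = t"
    and e2: "e2 = mul g2 f" "mul f e2 = f" "mul t e2 = t"
  shows "acc t e1 = acc t e2"
proof -
  define e where "e j = (if j = 0 then t else if odd j then e1 else e2)" for j :: nat
  have "e j \<in> gen mul H" for j using el e1(1) e2(1) by (auto simp: e_def intro: gen.step)
  then obtain x \<kappa> where x: "range x \<subseteq> H" "\<kappa> 0 = 0" "strict_mono \<kappa>"
    "\<And>j. sprod mul x (\<kappa> j) (\<kappa> (Suc j)) = e j"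
    using concat_sequences[of e H] by blast
  have lt: "\<kappa> j < \<kappa> (Suc j)" for j using x(3) by (simp add: strict_mono_less)
  have two: "sprod mul x (\<kappa> j) (\<kappa> (Suc (Suc j))) = mul (e j) (e (Suc j))" for j
    using sprod_split[OF lt lt, of x j] x(4) by simp
  have m: "mul e1 e1 = e1" "mul e2 e2 = e2" "mul e1 e2 = e1" "mul e2 e1 = e2"
    using e1 e2 by (simp_all add: assoc)
  have mono: "strict_mono (\<lambda>i. \<kappa> (2 * i + c))" for c using x(3) by (simp add: strict_mono_def)
  have "sprod mul x (\<kappa> (2 * i + 1)) (\<kappa> (2 * Suc i + 1)) = e1" for i
    using two[of "2 * i + 1"] m by (simp add: e_def)
  moreover have "sprod mul x 0 (\<kappa> 1) = t" using x(4)[of 0] x(2) by (simp add: e_def)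
  ultimately have "factor mul x (\<lambda>i. \<kappa> (2 * i + 1)) t e1"
    unfolding factor_def using mono[of 1] m e1 lt[of 0] x(2) by simp
  moreover have "sprod mul x (\<kappa> (2 * i + 2)) (\<kappa> (2 * Suc i + 2)) = e2" for i
    using two[of "2 * i + 2"] m by (simp add: e_def)
  moreover have "sprod mul x 0 (\<kappa> 2) = t" using two[of 0] x(2) e1 by (simp add: e_def numeral_2_eq_2)
  ultimately have "factor mul x (\<lambda>i. \<kappa> (2 * i + 1)) t e1" "factor mul x (\<lambda>i. \<kappa> (2 * i + 2)) t e2"
    unfolding factor_def using mono[of 2] m e2 strict_monoD[OF x(3), of 0 2] x(2) by (simp_all add: numeral_2_eq_2)
  then show ?thesis using sat x(1) unfolding saturated_def by blast
qed

text \<open>The pair \<open>(t, f)\<close> is decoded from the low digit of the colour. Any suitable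
  \<open>e\<close> ending in \<open>f\<close> may represent it: under saturation all of them get the
  same verdict.\<close>

definition goodc :: "'a set \<Rightarrow> ('a \<Rightarrow> 'a \<Rightarrow> bool) \<Rightarrow> nat \<Rightarrow> bool" where
  "goodc H acc m \<longleftrightarrow> (\<exists>t f e g. (t, f) \<in> C \<times> C \<and> idx (t, f) = m mod K \<and> f \<in> gen mul H \<and> t \<in> gen mul H \<and>
     g \<in> gen mul H \<and> e = mul g f \<and> mul f e = f \<and> mul t e = t \<and> acc t e)"

text \<open>Merging yields one particular factorisation, whose pair is named by the least recurring
  colour; saturation carries its verdict over to the given factorisation.\<close>

theorem mcnaughton:
  assumes H: "H \<subseteq> C" and sat: "saturated H acc" and x: "range x \<subseteq> H" and f: "factor mul x \<rho> s e"
  shows "goodc H acc (mininf (\<lambda>k. colr (x k) (rx x k))) \<longleftrightarrow> acc s e"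
proof -
  define m where "m = mininf (\<lambda>k. colr (x k) (rx x k))"
  have xC: "range x \<subseteq> C" using x H by blast
  then have "C \<noteq> {}" by auto
  then have "0 < K" using fin by (simp add: K_def card_gt_0_iff)
  then have "m mod K \<in> {0..<K}" by simp
  then obtain t f where tf: "(t, f) \<in> C \<times> C" "idx (t, f) = m mod K"
    using idx unfolding bij_betw_def by (metis imageE surj_pair)
  obtain i where "\<And>n. \<exists>r k. n \<le> r \<and> i < r \<and> r \<le> k \<and> sprod mul x r (Suc k) = f \<and>
    sprod mul x i (Suc k) = f \<and> sprod mul x 0 (Suc k) = t"
    using merge_infinite[OF xC m_def tf] by blast
  then obtain \<rho>' e' g where e': "factor mul x \<rho>' t e'" "e' = mul g f" "mul f e' = f" "g \<in> gen mul H"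
    "f \<in> gen mul H" "t \<in> gen mul H" "\<And>e'. mul f e' = f \<Longrightarrow> mul t e' = t"
    using merge_factor[OF x H] by blast
  have eq: "acc s e = acc t e'" using sat x f e'(1) unfolding saturated_def by blast
  have "goodc H acc m \<longleftrightarrow> acc t e'"
  proof
    assume "acc t e'"
    then show "goodc H acc m" unfolding goodc_def using tf e' by blast
  next
    assume "goodc H acc m"
    then obtain t2 f2 e2 g2 where 2: "(t2, f2) \<in> C \<times> C" "idx (t2, f2) = m mod K" "g2 \<in> gen mul H"
      "e2 = mul g2 f2" "mul f2 e2 = f2" "mul t2 e2 = t2" "acc t2 e2"
      unfolding goodc_def by blast
    have "(t2, f2) = (t, f)" using 2 tf idx by (metis bij_betw_imp_inj_on inj_onD)
    then have "acc t e' = acc t e2" using saturated_agree[OF sat e'(6,5,4) 2(3)] 2 e' by auto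
    then show "acc t e'" using 2 \<open>(t2, f2) = (t, f)\<close> by simp
  qed
  then show ?thesis using eq m_def by simp
qed

end

section \<open>Certificates for games with a semigroup winning condition\<close>

text \<open>\<open>R\<close> is a set of values of play segments between states, closed under composition, so that winning is
  a condition on the linked pairs in \<open>R\<close> alone.\<close>

definition certificate ::
    "('s \<Rightarrow> 's \<Rightarrow> 's) \<Rightarrow> ('s \<Rightarrow> 's \<Rightarrow> bool) \<Rightarrow> 'a set \<Rightarrow> 'b set \<Rightarrow> ('v \<Rightarrow> 'a \<Rightarrow> 'b \<Rightarrow> 'v) \<Rightarrow>
     ('v \<Rightarrow> 'a \<Rightarrow> 'b \<Rightarrow> 's) \<Rightarrow> 'v \<Rightarrow> bool \<Rightarrow> ('v \<times> 'z) set \<Rightarrow> (('v \<times> 'z) \<times> 's \<times> ('v \<times> 'z)) set \<Rightarrow> 'v \<times> 'z \<Rightarrow> bool" where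
  "certificate mul acc A B \<delta> h v0 pl Q R q0 \<longleftrightarrow> finite Q \<and> finite R \<and> q0 \<in> Q \<and> fst q0 = v0 \<and>
     (\<forall>p v q w r. (p, v, q) \<in> R \<longrightarrow> (q, w, r) \<in> R \<longrightarrow> (p, mul v w, r) \<in> R) \<and>
     (if pl then \<forall>q\<in>Q. \<forall>a\<in>A. \<exists>b\<in>B. \<exists>q'\<in>Q. fst q' = \<delta> (fst q) a b \<and> (q, h (fst q) a b, q') \<in> R
      else \<forall>q\<in>Q. \<exists>a\<in>A. \<forall>b\<in>B. \<exists>q'\<in>Q. fst q' = \<delta> (fst q) a b \<and> (q, h (fst q) a b, q') \<in> R) \<and>
     (\<forall>t e q. (q0, t, q) \<in> R \<longrightarrow> (q, e, q) \<in> R \<longrightarrow> mul t e = t \<longrightarrow> mul e e = e \<longrightarrow> acc t e = pl)"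

text \<open>Composition of labelled edges, with \<open>None\<close> as an absorbing zero for edges
  that do not meet. It makes play segments a finite semigroup, so that facts about words apply to
  plays.\<close>

fun pmul :: "('s \<Rightarrow> 's \<Rightarrow> 's) \<Rightarrow> ('q \<times> 's \<times> 'q) option \<Rightarrow> ('q \<times> 's \<times> 'q) option \<Rightarrow> ('q \<times> 's \<times> 'q) option" where
  "pmul m (Some (p, v, q)) (Some (q', w, r)) = (if q = q' then Some (p, m v w, r) else None)"
| "pmul m _ _ = None"

context fin_semigroup
begin

lemma fin_semigroup_pmul:
  assumes "finite Q"
  shows "fin_semigroup (pmul mul) (insert None (Some ` (Q \<times> C \<times> Q)))"
proof
  show "pmul mul (pmul mul a b) c = pmul mul a (pmul mul b c)"
    for a b c :: "('b \<times> 'a \<times> 'b) option"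
    by (cases a; cases b; cases c) (auto simp: assoc)
  show "finite (insert None (Some ` (Q \<times> C \<times> Q)))" using assms fin by simp
  show "pmul mul a b \<in> insert None (Some ` (Q \<times> C \<times> Q))"
    if "a \<in> insert None (Some ` (Q \<times> C \<times> Q))" "b \<in> insert None (Some ` (Q \<times> C \<times> Q))" for a b
    using that by (auto intro!: imageI closed)
qed

lemma sprod_pmul:
  assumes "\<And>n. y n = Some (s n, g n, s (Suc n))" "i < j"
  shows "sprod (pmul mul) y i j = Some (s i, sprod mul g i j, s j)"
  using assms(2)
proof (induction j)
  case (Suc j)
  then show ?case using assms(1) by (cases "i = j") auto
qed simp

text \<open>\<open>None\<close> is absorbing, so prefix products that are defined arbitrarily late
  were never \<open>None\<close>, and consecutive edges meet.\<close>

lemma sprod_pmul_chain: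
  assumes "\<And>n. y n = Some (s n, g n, s' n)" "\<And>n. \<exists>j>n. sprod (pmul mul) y 0 j \<noteq> None"
  shows "s' n = s (Suc n)"
proof -
  have ne: "sprod (pmul mul) y 0 j \<noteq> None" if "0 < j" for j
  proof
    assume *: "sprod (pmul mul) y 0 j = None"
    have "sprod (pmul mul) y 0 (j + k) = None" for k
      by (induction k) (use * that in auto)
    moreover obtain j' where "j' > j" "sprod (pmul mul) y 0 j' \<noteq> None" using assms(2) by blast
    ultimately show False by (metis less_imp_add_positive)
  qed
  have last: "\<exists>v. sprod (pmul mul) y 0 (Suc n) = Some (s 0, v, s' n)" for n
  proof (induction n)
    case (Suc n)
    then obtain v where v: "sprod (pmul mul) y 0 (Suc n) = Some (s 0, v, s' n)" by blast
    have "sprod (pmul mul) y 0 (Suc (Suc n)) = pmul mul (Some (s 0, v, s' n)) (y (Suc n))"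
      using v by (simp only: sprod.simps(2)[of _ _ _ "Suc n"]) simp
    then show ?case using ne[of "Suc (Suc n)"] assms(1)[of "Suc n"] by (auto simp del: sprod.simps split: if_splits)
  qed (use assms in simp)
  obtain v where v: "sprod (pmul mul) y 0 (Suc n) = Some (s 0, v, s' n)" using last by blast
  have "sprod (pmul mul) y 0 (Suc (Suc n)) = pmul mul (Some (s 0, v, s' n)) (y (Suc n))"
    using v by (simp only: sprod.simps(2)[of _ _ _ "Suc n"]) simp
  then show ?thesis using ne[of "Suc (Suc n)"] assms(1)[of "Suc n"] by (auto simp del: sprod.simps split: if_splits)
qed

lemma rx_cong: "(\<And>i. i < k \<Longrightarrow> x i = y i) \<Longrightarrow> rx x k = rx y k"
  by (induction k) auto

definition rxs :: "'a list set" where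
  "rxs = {rx x k |x k. range x \<subseteq> C}"

lemma rxs_step:
  assumes "xs \<in> rxs" "g \<in> C"
  shows "kf id (ystep g xs) \<in> rxs" "colr g xs \<le> card C * K"
proof -
  obtain x k where x: "range x \<subseteq> C" "xs = rx x k" using assms(1) by (auto simp: rxs_def)
  define y where "y = x(k := g)"
  have y: "range y \<subseteq> C" using x(1) assms(2) by (auto simp: y_def)
  have "rx y k = xs" unfolding x(2) by (rule rx_cong) (simp add: y_def)
  then have "kf id (ystep g xs) = rx y (Suc k)" "colr g xs = colr (y k) (rx y k)" by (simp_all add: y_def)
  then show "kf id (ystep g xs) \<in> rxs" "colr g xs \<le> card C * K"
    using y colr_le[OF y, of k] by (auto simp: rxs_def simp del: rx.simps)
qed

lemma finite_rxs: "finite rxs"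
proof (rule finite_subset)
  show "rxs \<subseteq> {xs. set xs \<subseteq> C \<and> length xs \<le> card C}"
    using rx_in length_rx by (fastforce simp: rxs_def)
  show "finite {xs. set xs \<subseteq> C \<and> length xs \<le> card C}" using fin by (rule finite_lists_length_le)
qed

text \<open>On the arena of positions, automaton states and colours, one player wins from the start
  with a positional strategy; automaton state and colour become the memory of the certificate. A
  linked pair in \<open>R\<close> unfolds into a play of this strategy, whose least recurring colour
  tells by \<open>mcnaughton\<close> how the pair is accepted.\<close>

theorem certificates_exist:
  fixes A :: "'m set" and B :: "'n set" and \<delta> :: "'v \<Rightarrow> 'm \<Rightarrow> 'n \<Rightarrow> 'v" and h :: "'v \<Rightarrow> 'm \<Rightarrow> 'n \<Rightarrow> 'a"
  assumes fA: "finite A" "A \<noteq> {}" and fB: "finite B" "B \<noteq> {}" and fV: "finite Vs" "v0 \<in> Vs"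
    and \<delta>: "\<And>v a b. v \<in> Vs \<Longrightarrow> a \<in> A \<Longrightarrow> b \<in> B \<Longrightarrow> \<delta> v a b \<in> Vs"
    and H: "H = {h v a b |v a b. v \<in> Vs \<and> a \<in> A \<and> b \<in> B}" "H \<subseteq> C"
    and sat: "saturated H acc"
  shows "\<exists>pl Q R (q0 :: 'v \<times> ('a list \<times> nat)). certificate mul acc A B \<delta> h v0 pl Q R q0"
proof -
  \<comment> \<open>The parity game colours vertices and not moves, so the state carries the colour
    of the last move.\<close>
  define next_st :: "'v \<times> ('a list \<times> nat) \<Rightarrow> 'm \<Rightarrow> 'n \<Rightarrow> 'v \<times> ('a list \<times> nat)" where
    "next_st s a b = (\<delta> (fst s) a b, kf id (ystep (h (fst s) a b) (fst (snd s))), colr (h (fst s) a b) (fst (snd s)))"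
    for s a b
  define S where "S = Vs \<times> rxs \<times> {..card C * K}"
  define E :: "((('v \<times> ('a list \<times> nat)) \<times> 'm option) \<times> (('v \<times> ('a list \<times> nat)) \<times> 'm option)) set" where
    "E = {((s, None), (s, Some a)) |s a. a \<in> A} \<union> {((s, Some a), (next_st s a b, None)) |s a b. b \<in> B}"
  have E1: "((s, None), (s, Some a)) \<in> E" if "a \<in> A" for s a unfolding E_def using that by blast
  have E2: "((s, Some a), (next_st s a b, None)) \<in> E" if "b \<in> B" for s a b unfolding E_def using that by blast
  define own where "own v = (snd v \<noteq> None)" for v :: "('v \<times> ('a list \<times> nat)) \<times> 'm option"
  define col where "col v = snd (snd (fst v))" for v :: "('v \<times> ('a list \<times> nat)) \<times> 'm option"
  define U where "U = S \<times> insert None (Some ` A)"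
  interpret parity_game E own col "goodc H acc" .
  have hC: "h v a b \<in> C" "h v a b \<in> H" if "v \<in> Vs" "a \<in> A" "b \<in> B" for v a b using that H by auto
  have nextS: "next_st s a b \<in> S" if "s \<in> S" "a \<in> A" "b \<in> B" for s a b
    using that rxs_step[of "fst (snd s)" "h (fst s) a b"] hC(1) \<delta> by (auto simp: S_def next_st_def)
  have "finite U" unfolding U_def S_def using fV fA finite_rxs by simp
  moreover have "arena U"
    unfolding arena_def
  proof
    fix v assume "v \<in> U"
    then obtain s m where v: "v = (s, m)" "s \<in> S" "m \<in> insert None (Some ` A)" by (auto simp: U_def)
    show "\<exists>u\<in>U. (v, u) \<in> E"
    proof (cases m)
      case None
      obtain a where "a \<in> A" using fA by auto
      then show ?thesis using v None E1 by (intro bexI[of _ "(s, Some a)"]) (auto simp: U_def)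
    next
      case (Some a)
      obtain b where "b \<in> B" using fB by auto
      then show ?thesis using v Some nextS[of s a b]
        by (intro bexI[of _ "(next_st s a b, None)"]) (auto simp: E2 U_def)
    qed
  qed
  ultimately have "\<exists>D F. (\<forall>pl. dominion U pl (D pl) (F pl)) \<and> D True \<union> D False = U"
    by (rule parity_determined)
  then obtain D F where D: "\<And>pl. dominion U pl (D pl) (F pl)" "D True \<union> D False = U" by auto
  \<comment> \<open>Any colour up to \<open>card C * K\<close> would serve at the start, since
    finitely many rounds do not affect \<open>mininf\<close>.\<close>
  define q0 where "q0 = (v0, ([] :: 'a list, card C * K))"
  have "q0 \<in> S"
  proof -
    obtain a b where "a \<in> A" "b \<in> B" using fA fB by auto
    then obtain c where "c \<in> C" using hC(1)[OF fV(2)] by blast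
    then have "[] \<in> rxs" unfolding rxs_def by (intro CollectI exI[of _ "\<lambda>_. c"] exI[of _ 0]) auto
    then show ?thesis using fV by (simp add: q0_def S_def)
  qed
  then have "(q0, None) \<in> U" by (simp add: U_def)
  then obtain pl where pl: "(q0, None) \<in> D pl" using D(2) by blast
  note dom = D(1)[of pl, unfolded dominion_def]
  have DU: "D pl \<subseteq> U" and FE: "F pl \<subseteq> E \<inter> D pl \<times> D pl" using dom by blast+
  define Q where "Q = {s. (s, None) \<in> D pl}"
  have QS: "Q \<subseteq> S" using DU by (auto simp: Q_def U_def)
  have fQ: "finite Q" using QS fV finite_rxs finite_subset by (fastforce simp: S_def)
  define T where "T = {(s, h (fst s) a b, next_st s a b) |s a b. s \<in> Q \<and> a \<in> A \<and> b \<in> B \<and>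
    ((s, None), (s, Some a)) \<in> F pl \<and> ((s, Some a), (next_st s a b, None)) \<in> F pl}"
  have TQ: "T \<subseteq> Q \<times> C \<times> Q"
  proof
    fix r assume "r \<in> T"
    then obtain s a b where r: "r = (s, h (fst s) a b, next_st s a b)" "s \<in> Q" "a \<in> A" "b \<in> B"
      "((s, Some a), (next_st s a b, None)) \<in> F pl" by (auto simp: T_def)
    then have "(next_st s a b, None) \<in> D pl" using FE by blast
    then have "next_st s a b \<in> Q" by (simp add: Q_def)
    moreover have "s \<in> S" using r(2) QS by (rule rev_subsetD)
    then have "h (fst s) a b \<in> C" using hC(1) r(3,4) by (simp add: S_def mem_Times_iff)
    ultimately show "r \<in> Q \<times> C \<times> Q" using r(1,2) by simp
  qed
  note P = fin_semigroup_pmul[OF fQ]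
  \<comment> \<open>The single moves of the winning strategy, closed under composition.\<close>
  define R where "R = {r. Some r \<in> gen (pmul mul) (Some ` T)}"
  have RQ: "R \<subseteq> Q \<times> C \<times> Q"
  proof -
    have "gen (pmul mul) (Some ` T) \<subseteq> insert None (Some ` (Q \<times> C \<times> Q))"
      by (rule gen_subset, use TQ in blast, rule fin_semigroup.closed[OF P])
    then show ?thesis by (auto simp: R_def)
  qed
  have move: "fst (next_st s a b) = \<delta> (fst s) a b \<and> (s, h (fst s) a b, next_st s a b) \<in> R \<and> next_st s a b \<in> Q"
    if "s \<in> Q" "a \<in> A" "b \<in> B" "((s, None), (s, Some a)) \<in> F pl" "((s, Some a), (next_st s a b, None)) \<in> F pl"
    for s a b
  proof -
    have t: "(s, h (fst s) a b, next_st s a b) \<in> T" unfolding T_def using that by blast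
    then have "(s, h (fst s) a b, next_st s a b) \<in> R" unfolding R_def by (simp add: gen.base)
    moreover have "next_st s a b \<in> Q" using t TQ by blast
    ultimately show ?thesis by (simp add: next_st_def)
  qed
  have moves: "if pl then \<forall>q\<in>Q. \<forall>a\<in>A. \<exists>b\<in>B. \<exists>q'\<in>Q. fst q' = \<delta> (fst q) a b \<and> (q, h (fst q) a b, q') \<in> R
      else \<forall>q\<in>Q. \<exists>a\<in>A. \<forall>b\<in>B. \<exists>q'\<in>Q. fst q' = \<delta> (fst q) a b \<and> (q, h (fst q) a b, q') \<in> R"
  proof (cases pl)
    case True
    have "\<exists>b\<in>B. \<exists>q'\<in>Q. fst q' = \<delta> (fst q) a b \<and> (q, h (fst q) a b, q') \<in> R" if "q \<in> Q" "a \<in> A" for q a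
    proof -
      have q: "(q, None) \<in> D pl" using that by (simp add: Q_def)
      have "(q, Some a) \<in> U" "((q, None), (q, Some a)) \<in> E" using that QS E1 by (auto simp: U_def)
      then have f1: "((q, None), (q, Some a)) \<in> F pl"
        using q dom True by (auto simp: own_def)
      then have "(q, Some a) \<in> D pl" using FE by auto
      then obtain u where u: "((q, Some a), u) \<in> F pl" using dom True by (auto simp: own_def)
      then have "((q, Some a), u) \<in> E" using FE by auto
      then obtain b where "b \<in> B" "u = (next_st q a b, None)" by (auto simp: E_def)
      then show ?thesis using move[of q a b] that f1 u by blast
    qed
    then show ?thesis using True by simp
  next
    case False
    have "\<exists>a\<in>A. \<forall>b\<in>B. \<exists>q'\<in>Q. fst q' = \<delta> (fst q) a b \<and> (q, h (fst q) a b, q') \<in> R" if "q \<in> Q" for q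
    proof -
      have "(q, None) \<in> D pl" using that by (simp add: Q_def)
      then obtain u where u: "((q, None), u) \<in> F pl" using dom False by (auto simp: own_def)
      then have "((q, None), u) \<in> E" using FE by auto
      then obtain a where a: "a \<in> A" "u = (q, Some a)" by (auto simp: E_def)
      have qa: "(q, Some a) \<in> D pl" using u a FE by auto
      have "\<exists>q'\<in>Q. fst q' = \<delta> (fst q) a b \<and> (q, h (fst q) a b, q') \<in> R" if "b \<in> B" for b
      proof -
        have "(next_st q a b, None) \<in> U" using nextS[of q a b] QS \<open>q \<in> Q\<close> a that by (auto simp: U_def)
        moreover have "((q, Some a), (next_st q a b, None)) \<in> E" using that by (rule E2)
        ultimately have "((q, Some a), (next_st q a b, None)) \<in> F pl"
          using qa dom False by (auto simp: own_def)
        then show ?thesis using move[of q a b] \<open>q \<in> Q\<close> a u that by blast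
      qed
      then show ?thesis using a by blast
    qed
    then show ?thesis using False by simp
  qed
  have win: "acc t e = pl" if te: "(q0, t, q) \<in> R" "(q, e, q) \<in> R" "mul t e = t" "mul e e = e" for t e q
  proof -
    \<comment> \<open>The pair is unfolded into a play: \<open>t\<close> once and then
      \<open>e\<close> forever, each spelled as a word of single moves.\<close>
    define w where "w j = (if j = 0 then Some (q0, t, q) else Some (q, e, q))" for j :: nat
    have "w j \<in> gen (pmul mul) (Some ` T)" for j using te by (simp add: w_def R_def)
    then obtain y \<kappa> where y: "range y \<subseteq> Some ` T" "\<kappa> 0 = 0" "strict_mono \<kappa>"
      "\<And>j. sprod (pmul mul) y (\<kappa> j) (\<kappa> (Suc j)) = w j"
      using fin_semigroup.concat_sequences[OF P, of w "Some ` T"] by blast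
    have "\<exists>s a b. y n = Some (s, h (fst s) a b, next_st s a b) \<and> s \<in> Q \<and> a \<in> A \<and> b \<in> B \<and>
      ((s, None), (s, Some a)) \<in> F pl \<and> ((s, Some a), (next_st s a b, None)) \<in> F pl" for n
    proof -
      have "y n \<in> Some ` T" using y(1) by blast
      then show ?thesis unfolding T_def by blast
    qed
    then obtain s a b where sab: "\<And>n. y n = Some (s n, h (fst (s n)) (a n) (b n), next_st (s n) (a n) (b n)) \<and>
        s n \<in> Q \<and> a n \<in> A \<and> b n \<in> B \<and> ((s n, None), (s n, Some (a n))) \<in> F pl \<and>
        ((s n, Some (a n)), (next_st (s n) (a n) (b n), None)) \<in> F pl" by metis
    define g where "g n = h (fst (s n)) (a n) (b n)" for n
    have lt: "\<kappa> j < \<kappa> (Suc j)" for j using y(3) by (simp add: strict_mono_less)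
    have pre: "sprod (pmul mul) y 0 (\<kappa> (Suc j)) = Some (q0, t, q)" for j
    proof (induction j)
      case 0
      then show ?case using y(4)[of 0] y(2) by (simp add: w_def)
    next
      case (Suc j)
      have "0 < \<kappa> (Suc j)" using lt[of j] by simp
      from fin_semigroup.sprod_split[OF P this lt] show ?case using Suc y(4)[of "Suc j"] te(3) by (simp add: w_def)
    qed
    have chain: "next_st (s n) (a n) (b n) = s (Suc n)" for n
    proof (rule sprod_pmul_chain[where g = g and y = y])
      show "y n = Some (s n, g n, next_st (s n) (a n) (b n))" for n using sab by (simp add: g_def)
      show "\<exists>j>n. sprod (pmul mul) y 0 j \<noteq> None" for n
      proof -
        have "n < \<kappa> (Suc n)" using strict_mono_imp_increasing[OF y(3), of "Suc n"] by simp
        then show ?thesis using pre[of n] by (intro exI[of _ "\<kappa> (Suc n)"]) simp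
      qed
    qed
    have y': "y n = Some (s n, g n, s (Suc n))" for n using sab[of n] chain by (simp add: g_def)
    have sp: "sprod (pmul mul) y i j = Some (s i, sprod mul g i j, s j)" if "i < j" for i j
      using sprod_pmul[of y s g i j] y' that by blast
    have s0: "s 0 = q0" and t: "sprod mul g 0 (\<kappa> 1) = t"
      using sp[of 0 "\<kappa> 1"] pre[of 0] lt[of 0] y(2) by auto
    have e: "sprod mul g (\<kappa> (Suc j)) (\<kappa> (Suc (Suc j))) = e" for j
      using sp[OF lt[of "Suc j"]] y(4)[of "Suc j"] by (simp add: w_def)
    have "factor mul g (\<lambda>i. \<kappa> (Suc i)) t e"
      unfolding factor_def using y(3) lt[of 0] y(2) t e te by (auto simp: strict_mono_def simp del: sprod.simps)
    moreover have "range g \<subseteq> H"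
    proof -
      have "fst (s n) \<in> Vs" for n using sab[of n] QS by (auto simp: S_def)
      then show ?thesis using sab hC(2) by (auto simp: g_def)
    qed
    ultimately have mc: "goodc H acc (mininf (\<lambda>k. colr (g k) (rx g k))) \<longleftrightarrow> acc t e"
      using mcnaughton[OF H(2) sat] by blast
    have xs: "fst (snd (s n)) = rx g n" for n
    proof (induction n)
      case (Suc n)
      then show ?case using chain[of n, symmetric] by (simp add: next_st_def g_def)
    qed (simp add: s0 q0_def)
    have cs: "snd (snd (s (Suc n))) = colr (g n) (rx g n)" for n
      using chain[of n, symmetric] xs[of n] by (simp add: next_st_def g_def)
    \<comment> \<open>Each round contributes two vertices with the same colour, and a colour is
      stored one round after its letter; \<open>mininf_double\<close> and a shift by one undo
      this.\<close>
    define p where "p n = (s (n div 2), if even n then None else Some (a (n div 2)))" for n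
    have "(p n, p (Suc n)) \<in> F pl" for n
    proof (cases "even n")
      case True
      then show ?thesis using sab[of "n div 2"] by (simp add: p_def)
    next
      case False
      then have "Suc n div 2 = Suc (n div 2)" by presburger
      then show ?thesis using sab[of "n div 2"] False by (simp add: p_def chain)
    qed
    then have "path (F pl) p" by (simp add: path_def)
    then have "goodc H acc (mininf (\<lambda>i. col (p i))) = pl" using dom by blast
    moreover have "mininf (\<lambda>i. col (p i)) = mininf (\<lambda>k. colr (g k) (rx g k))"
    proof -
      have "mininf (\<lambda>i. col (p i)) = mininf (\<lambda>n. snd (snd (s n)))"
        using mininf_double[of "\<lambda>n. snd (snd (s n))"] by (simp add: col_def p_def)
      also have "\<dots> = mininf (\<lambda>n. snd (snd (s (1 + n))))"
        using mininf_shift[of "\<lambda>n. snd (snd (s n))" 1] by simp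
      finally show ?thesis using cs by simp
    qed
    ultimately show ?thesis using mc by simp
  qed
  have "finite R" using finite_subset[OF RQ] fQ fin by simp
  moreover have "q0 \<in> Q" using pl by (simp add: Q_def)
  moreover have "(p, mul v w, r) \<in> R" if "(p, v, q) \<in> R" "(q, w, r) \<in> R" for p v q w r
    using gen.step[of "Some (p, v, q)" "pmul mul" "Some ` T" "Some (q, w, r)"] that by (simp add: R_def)
  ultimately have "certificate mul acc A B \<delta> h v0 pl Q R q0"
    unfolding certificate_def using fQ moves win by (auto simp: q0_def)
  then show ?thesis by blast
qed

end

section \<open>The game of a synthesis problem\<close>

text \<open>Ramsey's theorem with the state as an extra colour cuts the play at repetitions of one
  state. Closure puts the prefix and the loop into \<open>R\<close>, and the certificate judges this
  pair.\<close>

lemma (in fin_semigroup) certificate_play: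
  assumes cert: "certificate mul acc A B \<delta> h v0 pl Q R q0"
    and q: "q 0 = q0" "\<And>n. q n \<in> Q"
    and R: "\<And>n. (q n, x n, q (Suc n)) \<in> R"
    and x: "range x \<subseteq> C"
  obtains \<rho> s e where "factor mul x \<rho> s e" "acc s e = pl"
proof -
  have fQ: "finite Q" and cl: "\<And>p v q w r. (p, v, q) \<in> R \<Longrightarrow> (q, w, r) \<in> R \<Longrightarrow> (p, mul v w, r) \<in> R"
    and win: "\<And>t e q. (q0, t, q) \<in> R \<Longrightarrow> (q, e, q) \<in> R \<Longrightarrow> mul t e = t \<Longrightarrow> mul e e = e \<Longrightarrow> acc t e = pl"
    using cert unfolding certificate_def by blast+
  have seg: "(q i, sprod mul x i j, q j) \<in> R" if "i < j" for i j
    using that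
  proof (induction j)
    case (Suc j)
    then show ?case using R cl by (cases "i = j") auto
  qed simp
  have "x i \<in> C" for i using x by blast
  then obtain \<rho> s e p where f: "factor mul x \<rho> s e" "\<And>i. q (\<rho> i) = p"
    using factor_exists_state[of x Q q] fQ q(2) by metis
  then have \<rho>: "0 < \<rho> 0" "strict_mono \<rho>" "sprod mul x 0 (\<rho> 0) = s" "sprod mul x (\<rho> 0) (\<rho> (Suc 0)) = e"
    "mul s e = s" "mul e e = e" by (auto simp: factor_def)
  have "\<rho> 0 < \<rho> (Suc 0)" using \<rho>(2) by (simp add: strict_mono_less)
  then have "acc s e = pl" using win seg[OF \<rho>(1)] seg[of "\<rho> 0" "\<rho> (Suc 0)"] f(2) \<rho> q(1) by metis
  then show ?thesis using that f(1) by blast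
qed

text \<open>The flags tell whether an event occurs in a segment. In the repeated value of a
  factorisation a flag is set iff its event occurs infinitely often.\<close>

fun gmul :: "sform \<Rightarrow> nat \<times> bool \<times> bool \<Rightarrow> nat \<times> bool \<times> bool \<Rightarrow> nat \<times> bool \<times> bool" where
  "gmul \<chi> (s, d, c) (s', d', c') = (smul \<chi> s s', d \<or> d', c \<or> c')"

fun gacc :: "sform \<Rightarrow> nat \<times> bool \<times> bool \<Rightarrow> nat \<times> bool \<times> bool \<Rightarrow> bool" where
  "gacc \<chi> (s, _, _) (e, d, c) = (if d then sacc \<chi> s e else c)"

definition gcar :: "sform \<Rightarrow> (nat \<times> bool \<times> bool) set" where
  "gcar \<chi> = scar \<chi> \<times> UNIV \<times> UNIV"

lemma fin_semigroup_gmul: "fin_semigroup (gmul \<chi>) (gcar \<chi>)"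
proof
  show "gmul \<chi> (gmul \<chi> a b) c = gmul \<chi> a (gmul \<chi> b c)" for a b c
    by (cases a; cases b; cases c) (auto simp: smul_assoc)
  show "finite (gcar \<chi>)" by (simp add: gcar_def finite_scar)
  show "gmul \<chi> a b \<in> gcar \<chi>" if "a \<in> gcar \<chi>" "b \<in> gcar \<chi>" for a b
    using that by (auto simp: gcar_def smul_scar)
qed

lemma sprod_gmul:
  "i < j \<Longrightarrow> sprod (gmul \<chi>) x i j = (sprod (smul \<chi>) (\<lambda>n. fst (x n)) i j,
     \<exists>k\<in>{i..<j}. fst (snd (x k)), \<exists>k\<in>{i..<j}. snd (snd (x k)))"
proof (induction j)
  case (Suc j)
  obtain s d c where xj: "x j = (s, d, c)" by (cases "x j")
  show ?case
  proof (cases "i = j")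
    case True
    have "{j..<Suc j} = {j}" by auto
    then show ?thesis using xj True by simp
  next
    case False
    then have "i < j" using Suc.prems by simp
    moreover from this have "{i..<Suc j} = insert j {i..<j}" by auto
    ultimately show ?thesis using Suc.IH xj by auto
  qed
qed simp

lemma nat_interval_index:
  assumes "strict_mono (\<rho> :: nat \<Rightarrow> nat)" "\<rho> 0 \<le> k"
  obtains i where "\<rho> i \<le> k" "k < \<rho> (Suc i)"
proof -
  have "k < \<rho> (Suc k)" using strict_mono_imp_increasing[OF assms(1), of "Suc k"] by simp
  define i where "i = (LEAST i. k < \<rho> (Suc i))"
  have "k < \<rho> (Suc i)" unfolding i_def using \<open>k < \<rho> (Suc k)\<close> by (rule LeastI)
  moreover have "\<rho> i \<le> k"
  proof (cases i)
    case (Suc j)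
    then have "\<not> k < \<rho> (Suc j)" unfolding i_def using not_less_Least[of j "\<lambda>i. k < \<rho> (Suc i)"] by auto
    then show ?thesis by (simp add: Suc)
  qed (use assms in simp)
  ultimately show ?thesis using that by blast
qed

lemma factor_gmul:
  assumes "factor (gmul \<chi>) x \<rho> s e"
  shows "factor (smul \<chi>) (\<lambda>n. fst (x n)) \<rho> (fst s) (fst e)"
    "fst (snd e) \<longleftrightarrow> (\<forall>n. \<exists>k\<ge>n. fst (snd (x k)))" "snd (snd e) \<longleftrightarrow> (\<forall>n. \<exists>k\<ge>n. snd (snd (x k)))"
proof -
  have \<rho>: "strict_mono \<rho>" "0 < \<rho> 0" using assms by (auto simp: factor_def)
  have lt: "\<rho> i < \<rho> (Suc i)" for i using \<rho>(1) by (simp add: strict_mono_less)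
  have s: "s = (sprod (smul \<chi>) (\<lambda>n. fst (x n)) 0 (\<rho> 0), \<exists>k\<in>{0..<\<rho> 0}. fst (snd (x k)), \<exists>k\<in>{0..<\<rho> 0}. snd (snd (x k)))"
    using assms sprod_gmul[OF \<rho>(2), of \<chi> x] by (simp add: factor_def del: sprod.simps)
  have e: "e = (sprod (smul \<chi>) (\<lambda>n. fst (x n)) (\<rho> i) (\<rho> (Suc i)), \<exists>k\<in>{\<rho> i..<\<rho> (Suc i)}. fst (snd (x k)),
      \<exists>k\<in>{\<rho> i..<\<rho> (Suc i)}. snd (snd (x k)))" for i
    using assms sprod_gmul[OF lt[of i], of \<chi> x] by (simp add: factor_def del: sprod.simps)
  obtain s1 s2 s3 e1 e2 e3 where se: "s = (s1, s2, s3)" "e = (e1, e2, e3)" by (cases s; cases e)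
  have "smul \<chi> s1 e1 = s1" "smul \<chi> e1 e1 = e1" using assms se by (auto simp: factor_def)
  then show "factor (smul \<chi>) (\<lambda>n. fst (x n)) \<rho> (fst s) (fst e)"
    unfolding factor_def using \<rho> s e se by auto
  have inf: "b \<longleftrightarrow> (\<forall>n. \<exists>k\<ge>n. P k)" if b: "\<And>i. b = (\<exists>k\<in>{\<rho> i..<\<rho> (Suc i)}. P k)" for b P
  proof
    assume b': b
    show "\<forall>n. \<exists>k\<ge>n. P k"
    proof
      fix n
      obtain k where "k \<in> {\<rho> n..<\<rho> (Suc n)}" "P k" using b[of n] b' by blast
      moreover have "n \<le> \<rho> n" using strict_mono_imp_increasing[OF \<rho>(1)] .
      ultimately show "\<exists>k\<ge>n. P k" by (auto intro!: exI[of _ k])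
    qed
  next
    assume "\<forall>n. \<exists>k\<ge>n. P k"
    then obtain k where k: "\<rho> 0 \<le> k" "P k" by blast
    then obtain i where "\<rho> i \<le> k" "k < \<rho> (Suc i)" using nat_interval_index[OF \<rho>(1)] by blast
    then show b using b[of i] k by auto
  qed
  show "fst (snd e) \<longleftrightarrow> (\<forall>n. \<exists>k\<ge>n. fst (snd (x k)))"
    by (rule inf) (subst e, simp)
  show "snd (snd e) \<longleftrightarrow> (\<forall>n. \<exists>k\<ge>n. snd (snd (x k)))"
    by (rule inf) (subst e, simp)
qed

section \<open>Positions and values of the synthesis game\<close>

definition pos_step :: "nat \<times> bool \<Rightarrow> nat \<Rightarrow> nat \<times> bool \<Rightarrow> nat \<times> bool" where
  "pos_step v a bc = (a, snd bc)"

locale synth =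
  fixes Cin Cout :: "bool list list" and \<Psi> :: mso
  assumes cin: "is_coding Cin" and cout: "is_coding Cout" and spec: "spec_formula Cin Cout \<Psi>"
begin

text \<open>In a position \<open>v = (a', c')\<close>, the last input letter was \<open>a'\<close> and \<open>c'\<close> says that the output player asked
  for a checkpoint. The first flag of the value records that the checkpoint is passed, because the input
  does not change, and the second flag that the input changes.\<close>

definition gval :: "nat \<times> bool \<Rightarrow> nat \<Rightarrow> nat \<times> bool \<Rightarrow> nat \<times> bool \<times> bool" where
  "gval v a bc = (hval Cin Cout \<Psi> a (fst bc), snd v \<and> a = fst v, a \<noteq> fst v)"

abbreviation "insym \<equiv> {..<length Cin}"
abbreviation "outsym \<equiv> {..<length Cout}"

text \<open>The start pretends that the letter 0 came before and that no checkpoint was requested. A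
  spurious first change is harmless, because only recurring events count.\<close>

definition is_cert :: "bool \<Rightarrow> ((nat \<times> bool) \<times> 'z) set \<Rightarrow>
    (((nat \<times> bool) \<times> 'z) \<times> (nat \<times> bool \<times> bool) \<times> ((nat \<times> bool) \<times> 'z)) set \<Rightarrow> (nat \<times> bool) \<times> 'z \<Rightarrow> bool" where
  "is_cert pl Q R q0 \<longleftrightarrow> certificate (gmul (tr \<Psi>)) (gacc (tr \<Psi>)) insym (outsym \<times> UNIV)
     pos_step gval (0, False) pl Q R q0"

lemma ne: "Cin \<noteq> []" "Cout \<noteq> []"
  using cin cout by (auto simp: is_coding_def)

lemma block_signal:
  fixes \<tau> :: "nat \<Rightarrow> real"
  assumes \<tau>: "\<tau> 0 = 0" "strict_mono \<tau>" "\<not> bdd_above (range \<tau>)" and b: "\<And>n. b n \<in> S"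
  defines "f \<equiv> (\<lambda>t\<in>{0..}. b (LEAST n. t < \<tau> (Suc n)))"
  shows "f \<in> signals S" "\<And>n t. t \<in> {\<tau> n..<\<tau> (Suc n)} \<Longrightarrow> f t = b n"
proof -
  have pos: "0 \<le> \<tau> n" for n using strict_mono_leD[OF \<tau>(2), of 0 n] \<tau>(1) by simp
  show *: "f t = b n" if t: "t \<in> {\<tau> n..<\<tau> (Suc n)}" for n t
  proof -
    have "(LEAST i. t < \<tau> (Suc i)) = n"
    proof (rule Least_equality)
      show "t < \<tau> (Suc n)" using t by simp
      fix j assume "t < \<tau> (Suc j)"
      then have "\<tau> n < \<tau> (Suc j)" using t by simp
      then show "n \<le> j" using \<tau>(2) by (simp add: strict_mono_less)
    qed
    then show ?thesis using t pos[of n] by (simp add: f_def)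
  qed
  have "f \<in> {0..} \<rightarrow>\<^sub>E S" using b by (auto simp: f_def)
  moreover have "\<exists>a. \<forall>t\<in>{\<tau> i..<\<tau> (Suc i)}. f t = a" for i using * by blast
  ultimately show "f \<in> signals S" unfolding signals_def using \<tau>
    by (intro CollectI conjI exI[of _ \<tau>] allI) auto
qed

text \<open>Reading the letters at unit speed turns the word into two signals, and both
  factorisations decide \<open>\<Psi>\<close> for them. The flags express recurrence, which refers
  to the word only.\<close>

lemma saturated_gval:
  "fin_semigroup.saturated (gmul (tr \<Psi>)) {gval v a b |v a b. v \<in> insym \<times> UNIV \<and> a \<in> insym \<and> b \<in> outsym \<times> UNIV}
     (gacc (tr \<Psi>))"
  unfolding fin_semigroup.saturated_def[OF fin_semigroup_gmul]
proof (intro allI impI)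
  fix x \<rho> s e \<rho>' s' e'
  assume x: "range x \<subseteq> {gval v a b |v a b. v \<in> insym \<times> UNIV \<and> a \<in> insym \<and> b \<in> outsym \<times> UNIV}"
    and f: "factor (gmul (tr \<Psi>)) x \<rho> s e" "factor (gmul (tr \<Psi>)) x \<rho>' s' e'"
  have "\<exists>a b. fst (x n) = hval Cin Cout \<Psi> a b \<and> a < length Cin \<and> b < length Cout" for n
  proof -
    have "x n \<in> {gval v a b |v a b. v \<in> insym \<times> UNIV \<and> a \<in> insym \<and> b \<in> outsym \<times> UNIV}" using x by blast
    then obtain v a b where "x n = gval v a b" "a \<in> insym" "b \<in> outsym \<times> UNIV" by blast
    then show ?thesis by (intro exI[of _ a] exI[of _ "fst b"]) (auto simp: gval_def)
  qed
  then obtain a b where ab: "\<And>n. fst (x n) = hval Cin Cout \<Psi> (a n) (b n)"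
    "\<And>n. a n < length Cin" "\<And>n. b n < length Cout" by metis
  have \<tau>: "real 0 = 0" "strict_mono real" "\<not> bdd_above (range real)"
    by (auto simp: strict_mono_def bdd_above_def not_le) (meson reals_Archimedean2)
  define X where "X = (\<lambda>t\<in>{0..}. a (LEAST n. t < real (Suc n)))"
  define Y where "Y = (\<lambda>t\<in>{0..}. b (LEAST n. t < real (Suc n)))"
  have X: "X \<in> signals (alphabet Cin)" "\<And>n t. t \<in> {real n..<real (Suc n)} \<Longrightarrow> X t = a n"
    unfolding X_def using block_signal[OF \<tau>, of a "alphabet Cin"] ab(2) by (auto simp: alphabet_def)
  have Y: "Y \<in> signals (alphabet Cout)" "\<And>n t. t \<in> {real n..<real (Suc n)} \<Longrightarrow> Y t = b n"
    unfolding Y_def using block_signal[OF \<tau>, of b "alphabet Cout"] ab(3) by (auto simp: alphabet_def)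
  have fa: "factor (smul (tr \<Psi>)) (\<lambda>n. hval Cin Cout \<Psi> (a n) (b n)) \<rho> (fst s) (fst e)"
    "factor (smul (tr \<Psi>)) (\<lambda>n. hval Cin Cout \<Psi> (a n) (b n)) \<rho>' (fst s') (fst e')"
    using factor_gmul(1)[OF f(1)] factor_gmul(1)[OF f(2)] ab(1) by simp_all
  have "sacc (tr \<Psi>) (fst s) (fst e) \<longleftrightarrow> Rsig_models Cin Cout \<Psi> X Y"
    using Rsig_models_iff_sacc[OF spec X(1) Y(1) \<tau> _ fa(1)] X(2) Y(2) by blast
  moreover have "sacc (tr \<Psi>) (fst s') (fst e') \<longleftrightarrow> Rsig_models Cin Cout \<Psi> X Y"
    using Rsig_models_iff_sacc[OF spec X(1) Y(1) \<tau> _ fa(2)] X(2) Y(2) by blast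
  ultimately have eq: "sacc (tr \<Psi>) (fst s) (fst e) \<longleftrightarrow> sacc (tr \<Psi>) (fst s') (fst e')" by simp
  have "fst (snd e) = fst (snd e')" "snd (snd e) = snd (snd e')"
    using factor_gmul(2,3)[OF f(1)] factor_gmul(2,3)[OF f(2)] by simp_all
  then show "gacc (tr \<Psi>) s e = gacc (tr \<Psi>) s' e'"
    using eq by (cases s; cases e; cases s'; cases e') auto
qed

theorem is_cert_exists: "\<exists>pl Q R (q0 :: (nat \<times> bool) \<times> ((nat \<times> bool \<times> bool) list \<times> nat)). is_cert pl Q R q0"
  unfolding is_cert_def
proof (rule fin_semigroup.certificates_exist[OF fin_semigroup_gmul, where Vs = "insym \<times> UNIV" and
      H = "{gval v a b |v a b. v \<in> insym \<times> UNIV \<and> a \<in> insym \<and> b \<in> outsym \<times> UNIV}"])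
  show "fin_semigroup.saturated (gmul (tr \<Psi>)) {gval v a b |v a b. v \<in> insym \<times> UNIV \<and> a \<in> insym \<and> b \<in> outsym \<times> UNIV}
     (gacc (tr \<Psi>))" by (rule saturated_gval)
  show "{gval v a b |v a b. v \<in> insym \<times> UNIV \<and> a \<in> insym \<and> b \<in> outsym \<times> UNIV} \<subseteq> gcar (tr \<Psi>)"
    by (auto simp: gval_def gcar_def shom_scar)
qed (use ne in \<open>simp_all add: pos_step_def lessThan_empty_iff split_beta mem_Times_iff\<close>)

text \<open>The flags of round \<open>Suc k\<close> look back at the letter and the request of round
  \<open>k\<close>, and those of round 0 at the fictitious start. Recurrence is insensitive to this
  shift, so the conclusion can speak of consecutive rounds.\<close>

lemma is_cert_play:
  assumes cert: "is_cert pl Q R q0"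
    and q: "q 0 = q0" "\<And>n. q n \<in> Q" "\<And>n. fst (q (Suc n)) = (a n, c n)"
    and R: "\<And>n. (q n, gval (fst (q n)) (a n) (b n, c n), q (Suc n)) \<in> R"
  obtains \<rho> s e where "factor (smul (tr \<Psi>)) (\<lambda>n. hval Cin Cout \<Psi> (a n) (b n)) \<rho> s e"
    "\<forall>n. \<exists>k\<ge>n. c k \<and> a (Suc k) = a k \<Longrightarrow> sacc (tr \<Psi>) s e = pl"
    "\<not> (\<forall>n. \<exists>k\<ge>n. c k \<and> a (Suc k) = a k) \<Longrightarrow> (\<forall>n. \<exists>k\<ge>n. a (Suc k) \<noteq> a k) = pl"
proof -
  interpret fin_semigroup "gmul (tr \<Psi>)" "gcar (tr \<Psi>)" by (rule fin_semigroup_gmul)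
  let ?x = "\<lambda>n. gval (fst (q n)) (a n) (b n, c n)"
  have "range ?x \<subseteq> gcar (tr \<Psi>)" by (auto simp: gval_def gcar_def shom_scar)
  then obtain \<rho> s e where f: "factor (gmul (tr \<Psi>)) ?x \<rho> s e" and acc: "gacc (tr \<Psi>) s e = pl"
    using certificate_play[OF cert[unfolded is_cert_def] q(1,2) R] by blast
  have shift: "(\<forall>n. \<exists>k\<ge>n. P k) \<longleftrightarrow> (\<forall>n. \<exists>k\<ge>n. P (Suc k))" for P :: "nat \<Rightarrow> bool"
    by (metis Suc_le_D Suc_le_mono le_Suc_eq)
  have d: "fst (snd e) \<longleftrightarrow> (\<forall>n. \<exists>k\<ge>n. c k \<and> a (Suc k) = a k)"
    unfolding factor_gmul(2)[OF f] by (subst shift) (simp add: gval_def q(3))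
  have c: "snd (snd e) \<longleftrightarrow> (\<forall>n. \<exists>k\<ge>n. a (Suc k) \<noteq> a k)"
    unfolding factor_gmul(3)[OF f] by (subst shift) (simp add: gval_def q(3))
  have "factor (smul (tr \<Psi>)) (\<lambda>n. hval Cin Cout \<Psi> (a n) (b n)) \<rho> (fst s) (fst e)"
    using factor_gmul(1)[OF f] by (simp add: gval_def)
  moreover have "(if fst (snd e) then sacc (tr \<Psi>) (fst s) (fst e) else snd (snd e)) = pl"
    using acc by (cases s; cases e) (auto split: if_splits)
  ultimately show ?thesis using that[of \<rho> "fst s" "fst e"] d c by argo
qed

end

section \<open>Operators and certificates\<close>

lemma unbounded_jumps:
  fixes f :: "nat \<Rightarrow> real"
  assumes mono: "\<And>n. f n \<le> f (Suc n)" and jump: "\<forall>n. \<exists>k\<ge>n. f k + 1 \<le> f (Suc k)"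
  shows "\<exists>n. M < f n"
proof -
  have le: "f m \<le> f n" if "m \<le> n" for m n using lift_Suc_mono_le[of f] mono that by blast
  have "\<exists>n. f 0 + real j \<le> f n" for j
  proof (induction j)
    case (Suc j)
    then obtain n where n: "f 0 + real j \<le> f n" by blast
    obtain k where "n \<le> k" "f k + 1 \<le> f (Suc k)" using jump by blast
    then show ?case using n le[of n k] by (intro exI[of _ "Suc k"]) simp
  qed auto
  moreover obtain j :: nat where "M - f 0 < real j" using reals_Archimedean2 by blast
  ultimately show ?thesis by (metis diff_less_eq add.commute less_le_trans)
qed

lemma eventually_constant:
  fixes f :: "nat \<Rightarrow> 'a"
  assumes "\<And>n. N \<le> n \<Longrightarrow> f (Suc n) = f n" "N \<le> n"
  shows "f n = f N"
  using assms(2) by (induction rule: dec_induct) (auto simp: assms(1))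

context synth
begin

text \<open>Ticks are placed halfway to the deadline \<open>\<beta> + 2\<close>, where \<open>\<beta>\<close> is the time of the last passed checkpoint,
  so that passed checkpoints are at least one time unit apart, and an input that prevents all
  further checkpoints changes infinitely often before the deadline.\<close>

theorem cert_imp_C_operator:
  assumes cert: "is_cert True Q R q0"
  shows "\<exists>F. C_operator (alphabet Cin) (alphabet Cout) F \<and>
    (\<forall>X\<in>signals (alphabet Cin). Rsig_models Cin Cout \<Psi> X (F X))"
proof -
  note c = cert[unfolded is_cert_def certificate_def]
  have q0: "q0 \<in> Q" using c by blast
  have "\<exists>b c q'. b < length Cout \<and> q' \<in> Q \<and> fst q' = (a, c) \<and> (q, gval (fst q) a (b, c), q') \<in> R"
    if "q \<in> Q" "a < length Cin" for q a
  proof -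
    have "a \<in> insym" using that by simp
    from bspec[OF bspec[OF c[THEN conjunct2, THEN conjunct2, THEN conjunct2, THEN conjunct2, THEN conjunct2,
            THEN conjunct1, unfolded if_True] that(1)] this]
    obtain bc q' where "bc \<in> outsym \<times> UNIV" "q' \<in> Q" "fst q' = pos_step (fst q) a bc" "(q, gval (fst q) a bc, q') \<in> R"
      by (elim bexE conjE)
    then show ?thesis by (intro exI[of _ "fst bc"] exI[of _ "snd bc"] exI[of _ q']) (auto simp: pos_step_def)
  qed
  then obtain fb fc fq where pick: "\<And>q a. q \<in> Q \<Longrightarrow> a < length Cin \<Longrightarrow> fb q a < length Cout \<and> fq q a \<in> Q \<and>
      fst (fq q a) = (a, fc q a) \<and> (q, gval (fst q) a (fb q a, fc q a), fq q a) \<in> R" by metis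
  \<comment> \<open>The state holds the present tick, the time of the last passed checkpoint and the
    memory. An input change before the planned tick becomes the tick.\<close>
  define nst where "nst X = (\<lambda>(t, \<beta>, q). let t' = nxt X t ((t + \<beta> + 2) / 2) in
      (t', if fc q (X t) \<and> X t' = X t then t' else \<beta>, fq q (X t)))" for X :: "real \<Rightarrow> nat"
  define st where "st X n = (nst X ^^ n) (0 :: real, 0 :: real, q0)" for X n
  define \<tau> where "\<tau> X n = fst (st X n)" for X n
  define \<beta> where "\<beta> X n = fst (snd (st X n))" for X n
  define q where "q X n = snd (snd (st X n))" for X n
  define p where "p X n = (\<tau> X n + \<beta> X n + 2) / 2" for X n
  have st: "st X n = (\<tau> X n, \<beta> X n, q X n)" for X n by (simp add: \<tau>_def \<beta>_def q_def)
  have S0: "\<tau> X 0 = 0" "\<beta> X 0 = 0" "q X 0 = q0" for X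
    by (simp_all add: \<tau>_def \<beta>_def q_def st_def)
  have stS: "st X (Suc n) = nst X (st X n)" for X n by (simp add: st_def)
  have SS: "\<tau> X (Suc n) = nxt X (\<tau> X n) (p X n)"
    "\<beta> X (Suc n) = (if fc (q X n) (X (\<tau> X n)) \<and> X (\<tau> X (Suc n)) = X (\<tau> X n) then \<tau> X (Suc n) else \<beta> X n)"
    "q X (Suc n) = fq (q X n) (X (\<tau> X n))" for X n
    using stS[of X n] unfolding st nst_def p_def by (simp_all add: Let_def)
  define F where "F X = (\<lambda>t\<in>{0..}. fb (q X (LEAST n. t < \<tau> X (Suc n))) (X (\<tau> X (LEAST n. t < \<tau> X (Suc n)))))" for X
  have inv: "0 \<le> \<beta> X n \<and> \<beta> X n \<le> \<tau> X n \<and> \<tau> X n < \<beta> X n + 2 \<and> q X n \<in> Q"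
    and less: "\<tau> X n < \<tau> X (Suc n)" if X: "X \<in> signals (alphabet Cin)" for X n
  proof -
    have lX: "lconst X" and Xa: "\<And>t. 0 \<le> t \<Longrightarrow> X t < length Cin"
      using X by (auto simp: signals_iff alphabet_def PiE_def Pi_def)
    have step: "\<tau> X n < \<tau> X (Suc n) \<and> \<tau> X (Suc n) \<le> p X n \<and> p X n < \<beta> X n + 2"
      if "0 \<le> \<beta> X n \<and> \<beta> X n \<le> \<tau> X n \<and> \<tau> X n < \<beta> X n + 2" for n
    proof -
      have "\<tau> X n < p X n" "p X n < \<beta> X n + 2" using that by (simp_all add: p_def)
      then show ?thesis using nxt_greater[OF lX, of "\<tau> X n" "p X n"] nxt_le[of "\<tau> X n" "p X n" X] that
        by (simp add: SS(1))
    qed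
    show inv: "0 \<le> \<beta> X n \<and> \<beta> X n \<le> \<tau> X n \<and> \<tau> X n < \<beta> X n + 2 \<and> q X n \<in> Q" for n
    proof (induction n)
      case (Suc n)
      then have "q X (Suc n) \<in> Q" using pick[of "q X n" "X (\<tau> X n)"] Xa[of "\<tau> X n"] by (simp add: SS(3))
      then show ?case using Suc step[of n] unfolding SS(2) by auto
    qed (use q0 in \<open>simp add: S0\<close>)
    show "\<tau> X n < \<tau> X (Suc n)" using step inv by blast
  qed
  have mono: "strict_mono (\<tau> X)" if "X \<in> signals (alphabet Cin)" for X
    unfolding strict_mono_Suc_iff using less[OF that] by blast
  have main: "\<not> bdd_above (range (\<tau> X)) \<and> F X \<in> signals (alphabet Cout) \<and> Rsig_models Cin Cout \<Psi> X (F X)"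
    if X: "X \<in> signals (alphabet Cin)" for X
  proof -
    have lX: "lconst X" and Xa: "\<And>t. 0 \<le> t \<Longrightarrow> X t < length Cin"
      using X by (auto simp: signals_iff alphabet_def PiE_def Pi_def)
    have pos: "0 \<le> \<tau> X n" for n using inv[OF X, of n] by linarith
    define a where "a n = X (\<tau> X n)" for n
    define b where "b n = fb (q X n) (a n)" for n
    define cc where "cc n = fc (q X n) (a n)" for n
    have pk: "b n < length Cout \<and> q X (Suc n) \<in> Q \<and> fst (q X (Suc n)) = (a n, cc n) \<and>
        (q X n, gval (fst (q X n)) (a n) (b n, cc n), q X (Suc n)) \<in> R" for n
      using pick[of "q X n" "a n"] inv[OF X, of n] Xa[OF pos[of n]] by (simp add: a_def b_def cc_def SS(3))
    have ch: "X t = a n" if "t \<in> {\<tau> X n..<\<tau> X (Suc n)}" for n t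
      using nxt_const[of "\<tau> X n" "p X n" t X] that inv[OF X, of n] by (simp add: SS(1) a_def p_def)
    obtain \<rho> s e where f: "factor (smul (tr \<Psi>)) (\<lambda>n. hval Cin Cout \<Psi> (a n) (b n)) \<rho> s e"
      and w1: "\<forall>n. \<exists>k\<ge>n. cc k \<and> a (Suc k) = a k \<Longrightarrow> sacc (tr \<Psi>) s e = True"
      and w2: "\<not> (\<forall>n. \<exists>k\<ge>n. cc k \<and> a (Suc k) = a k) \<Longrightarrow> (\<forall>n. \<exists>k\<ge>n. a (Suc k) \<noteq> a k) = True"
      using is_cert_play[OF cert, of "q X" a cc b] S0(3) pk inv[OF X] by blast
    have \<beta>S: "\<beta> X (Suc n) = (if cc n \<and> a (Suc n) = a n then \<tau> X (Suc n) else \<beta> X n)" for n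
      by (simp add: SS(2) cc_def a_def)
    \<comment> \<open>Without an input change the tick is the planned midpoint, which is at least
      \<open>\<beta> + 1\<close> because \<open>\<beta> \<le> \<tau>\<close>.\<close>
    have jump: "\<beta> X n + 1 \<le> \<beta> X (Suc n)" if "cc n \<and> a (Suc n) = a n" for n
    proof -
      have lt: "\<tau> X n < p X n" using inv[OF X, of n] by (simp add: p_def)
      have "\<not> \<tau> X (Suc n) < p X n"
        using nxt_change[OF lX pos[of n] lt] that by (auto simp: SS(1) a_def)
      then have "p X n \<le> \<beta> X (Suc n)" using that \<beta>S[of n] by simp
      then show ?thesis using inv[OF X, of n] by (simp add: p_def)
    qed
    have \<beta>mono: "\<beta> X n \<le> \<beta> X (Suc n)" for n
      using jump[of n] \<beta>S[of n] by (cases "cc n \<and> a (Suc n) = a n") auto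
    have \<beta>unb: "\<exists>n. M < \<beta> X n" if "\<forall>n. \<exists>k\<ge>n. cc k \<and> a (Suc k) = a k" for M
      using unbounded_jumps[of "\<beta> X" M] \<beta>mono jump that by blast
    \<comment> \<open>If the ticks accumulated, the sampled input would eventually be constant. Then
      the play cannot be won by changes, so checkpoints recur, and each of them advances
      \<open>\<beta>\<close> by at least one.\<close>
    have unb: "\<not> bdd_above (range (\<tau> X))"
    proof
      assume bdd: "bdd_above (range (\<tau> X))"
      then obtain M where M: "\<And>n. \<tau> X n \<le> M" by (auto simp: bdd_above_def)
      obtain N where N: "\<And>i. N \<le> i \<Longrightarrow> X (\<tau> X i) = X (\<tau> X N)"
        using lconst_no_zeno[OF lX mono[OF X] pos bdd] by blast
      have "a (Suc k) = a k" if "N \<le> k" for k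
        unfolding a_def using N[OF that] N[OF le_SucI[OF that]] by (rule trans[OF _ sym, rotated])
      then have "\<forall>n. \<exists>k\<ge>n. cc k \<and> a (Suc k) = a k" using w2 by blast
      then obtain n where "M < \<beta> X n" using \<beta>unb by blast
      then show False using M[of n] inv[OF X, of n] by linarith
    qed
    \<comment> \<open>Ticks stay below \<open>\<beta> + 2\<close>, so diverging ticks require
      recurring checkpoints.\<close>
    have "\<forall>n. \<exists>k\<ge>n. cc k \<and> a (Suc k) = a k"
    proof (rule ccontr)
      assume "\<not> ?thesis"
      then obtain N where N: "\<And>k. N \<le> k \<Longrightarrow> \<not> (cc k \<and> a (Suc k) = a k)" by blast
      have const: "\<beta> X k = \<beta> X N" if "N \<le> k" for k
        by (rule eventually_constant[OF _ that]) (use \<beta>S N in auto)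
      have "\<tau> X k \<le> \<beta> X N + 2" for k
      proof (cases "N \<le> k")
        case True
        then show ?thesis using inv[OF X, of k] const[of k] by simp
      next
        case False
        then have "\<tau> X k \<le> \<tau> X N" using mono[OF X] by (simp add: strict_mono_less_eq)
        then show ?thesis using inv[OF X, of N] by simp
      qed
      then show False using unb by (auto simp: bdd_above_def)
    qed
    then have acc: "sacc (tr \<Psi>) s e" using w1 by simp
    have Fb: "F X = (\<lambda>t\<in>{0..}. b (LEAST n. t < \<tau> X (Suc n)))" by (simp add: F_def b_def a_def)
    have FX: "F X \<in> signals (alphabet Cout)" "\<And>n t. t \<in> {\<tau> X n..<\<tau> X (Suc n)} \<Longrightarrow> F X t = b n"
      unfolding Fb using block_signal[OF S0(1) mono[OF X] unb, of b "alphabet Cout"] pk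
      by (auto simp: alphabet_def)
    have "Rsig_models Cin Cout \<Psi> X (F X) \<longleftrightarrow> sacc (tr \<Psi>) s e"
      by (rule Rsig_models_iff_sacc[OF spec X FX(1) S0(1) mono[OF X] unb _ f]) (use ch FX(2) in blast)
    then show ?thesis using acc unb FX(1) by simp
  qed
  have causal: "F X1 t = F X2 t"
    if t: "0 \<le> t" and X1: "X1 \<in> signals (alphabet Cin)" and X2: "X2 \<in> signals (alphabet Cin)"
      and agree: "\<And>s. s \<in> {0..t} \<Longrightarrow> X1 s = X2 s" for t X1 X2
  proof -
    have lX: "lconst X1" "lconst X2" using X1 X2 by (auto simp: signals_iff)
    obtain \<epsilon>1 where \<epsilon>1: "\<epsilon>1 > 0" "\<And>s. s \<in> {t..<t+\<epsilon>1} \<Longrightarrow> X1 s = X1 t" using lconst_right[OF lX(1) t] by blast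
    obtain \<epsilon>2 where \<epsilon>2: "\<epsilon>2 > 0" "\<And>s. s \<in> {t..<t+\<epsilon>2} \<Longrightarrow> X2 s = X2 t" using lconst_right[OF lX(2) t] by blast
    \<comment> \<open>Right continuity extends the agreement on \<open>{0..t}\<close> to a longer
      half-open interval, so that a tick at \<open>t\<close> itself lies strictly before the horizon
      of \<open>nxt_cong\<close>.\<close>
    define r where "r = t + min \<epsilon>1 \<epsilon>2"
    have "t < r" using \<epsilon>1(1) \<epsilon>2(1) by (simp add: r_def)
    have eq: "X1 s = X2 s" if "s \<in> {0..<r}" for s
    proof (cases "s \<le> t")
      case False
      then have "X1 s = X1 t" "X2 s = X2 t" using that \<epsilon>1(2)[of s] \<epsilon>2(2)[of s] by (auto simp: r_def)
      then show ?thesis using agree[of t] t by simp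
    qed (use agree that in auto)
    have same: "st X n = st Y n"
      if "\<tau> X n < r" and X: "X \<in> signals (alphabet Cin)" and eq: "\<And>s. s \<in> {0..<r} \<Longrightarrow> X s = Y s" for X Y n
      using that(1)
    proof (induction n)
      case 0
      show ?case by (simp add: st_def)
    next
      case (Suc n)
      have lt: "\<tau> X n < r" using less[OF X, of n] Suc.prems by simp
      then have IH: "st X n = st Y n" using Suc.IH by simp
      then have e: "\<tau> Y n = \<tau> X n" "\<beta> Y n = \<beta> X n" "q Y n = q X n" "p Y n = p X n"
        by (simp_all add: \<tau>_def \<beta>_def q_def p_def)
      have pos: "0 \<le> \<tau> X n" "0 \<le> \<tau> X (Suc n)" and lp: "\<tau> X n < p X n"
        using inv[OF X, of n] inv[OF X, of "Suc n"] by (auto simp: p_def)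
      have "nxt X (\<tau> X n) (p X n) = nxt Y (\<tau> X n) (p X n)"
        by (rule nxt_cong(2)[OF _ lt lp]) (use eq pos Suc.prems in \<open>auto simp: SS(1)\<close>)
      then have \<tau>: "\<tau> Y (Suc n) = \<tau> X (Suc n)" by (simp add: SS(1) e)
      have X: "X (\<tau> X n) = Y (\<tau> X n)" "X (\<tau> X (Suc n)) = Y (\<tau> X (Suc n))"
        using eq pos lt Suc.prems by auto
      have "\<beta> Y (Suc n) = \<beta> X (Suc n)" "q Y (Suc n) = q X (Suc n)"
        unfolding SS(2,3) \<tau> e using X by simp_all
      then show ?case using \<tau> st by simp
    qed
    have "\<tau> X1 0 \<le> t" using S0(1) t by simp
    from interval_index[OF main[OF X1, THEN conjunct1] this]
    obtain n where n: "\<tau> X1 n \<le> t" "t < \<tau> X1 (Suc n)" by blast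
    have s: "st X1 n = st X2 n" using same[of X1 n X2] n \<open>t < r\<close> X1 eq by force
    then have e: "\<tau> X2 n = \<tau> X1 n" "q X2 n = q X1 n" by (simp_all add: \<tau>_def q_def)
    have n2: "t < \<tau> X2 (Suc n)"
    proof (rule ccontr)
      assume *: "\<not> ?thesis"
      then have "st X2 (Suc n) = st X1 (Suc n)" using same[of X2 "Suc n" X1] \<open>t < r\<close> X2 eq by force
      then show False using * n by (simp add: \<tau>_def)
    qed
    have "(LEAST i. t < \<tau> X (Suc i)) = n"
      if "X \<in> signals (alphabet Cin)" "\<tau> X n \<le> t" "t < \<tau> X (Suc n)" for X
    proof (rule Least_equality)
      show "t < \<tau> X (Suc n)" by (rule that(3))
      fix i assume "t < \<tau> X (Suc i)"
      then have "\<tau> X n < \<tau> X (Suc i)" using that by simp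
      then show "n \<le> i" using mono[OF that(1)] by (simp add: strict_mono_less)
    qed
    then have Fn: "F X t = fb (q X n) (X (\<tau> X n))"
      if "X \<in> signals (alphabet Cin)" "\<tau> X n \<le> t" "t < \<tau> X (Suc n)" for X
      unfolding F_def using t that by simp
    have "0 \<le> \<tau> X1 n" using inv[OF X1, of n] by linarith
    then have "X1 (\<tau> X1 n) = X2 (\<tau> X1 n)" using agree n by simp
    then show ?thesis using Fn[OF X1 n] Fn[OF X2 _ n2] n(1) unfolding e by simp
  qed
  have "C_operator (alphabet Cin) (alphabet Cout) F"
    unfolding C_operator_def
  proof (intro conjI allI impI ballI Pi_I)
    show "F X \<in> signals (alphabet Cout)" if "X \<in> signals (alphabet Cin)" for X
      by (rule main[OF that, THEN conjunct2, THEN conjunct1])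
    show "F X1 t = F X2 t" if "0 \<le> t" "X1 \<in> signals (alphabet Cin)" "X2 \<in> signals (alphabet Cin)"
      "\<forall>s\<in>{0..t}. X1 s = X2 s" for t X1 X2
      by (rule causal[OF that(1-3)]) (use that(4) in blast)
  qed
  then show ?thesis
    by (intro exI[of _ F] conjI ballI) (assumption, rule main[THEN conjunct2, THEN conjunct2])
qed

end

section \<open>An operator against a certificate of the input player\<close>

lemma cut_signal:
  assumes f: "f \<in> signals S" and c: "c \<in> S" and m: "0 \<le> m"
  shows "(\<lambda>s. if s < m then f s else c) \<in> signals S"
proof -
  have lf: "lconst f" and fE: "f \<in> {0..} \<rightarrow>\<^sub>E S" using f by (auto simp: signals_iff)
  have "lconst (\<lambda>s. if s < m then f s else c)" unfolding lconst_def
  proof (intro conjI allI impI)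
    fix t :: real assume t: "0 \<le> t"
    show "\<exists>\<epsilon>>0. \<exists>a. \<forall>s\<in>{t..<t+\<epsilon>}. (if s < m then f s else c) = a"
    proof (cases "t < m")
      case True
      obtain \<epsilon> a where "\<epsilon> > 0" "\<And>s. s \<in> {t..<t+\<epsilon>} \<Longrightarrow> f s = a" using lconst_right[OF lf t] by blast
      then show ?thesis using True by (intro exI[of _ "min \<epsilon> (m - t)"] conjI exI[of _ a]) auto
    qed (intro exI[of _ 1] conjI exI[of _ c], auto)
  next
    fix t :: real assume t: "0 < t"
    show "\<exists>\<epsilon>>0. \<exists>a. \<forall>s\<in>{t-\<epsilon>..<t}. 0 \<le> s \<longrightarrow> (if s < m then f s else c) = a"
    proof (cases "t \<le> m")
      case True
      obtain \<epsilon> a where "\<epsilon> > 0" "\<And>s. s \<in> {t-\<epsilon>..<t} \<Longrightarrow> 0 \<le> s \<Longrightarrow> f s = a" using lconst_left[OF lf t] by blast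
      then show ?thesis using True by (intro exI[of _ \<epsilon>] conjI exI[of _ a]) auto
    qed (intro exI[of _ "t - m"] conjI exI[of _ c], auto)
  qed
  moreover have "(\<lambda>s. if s < m then f s else c) \<in> {0..} \<rightarrow>\<^sub>E S"
    using fE c m by (auto simp: PiE_def Pi_def extensional_def)
  ultimately show ?thesis by (simp add: signals_iff)
qed

context synth
begin

text \<open>The operator is played against the certificate of the input player. The input can change only
  at moments chosen here, namely no later than the next spontaneous change of the output and strictly before
  the deadline \<open>\<beta> + 1\<close>.\<close>

theorem cert_imp_no_C_operator:
  assumes cert: "is_cert False Q R q0"
    and F: "C_operator (alphabet Cin) (alphabet Cout) F"
    and models: "\<forall>X\<in>signals (alphabet Cin). Rsig_models Cin Cout \<Psi> X (F X)"
  shows False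
proof -
  note c = cert[unfolded is_cert_def certificate_def]
  have q0: "q0 \<in> Q" using c by blast
  have "\<exists>a. a < length Cin \<and> (\<forall>b c. b < length Cout \<longrightarrow> (\<exists>q'. q' \<in> Q \<and> fst q' = (a, c) \<and> (q, gval (fst q) a (b, c), q') \<in> R))"
    if "q \<in> Q" for q
  proof -
    from bspec[OF c[THEN conjunct2, THEN conjunct2, THEN conjunct2, THEN conjunct2, THEN conjunct2,
            THEN conjunct1, unfolded if_False] that]
    obtain a where a: "a \<in> insym"
      "\<forall>b\<in>outsym \<times> UNIV. \<exists>q'\<in>Q. fst q' = pos_step (fst q) a b \<and> (q, gval (fst q) a b, q') \<in> R" by (elim bexE)
    have "\<exists>q'. q' \<in> Q \<and> fst q' = (a, c) \<and> (q, gval (fst q) a (b, c), q') \<in> R" if "b < length Cout" for b c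
    proof -
      have "(b, c) \<in> outsym \<times> UNIV" using that by simp
      from bspec[OF a(2) this] show ?thesis by (auto simp: pos_step_def)
    qed
    then show ?thesis using a(1) by blast
  qed
  then obtain fa fq where pick: "\<And>q. q \<in> Q \<Longrightarrow> fa q < length Cin"
    "\<And>q b c. q \<in> Q \<Longrightarrow> b < length Cout \<Longrightarrow> fq q b c \<in> Q \<and> fst (fq q b c) = (fa q, c) \<and>
      (q, gval (fst q) (fa q) (b, c), fq q b c) \<in> R" by metis
  have FS: "F X \<in> signals (alphabet Cout)" if "X \<in> signals (alphabet Cin)" for X
    using F that by (auto simp: C_operator_def)
  have causal: "F X1 t = F X2 t" if "0 \<le> t" "X1 \<in> signals (alphabet Cin)" "X2 \<in> signals (alphabet Cin)"
    "\<And>s. s \<in> {0..t} \<Longrightarrow> X1 s = X2 s" for t X1 X2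
    using F that unfolding C_operator_def by blast
  define np where "np t \<beta> Y = nxt (F Y) t (\<beta> + 1)" for t \<beta> Y
  \<comment> \<open>The request is read off the operator: holding the output up to the deadline
    \<open>\<beta> + 1\<close> counts as asking for a checkpoint.\<close>
  define nq where "nq t \<beta> q Y = fq q (F Y t) (np t \<beta> Y = \<beta> + 1)" for t \<beta> q Y
  \<comment> \<open>A change of the letter at \<open>np\<close> could fall on the deadline itself;
    the midpoint lies strictly before it.\<close>
  define nt where "nt t \<beta> q Y = (if fa (nq t \<beta> q Y) = fa q then np t \<beta> Y else (t + np t \<beta> Y) / 2)" for t \<beta> q Y
  define nst where "nst = (\<lambda>(t, \<beta>, q, Y). (nt t \<beta> q Y,
      if np t \<beta> Y = \<beta> + 1 \<and> fa (nq t \<beta> q Y) = fa q then nt t \<beta> q Y else \<beta>,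
      nq t \<beta> q Y, \<lambda>s. if s < nt t \<beta> q Y then Y s else fa (nq t \<beta> q Y)))"
  \<comment> \<open>The last component is the input under the assumption that the current letter
    lasts forever. \<open>F\<close> needs a total signal, and causality makes the assumption
    harmless up to the next tick.\<close>
  define st where "st n = (nst ^^ n) (0, 0, q0, \<lambda>s\<in>{0..}. fa q0)" for n
  define \<tau> where "\<tau> n = fst (st n)" for n
  define \<beta> where "\<beta> n = fst (snd (st n))" for n
  define q where "q n = fst (snd (snd (st n)))" for n
  define Y where "Y n = snd (snd (snd (st n)))" for n
  define a where "a n = fa (q n)" for n
  define b where "b n = F (Y n) (\<tau> n)" for n
  define p where "p n = np (\<tau> n) (\<beta> n) (Y n)" for n
  define cc where "cc n \<longleftrightarrow> p n = \<beta> n + 1" for n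
  have S0: "\<tau> 0 = 0" "\<beta> 0 = 0" "q 0 = q0" "Y 0 = (\<lambda>s\<in>{0..}. fa q0)"
    by (simp_all add: \<tau>_def \<beta>_def q_def Y_def st_def)
  have st: "st n = (\<tau> n, \<beta> n, q n, Y n)" for n by (simp add: \<tau>_def \<beta>_def q_def Y_def)
  have stS: "st (Suc n) = nst (st n)" for n by (simp add: st_def)
  have qS: "q (Suc n) = fq (q n) (b n) (cc n)" for n
    using stS[of n] unfolding st nst_def by (simp add: nq_def b_def cc_def p_def)
  have \<tau>S: "\<tau> (Suc n) = (if a (Suc n) = a n then p n else (\<tau> n + p n) / 2)" for n
    using stS[of n] unfolding st nst_def a_def p_def by (simp add: nt_def)
  have \<beta>S: "\<beta> (Suc n) = (if cc n \<and> a (Suc n) = a n then \<tau> (Suc n) else \<beta> n)" for n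
    using stS[of n] unfolding st nst_def a_def p_def cc_def by simp
  have YS: "Y (Suc n) = (\<lambda>s. if s < \<tau> (Suc n) then Y n s else a (Suc n))" for n
  proof -
    have "\<tau> (Suc n) = nt (\<tau> n) (\<beta> n) (q n) (Y n)" "q (Suc n) = nq (\<tau> n) (\<beta> n) (q n) (Y n)"
      "Y (Suc n) = (\<lambda>s. if s < nt (\<tau> n) (\<beta> n) (q n) (Y n) then Y n s else fa (nq (\<tau> n) (\<beta> n) (q n) (Y n)))"
      using stS[of n] unfolding st nst_def by simp_all
    then show ?thesis by (simp only: a_def)
  qed
  have inv: "Y n \<in> signals (alphabet Cin) \<and> (\<forall>s\<ge>\<tau> n. Y n s = a n) \<and> 0 \<le> \<beta> n \<and> \<beta> n \<le> \<tau> n \<and> \<tau> n < \<beta> n + 1 \<and> q n \<in> Q"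
    and step: "\<tau> n < p n" "p n \<le> \<beta> n + 1" "b n < length Cout" "\<tau> n < \<tau> (Suc n)" "\<tau> (Suc n) \<le> p n" for n
  proof -
    have step: "\<tau> n < p n \<and> p n \<le> \<beta> n + 1 \<and> b n < length Cout \<and> \<tau> n < \<tau> (Suc n) \<and> \<tau> (Suc n) \<le> p n"
      if i: "Y n \<in> signals (alphabet Cin)" "0 \<le> \<beta> n" "\<beta> n \<le> \<tau> n" "\<tau> n < \<beta> n + 1" for n
    proof -
      have "F (Y n) \<in> signals (alphabet Cout)" using FS i by blast
      then have l: "lconst (F (Y n))" and r: "\<And>t. 0 \<le> t \<Longrightarrow> F (Y n) t < length Cout"
        by (auto simp: signals_iff alphabet_def PiE_def Pi_def)
      have "0 \<le> \<tau> n" using i by simp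
      then have "\<tau> n < p n" "p n \<le> \<beta> n + 1" "b n < length Cout"
        using nxt_greater[OF l, of "\<tau> n" "\<beta> n + 1"] nxt_le[of "\<tau> n" "\<beta> n + 1" "F (Y n)"] i r
        by (simp_all add: p_def np_def b_def)
      then show ?thesis by (simp add: \<tau>S)
    qed
    show inv: "Y n \<in> signals (alphabet Cin) \<and> (\<forall>s\<ge>\<tau> n. Y n s = a n) \<and> 0 \<le> \<beta> n \<and> \<beta> n \<le> \<tau> n \<and> \<tau> n < \<beta> n + 1 \<and> q n \<in> Q" for n
    proof (induction n)
      case 0
      have "lconst (\<lambda>s\<in>{0..}. fa q0)" by (rule lconst_cong[OF lconst_const[of "fa q0"]]) simp
      then have Y0: "(\<lambda>s\<in>{0..}. fa q0) \<in> signals (alphabet Cin)"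
        using pick(1)[OF q0] by (simp add: signals_iff alphabet_def)
      show ?case unfolding S0 a_def by (intro conjI, rule Y0) (simp_all add: q0)
    next
      case (Suc n)
      then have s: "\<tau> n < p n" "p n \<le> \<beta> n + 1" "b n < length Cout" "\<tau> n < \<tau> (Suc n)" "\<tau> (Suc n) \<le> p n"
        using step[of n] by blast+
      have qn: "q (Suc n) \<in> Q" using pick(2)[of "q n" "b n" "cc n"] Suc s by (simp add: qS)
      have "a (Suc n) \<in> alphabet Cin" using pick(1)[OF qn] by (simp add: a_def alphabet_def)
      moreover have "0 \<le> \<tau> (Suc n)" using Suc s by linarith
      ultimately have "Y (Suc n) \<in> signals (alphabet Cin)" unfolding YS using Suc by (intro cut_signal) auto
      moreover have "\<forall>s\<ge>\<tau> (Suc n). Y (Suc n) s = a (Suc n)" by (simp add: YS)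
      moreover have "\<tau> (Suc n) < \<beta> n + 1 \<or> cc n \<and> a (Suc n) = a n"
        using s by (auto simp: \<tau>S cc_def)
      ultimately show ?case using qn Suc s unfolding \<beta>S by auto
    qed
    show "\<tau> n < p n" "p n \<le> \<beta> n + 1" "b n < length Cout" "\<tau> n < \<tau> (Suc n)" "\<tau> (Suc n) \<le> p n"
      using step[of n] inv[of n] by blast+
  qed
  have pos: "0 \<le> \<tau> n" for n using inv[of n] by linarith
  have mono: "strict_mono \<tau>" unfolding strict_mono_Suc_iff using step(4) by blast
  have nxt_c: "F (Y n) t = b n" if "t \<in> {\<tau> n..<\<tau> (Suc n)}" for n t
  proof -
    have lt: "\<tau> n < \<beta> n + 1" using inv[of n] by blast
    have "t \<in> {\<tau> n..<nxt (F (Y n)) (\<tau> n) (\<beta> n + 1)}" using that step(5)[of n] by (auto simp: p_def np_def)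
    from nxt_const[OF lt this] show ?thesis by (simp add: b_def)
  qed
  have Ychain: "Y (n + k) s = Y n s" if "s < \<tau> (Suc n)" for n k s
  proof (induction k)
    case (Suc k)
    have "\<tau> (Suc n) \<le> \<tau> (Suc (n + k))" using mono by (simp add: strict_mono_less_eq)
    then show ?case using Suc that by (simp add: YS)
  qed simp
  have pk: "fst (q (Suc n)) = (a n, cc n)" "(q n, gval (fst (q n)) (a n) (b n, cc n), q (Suc n)) \<in> R" for n
    using pick(2)[of "q n" "b n" "cc n"] inv[of n] step(3)[of n] by (auto simp: qS a_def)
  obtain \<rho> s e where f: "factor (smul (tr \<Psi>)) (\<lambda>n. hval Cin Cout \<Psi> (a n) (b n)) \<rho> s e"
    and w1: "\<forall>n. \<exists>k\<ge>n. cc k \<and> a (Suc k) = a k \<Longrightarrow> sacc (tr \<Psi>) s e = False"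
    and w2: "\<not> (\<forall>n. \<exists>k\<ge>n. cc k \<and> a (Suc k) = a k) \<Longrightarrow> (\<forall>n. \<exists>k\<ge>n. a (Suc k) \<noteq> a k) = False"
    using is_cert_play[OF cert, of q a cc b] S0(3) pk inv by blast
  have jump: "\<beta> n + 1 \<le> \<beta> (Suc n)" if "cc n \<and> a (Suc n) = a n" for n
    using that by (simp add: \<beta>S \<tau>S cc_def)
  have \<beta>mono: "\<beta> n \<le> \<beta> (Suc n)" for n
    using jump[of n] \<beta>S[of n] by (cases "cc n \<and> a (Suc n) = a n") auto
  show False
  proof (cases "\<forall>n. \<exists>k\<ge>n. cc k \<and> a (Suc k) = a k")
    case True
    have unb: "\<not> bdd_above (range \<tau>)"
    proof
      assume "bdd_above (range \<tau>)"
      then obtain M where M: "\<And>n. \<tau> n \<le> M" by (auto simp: bdd_above_def)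
      obtain n where "M < \<beta> n" using unbounded_jumps[of \<beta> M] \<beta>mono jump True by blast
      then show False using M[of n] inv[of n] by linarith
    qed
    define X where "X = (\<lambda>t\<in>{0..}. a (LEAST n. t < \<tau> (Suc n)))"
    have "a n \<in> alphabet Cin" for n using pick(1)[of "q n"] inv[of n] by (simp add: a_def alphabet_def)
    then have X: "X \<in> signals (alphabet Cin)" "\<And>n t. t \<in> {\<tau> n..<\<tau> (Suc n)} \<Longrightarrow> X t = a n"
      unfolding X_def using block_signal[OF S0(1) mono unb, of a "alphabet Cin"] by blast+
    have XY: "X t = Y n t" if t: "0 \<le> t" "t < \<tau> (Suc n)" for n t
    proof -
      have "\<tau> 0 \<le> t" using t S0 by simp
      then obtain k where k: "\<tau> k \<le> t" "t < \<tau> (Suc k)" using interval_index[OF unb] by blast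
      have "\<tau> k < \<tau> (Suc n)" using k t by simp
      then have "k \<le> n" using mono by (simp add: strict_mono_less)
      then have "Y n t = Y k t" using Ychain[OF k(2), of "n - k"] by simp
      also have "\<dots> = a k" using inv[of k] k(1) by blast
      finally show ?thesis using X(2)[of t k] k by simp
    qed
    \<comment> \<open>Before the next tick \<open>X\<close> and \<open>Y n\<close> coincide, so the
      operator cannot tell them apart.\<close>
    have FX: "F X t = b n" if "t \<in> {\<tau> n..<\<tau> (Suc n)}" for n t
    proof -
      have "0 \<le> t" using that pos[of n] by simp
      then have "F X t = F (Y n) t"
        using that X(1) inv[of n] XY[of _ n] by (intro causal) auto
      then show ?thesis using nxt_c[OF that] by simp
    qed
    have "Rsig_models Cin Cout \<Psi> X (F X) \<longleftrightarrow> sacc (tr \<Psi>) s e"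
      by (rule Rsig_models_iff_sacc[OF spec X(1) FS[OF X(1)] S0(1) mono unb _ f]) (use X(2) FX in blast)
    then show False using w1[OF True] models X(1) by blast
  next
    case False
    \<comment> \<open>The certificate now grants only finitely many input changes. Once the input is
      frozen, every tick is a spontaneous change of one fixed output signal before one fixed
      deadline, which finite variability forbids.\<close>
    then obtain N1 where N1: "\<And>k. N1 \<le> k \<Longrightarrow> \<not> (cc k \<and> a (Suc k) = a k)" by blast
    obtain N2 where N2: "\<And>k. N2 \<le> k \<Longrightarrow> a (Suc k) = a k" using w2[OF False] by blast
    define N where "N = max N1 N2"
    have tick: "a (Suc k) = a k" "\<not> cc k" if "N \<le> k" for k using N1[of k] N2[of k] that by (auto simp: N_def)
    have const: "\<beta> k = \<beta> N" if "N \<le> k" for k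
      by (rule eventually_constant[OF _ that]) (use \<beta>S tick in auto)
    have "Y k = Y N" if "N \<le> k" for k
    proof (rule eventually_constant[OF _ that])
      fix k assume k: "N \<le> k"
      have "Y k s = a k" if "\<tau> (Suc k) \<le> s" for s using inv[of k] step(4)[of k] that by force
      then show "Y (Suc k) = Y k" by (auto simp: YS tick(1)[OF k])
    qed
    then have change: "F (Y N) (\<tau> (Suc k)) \<noteq> F (Y N) (\<tau> k)" if "N \<le> k" for k
    proof -
      have YN: "Y k = Y N" using \<open>N \<le> k \<Longrightarrow> Y k = Y N\<close> that by blast
      have l: "lconst (F (Y N))" using FS[of "Y N"] inv[of N] by (auto simp: signals_iff)
      have lt: "\<tau> k < \<beta> k + 1" using inv[of k] by blast
      have \<tau>k: "\<tau> (Suc k) = nxt (F (Y N)) (\<tau> k) (\<beta> k + 1)" using \<tau>S[of k] tick(1)[OF that] YN by (simp add: p_def np_def)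
      have "nxt (F (Y N)) (\<tau> k) (\<beta> k + 1) < \<beta> k + 1"
        using step(2)[of k] tick(2)[OF that] YN by (auto simp: cc_def p_def np_def)
      from nxt_change[OF l pos lt this] show ?thesis unfolding \<tau>k .
    qed
    have bdd: "bdd_above (range \<tau>)"
    proof (rule bdd_aboveI2)
      fix k
      show "\<tau> k \<le> \<beta> N + 1"
      proof (cases "N \<le> k")
        case True
        then show ?thesis using inv[of k] const[of k] by simp
      next
        case False
        then have "\<tau> k \<le> \<tau> N" using mono by (simp add: strict_mono_less_eq)
        then show ?thesis using inv[of N] by simp
      qed
    qed
    have l: "lconst (F (Y N))" using FS[of "Y N"] inv[of N] by (auto simp: signals_iff)
    obtain N' where N': "\<And>i. N' \<le> i \<Longrightarrow> F (Y N) (\<tau> i) = F (Y N) (\<tau> N')"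
      using lconst_no_zeno[OF l mono pos bdd] by blast
    have "F (Y N) (\<tau> (Suc (max N N'))) = F (Y N) (\<tau> (max N N'))"
      by (rule trans[OF N' N'[symmetric]]) auto
    then show False using change[of "max N N'"] by simp
  qed
qed

end

section \<open>Computability of the semigroups\<close>

text \<open>Course-of-values equations have a unique solution, so a given function is computable as
  soon as it satisfies one.\<close>

lemma course_of_values_fun:
  assumes eq: "\<And>p z. F p z = G p z (\<lambda>y. if y < z then F p y else 0)"
    and G: "cmp (\<lambda>w. G (pfst w) (pfst (psnd w)) (look (pfst (psnd w)) (psnd (psnd w))))"
  shows "cmp (\<lambda>x. F (pfst x) (psnd x))"
proof -
  obtain F' where F': "cmp (\<lambda>x. F' (pfst x) (psnd x))" "\<And>p z. F' p z = G p z (\<lambda>y. if y < z then F' p y else 0)"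
    using course_of_values[OF G] by blast
  have "F' p z = F p z" for p z
  proof (induction z rule: less_induct)
    case (less z)
    then have "(\<lambda>y. if y < z then F' p y else 0) = (\<lambda>y. if y < z then F p y else 0)" by auto
    then show ?case using F'(2)[of p z] eq[of p z] by simp
  qed
  then have "F' = F" by (intro ext)
  then show ?thesis using F'(1) by simp
qed

section \<open>Codes of formulas that decrease along subformulas\<close>

lemma pr_less: "c' < c \<Longrightarrow> x' \<le> x \<Longrightarrow> pr c' x' < pr c x"
  using triangle_mono[of "c' + x'" "c + x"] by (simp add: prod_encode_def)

lemma pr_le: "c' \<le> c \<Longrightarrow> x' \<le> x \<Longrightarrow> pr c' x' \<le> pr c x"
  using triangle_mono[of "c' + x'" "c + x"] by (simp add: prod_encode_def)

lemma psnd_less: "pfst c \<noteq> 0 \<Longrightarrow> psnd c < c"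
  using pr_less[of 0 "pfst c" "psnd c" "psnd c"] le_prod_encode_2[of "psnd c" 0] by simp

lemma sub_less: "pfst c \<noteq> 0 \<Longrightarrow> pfst (psnd c) < c \<and> psnd (psnd c) < c"
  using psnd_less[of c] pfst_le[of "psnd c"] psnd_le[of "psnd c"] by linarith

text \<open>Decoding is total, with every tag other than 0 and 1 read as \<open>ExS\<close>; so the
  functions below are total in the code, as \<open>cmp\<close> demands.\<close>

function sdec :: "nat \<Rightarrow> sform" where
  "sdec c = (if pfst c = 0 then First (pfst (psnd c)) (pfst (psnd (psnd c))) (psnd (psnd (psnd c)))
     else if pfst c = 1 then Nand (sdec (pfst (psnd c))) (sdec (psnd (psnd c)))
     else ExS (pfst (psnd c)) (sdec (psnd (psnd c))))"
  by pat_completeness auto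
termination by (relation "measure id") (simp_all add: sub_less)

declare sdec.simps [simp del]

lemma sdec_First [simp]: "sdec (pr 0 (pr x (pr y z))) = First x y z"
  and sdec_Nand [simp]: "sdec (pr 1 (pr c d)) = Nand (sdec c) (sdec d)"
  and sdec_ExS [simp]: "sdec (pr 2 (pr X c)) = ExS X (sdec c)"
  by (subst sdec.simps, simp)+

text \<open>\<open>set_encode\<close> is monotone under inclusion. An image or a closure can
  therefore be computed by minimising over the codes of its supersets.\<close>

lemma least_superset: "finite S \<Longrightarrow> (LEAST w. S \<subseteq> set_decode w) = set_encode S"
proof (rule Least_equality)
  assume S: "finite S"
  show "S \<subseteq> set_decode (set_encode S)" using S by simp
  show "set_encode S \<le> w" if "S \<subseteq> set_decode w" for w
    using subset_decode_imp_le[of "set_encode S" w] S that by simp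
qed

lemma ex_superset: "finite S \<Longrightarrow> \<exists>w. S \<subseteq> set_decode w"
  by (rule exI[of _ "set_encode S"]) simp

lemma ex_superset2: "\<exists>w. \<forall>i\<in>set_decode a. \<forall>j\<in>set_decode b. f i j \<in> set_decode w"
  using ex_superset[of "(\<lambda>(i, j). f i j) ` (set_decode a \<times> set_decode b)"] by auto

lemma smul_ExS_Least:
  "smul (ExS X \<phi>) a b = (LEAST w. \<forall>i\<in>set_decode a. \<forall>j\<in>set_decode b. smul \<phi> i j \<in> set_decode w)"
proof -
  have "(LEAST w. \<forall>i\<in>set_decode a. \<forall>j\<in>set_decode b. smul \<phi> i j \<in> set_decode w) =
      (LEAST w. (\<lambda>(i, j). smul \<phi> i j) ` (set_decode a \<times> set_decode b) \<subseteq> set_decode w)"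
    by (intro arg_cong[of _ _ Least] ext) auto
  then show ?thesis using least_superset[of "(\<lambda>(i, j). smul \<phi> i j) ` (set_decode a \<times> set_decode b)"] by simp
qed

text \<open>The recursion runs over \<open>z = pr c (pr a b)\<close>. A subformula has a smaller
  code, members of a coded set are smaller than its code, and pairing is monotone, so every
  recursive call is at a smaller number.\<close>

lemma cmp_smul [cmp_intros]:
  assumes "cmp f" "cmp g" "cmp h" shows "cmp (\<lambda>x. smul (sdec (f x)) (g x) (h x))"
proof -
  define F :: "nat \<Rightarrow> nat \<Rightarrow> nat" where
    "F p z = smul (sdec (pfst z)) (pfst (psnd z)) (psnd (psnd z))" for p z
  define G :: "nat \<Rightarrow> nat \<Rightarrow> (nat \<Rightarrow> nat) \<Rightarrow> nat" where "G p z f =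
     (if pfst (pfst z) = 0 then if pfst (psnd z) = 0 then psnd (psnd z) else pfst (psnd z)
      else if pfst (pfst z) = 1 then
        pr (f (pr (pfst (psnd (pfst z))) (pr (pfst (pfst (psnd z))) (pfst (psnd (psnd z))))))
           (f (pr (psnd (psnd (pfst z))) (pr (psnd (pfst (psnd z))) (psnd (psnd (psnd z))))))
      else (LEAST w. \<forall>i\<in>set_decode (pfst (psnd z)). \<forall>j\<in>set_decode (psnd (psnd z)).
        f (pr (psnd (psnd (pfst z))) (pr i j)) \<in> set_decode w))" for p z f
  have "cmp (\<lambda>x. F (pfst x) (psnd x))"
  proof (rule course_of_values_fun[where G = G])
    fix p z
    define c a b where "c = pfst z" and "a = pfst (psnd z)" and "b = psnd (psnd z)"
    have z: "z = pr c (pr a b)" by (simp add: c_def a_def b_def)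
    have lt: "pr c' (pr a' b') < z" if "c' < c" "a' \<le> a" "b' \<le> b" for c' a' b'
      unfolding z using that by (intro pr_less pr_le)
    have le: "i \<le> n" if "i \<in> set_decode n" for i n using set_decode_less[OF that] by simp
    let ?f = "\<lambda>y. if y < z then F p y else 0"
    consider "pfst c = 0" | "pfst c = 1" | "pfst c \<noteq> 0" "pfst c \<noteq> 1" by blast
    then show "F p z = G p z ?f"
    proof cases
      case 1
      then show ?thesis by (simp add: F_def G_def z sdec.simps[of c])
    next
      case 2
      then have "pr (pfst (psnd c)) (pr (pfst a) (pfst b)) < z" "pr (psnd (psnd c)) (pr (psnd a) (psnd b)) < z"
        using sub_less[of c] by (auto intro!: lt simp: pfst_le psnd_le)
      then show ?thesis using 2 by (simp add: F_def G_def z sdec.simps[of c])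
    next
      case 3
      then have "?f (pr (psnd (psnd c)) (pr i j)) = smul (sdec (psnd (psnd c))) i j"
        if "i \<in> set_decode a" "j \<in> set_decode b" for i j
        using sub_less[of c] lt[OF _ le[OF that(1)] le[OF that(2)]] by (simp add: F_def)
      then have "(\<forall>i\<in>set_decode a. \<forall>j\<in>set_decode b. ?f (pr (psnd (psnd c)) (pr i j)) \<in> set_decode w) \<longleftrightarrow>
          (\<forall>i\<in>set_decode a. \<forall>j\<in>set_decode b. smul (sdec (psnd (psnd c))) i j \<in> set_decode w)" for w
        by (simp only: cong: ball_cong)
      then show ?thesis using 3
        by (simp only: F_def G_def z pfst_pr psnd_pr sdec.simps[of c] if_False smul_ExS_Least)
    qed
  next
    show "cmp (\<lambda>w. G (pfst w) (pfst (psnd w)) (look (pfst (psnd w)) (psnd (psnd w))))"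
      unfolding G_def by (intro cmp_intros) (rule ex_superset2)
  qed
  from cmp_compose3[of "\<lambda>a b c. F 0 (pr a (pr b c))", OF _ assms]
    cmp_compose[OF this, of "\<lambda>x. pr 0 x"]
  show ?thesis by (simp add: F_def cmp_intros)
qed

lemma cmp_sacc [cmp_intros]:
  assumes "cmp f" "cmp g" "cmp h" shows "dec (\<lambda>x. sacc (sdec (f x)) (g x) (h x))"
proof -
  define F :: "nat \<Rightarrow> nat \<Rightarrow> nat" where
    "F p z = of_bool (sacc (sdec (pfst z)) (pfst (psnd z)) (psnd (psnd z)))" for p z
  define G :: "nat \<Rightarrow> nat \<Rightarrow> (nat \<Rightarrow> nat) \<Rightarrow> nat" where "G p z f = of_bool
     (if pfst (pfst z) = 0 then pfst (psnd z) = 1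
      else if pfst (pfst z) = 1 then
        \<not> (f (pr (pfst (psnd (pfst z))) (pr (pfst (pfst (psnd z))) (pfst (psnd (psnd z))))) = 1 \<and>
           f (pr (psnd (psnd (pfst z))) (pr (psnd (pfst (psnd z))) (psnd (psnd (psnd z))))) = 1)
      else (\<exists>i\<in>set_decode (pfst (psnd z)). \<exists>j\<in>set_decode (psnd (psnd z)).
        smul (sdec (psnd (psnd (pfst z)))) i j = i \<and> smul (sdec (psnd (psnd (pfst z)))) j j = j \<and>
        f (pr (psnd (psnd (pfst z))) (pr i j)) = 1))" for p z f
  have "cmp (\<lambda>x. F (pfst x) (psnd x))"
  proof (rule course_of_values_fun[where G = G])
    fix p z
    define c a b where "c = pfst z" and "a = pfst (psnd z)" and "b = psnd (psnd z)"
    have z: "z = pr c (pr a b)" by (simp add: c_def a_def b_def)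
    have lt: "pr c' (pr a' b') < z" if "c' < c" "a' \<le> a" "b' \<le> b" for c' a' b'
      unfolding z using that by (intro pr_less pr_le)
    have le: "i \<le> n" if "i \<in> set_decode n" for i n using set_decode_less[OF that] by simp
    let ?f = "\<lambda>y. if y < z then F p y else 0"
    consider "pfst c = 0" | "pfst c = 1" | "pfst c \<noteq> 0" "pfst c \<noteq> 1" by blast
    then show "F p z = G p z ?f"
    proof cases
      case 1
      then show ?thesis by (simp add: F_def G_def z sdec.simps[of c])
    next
      case 2
      then have "pr (pfst (psnd c)) (pr (pfst a) (pfst b)) < z" "pr (psnd (psnd c)) (pr (psnd a) (psnd b)) < z"
        using sub_less[of c] by (auto intro!: lt simp: pfst_le psnd_le)
      then show ?thesis using 2 by (simp add: F_def G_def z sdec.simps[of c])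
    next
      case 3
      then have "?f (pr (psnd (psnd c)) (pr i j)) = 1 \<longleftrightarrow> sacc (sdec (psnd (psnd c))) i j"
        if "i \<in> set_decode a" "j \<in> set_decode b" for i j
        using sub_less[of c] lt[OF _ le[OF that(1)] le[OF that(2)]] by (simp add: F_def)
      then show ?thesis using 3
        by (simp only: F_def G_def z pfst_pr psnd_pr sdec.simps[of c] if_False sacc.simps cong: bex_cong)
    qed
  next
    show "cmp (\<lambda>w. G (pfst w) (pfst (psnd w)) (look (pfst (psnd w)) (psnd (psnd w))))"
      unfolding G_def by (intro cmp_intros)
  qed
  from cmp_compose3[of "\<lambda>a b c. F 0 (pr a (pr b c))", OF _ assms]
    cmp_compose[OF this, of "\<lambda>x. pr 0 x"]
  show ?thesis by (simp add: F_def cmp_intros dec_def)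
qed

text \<open>The generators are arbitrary numbers here, possibly outside \<open>scar\<close>, since
  the minimisation that computes \<open>shom\<close> has to halt on all inputs.\<close>

lemma finite_gen_smul: "finite G \<Longrightarrow> finite (gen (smul \<phi>) G)"
proof (induction \<phi> arbitrary: G)
  case (First x y z)
  have "gen (smul (First x y z)) G \<subseteq> G" by (rule gen_subset) auto
  then show ?case using First finite_subset by blast
next
  case (Nand \<phi> \<psi>)
  have "gen (smul (Nand \<phi> \<psi>)) G \<subseteq> prod_encode ` (gen (smul \<phi>) (pfst ` G) \<times> gen (smul \<psi>) (psnd ` G))"
    (is "_ \<subseteq> ?S")
  proof (rule gen_subset)
    show "G \<subseteq> ?S"
    proof
      fix g assume "g \<in> G"
      then have "pr (pfst g) (psnd g) \<in> ?S" by (intro imageI) (auto intro: gen.base)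
      then show "g \<in> ?S" by simp
    qed
    show "smul (Nand \<phi> \<psi>) a b \<in> ?S" if "a \<in> ?S" "b \<in> ?S" for a b using that by (auto intro: gen.step)
  qed
  moreover have "finite ?S" using Nand by (intro finite_imageI finite_SigmaI) auto
  ultimately show ?case by (rule finite_subset)
next
  case (ExS X \<phi>)
  let ?H = "gen (smul \<phi>) (\<Union> (set_decode ` G))"
  have fH: "finite ?H" using ExS by simp
  have "gen (smul (ExS X \<phi>)) G \<subseteq> set_encode ` Pow ?H"
  proof (rule gen_subset)
    show "G \<subseteq> set_encode ` Pow ?H"
    proof
      fix g assume "g \<in> G"
      then have "set_decode g \<in> Pow ?H" by (auto intro: gen.base)
      then have "set_encode (set_decode g) \<in> set_encode ` Pow ?H" by (rule imageI)
      then show "g \<in> set_encode ` Pow ?H" by simp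
    qed
    show "smul (ExS X \<phi>) a b \<in> set_encode ` Pow ?H" if ab: "a \<in> set_encode ` Pow ?H" "b \<in> set_encode ` Pow ?H" for a b
    proof -
      obtain A B where AB: "a = set_encode A" "A \<subseteq> ?H" "b = set_encode B" "B \<subseteq> ?H" using ab by blast
      have fAB: "finite A" "finite B" using AB(2,4) fH finite_subset by blast+
      have "(\<lambda>(c, d). smul \<phi> c d) ` (A \<times> B) \<in> Pow ?H" using AB by (auto intro: gen.step)
      then show ?thesis unfolding smul.simps AB(1,3) set_encode_inverse[OF fAB(1)] set_encode_inverse[OF fAB(2)]
        by (rule imageI)
    qed
  qed
  moreover have "finite (set_encode ` Pow ?H)" using fH by simp
  ultimately show ?case by (rule finite_subset)
qed

lemma gen_Least:
  "set_encode (gen (smul \<phi>) {g, h}) = (LEAST w. g \<in> set_decode w \<and> h \<in> set_decode w \<and>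
     (\<forall>i\<in>set_decode w. \<forall>j\<in>set_decode w. smul \<phi> i j \<in> set_decode w))"
proof (rule Least_equality[symmetric])
  have fin: "finite (gen (smul \<phi>) {g, h})" by (rule finite_gen_smul) simp
  show "g \<in> set_decode (set_encode (gen (smul \<phi>) {g, h})) \<and> h \<in> set_decode (set_encode (gen (smul \<phi>) {g, h})) \<and>
      (\<forall>i\<in>set_decode (set_encode (gen (smul \<phi>) {g, h})). \<forall>j\<in>set_decode (set_encode (gen (smul \<phi>) {g, h})).
        smul \<phi> i j \<in> set_decode (set_encode (gen (smul \<phi>) {g, h})))"
    using fin by (simp add: gen.base gen.step)
  fix w assume "g \<in> set_decode w \<and> h \<in> set_decode w \<and>
     (\<forall>i\<in>set_decode w. \<forall>j\<in>set_decode w. smul \<phi> i j \<in> set_decode w)"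
  then have "gen (smul \<phi>) {g, h} \<subseteq> set_decode w" by (intro gen_subset) auto
  then show "set_encode (gen (smul \<phi>) {g, h}) \<le> w"
    using subset_decode_imp_le[of "set_encode (gen (smul \<phi>) {g, h})" w] fin by simp
qed

lemma ex_closed: "\<exists>w. g \<in> set_decode w \<and> h \<in> set_decode w \<and>
     (\<forall>i\<in>set_decode w. \<forall>j\<in>set_decode w. smul \<phi> i j \<in> set_decode w)"
  by (rule exI[of _ "set_encode (gen (smul \<phi>) {g, h})"])
    (simp add: finite_gen_smul gen.base gen.step)

lemma power_le_of_mem: "a \<in> set_decode z \<Longrightarrow> 2 ^ a \<le> z"
  using subset_decode_imp_le[of "2 ^ a" z] set_encode_inverse[of "{a}"] by (simp add: set_encode_def)

lemma set_decode_bound: "z < 2 ^ N \<longleftrightarrow> set_decode z \<subseteq> {..<N}"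
proof
  assume z: "z < 2 ^ N"
  show "set_decode z \<subseteq> {..<N}"
  proof
    fix a assume "a \<in> set_decode z"
    then have "(2::nat) ^ a < 2 ^ N" using power_le_of_mem z le_less_trans by blast
    then show "a \<in> {..<N}" by simp
  qed
next
  assume "set_decode z \<subseteq> {..<N}"
  then have "z \<le> set_encode {..<N}" using subset_decode_imp_le[of z "set_encode {..<N}"] by simp
  also have "set_encode {..<N} < 2 ^ N"
    unfolding set_encode_def by (induction N) (auto simp: lessThan_Suc)
  finally show "z < 2 ^ N" .
qed

definition ins_bit :: "nat \<Rightarrow> nat \<Rightarrow> nat" where "ins_bit X l = (if X \<in> set_decode l then l else l + 2 ^ X)"
definition del_bit :: "nat \<Rightarrow> nat \<Rightarrow> nat" where "del_bit X l = (if X \<in> set_decode l then l - 2 ^ X else l)"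

lemma set_decode_ins_bit: "set_decode (ins_bit X l) = insert X (set_decode l)"
  using set_decode_plus_power_2[of X l] by (auto simp: ins_bit_def add.commute)

lemma diff_eq_from_add: "(l::nat) = p + s \<Longrightarrow> l - p = s"
  by simp

lemma set_decode_del_bit: "set_decode (del_bit X l) = set_decode l - {X}"
proof (cases "X \<in> set_decode l")
  case True
  then have "l = set_encode (insert X (set_decode l - {X}))" by (simp add: insert_absorb)
  also have "\<dots> = 2 ^ X + set_encode (set_decode l - {X})" by (subst set_encode_insert) auto
  finally have "l - 2 ^ X = set_encode (set_decode l - {X})" by (rule diff_eq_from_add)
  then show ?thesis using True by (simp add: del_bit_def)
qed (simp add: del_bit_def)

text \<open>For \<open>ExS\<close> the letter set gains a bit and so may grow while the formula
  shrinks. The argument \<open>c * 2^N + l\<close> with \<open>l < 2^N\<close> orders by the formula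
  first; \<open>N\<close> is a fixed parameter, large enough because bound variables are below the
  code \<open>c \<le> N\<close>.\<close>

lemma cmp_shom [cmp_intros]:
  assumes "cmp f" "cmp g" shows "cmp (\<lambda>x. shom (sdec (f x)) (set_decode (g x)))"
proof -
  define G :: "nat \<Rightarrow> nat \<Rightarrow> (nat \<Rightarrow> nat) \<Rightarrow> nat" where "G N i f = (
      if pfst (i div 2^N) = 0 then
        if pfst (psnd (i div 2^N)) \<in> set_decode (i mod 2^N) \<or> pfst (psnd (psnd (i div 2^N))) \<in> set_decode (i mod 2^N)
        then if psnd (psnd (psnd (i div 2^N))) \<in> set_decode (i mod 2^N) then 1 else 2 else 0
      else if pfst (i div 2^N) = 1 then
        pr (f (pfst (psnd (i div 2^N)) * 2^N + i mod 2^N)) (f (psnd (psnd (i div 2^N)) * 2^N + i mod 2^N))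
      else (LEAST w.
        f (psnd (psnd (i div 2^N)) * 2^N + ins_bit (pfst (psnd (i div 2^N))) (i mod 2^N)) \<in> set_decode w \<and>
        f (psnd (psnd (i div 2^N)) * 2^N + del_bit (pfst (psnd (i div 2^N))) (i mod 2^N)) \<in> set_decode w \<and>
        (\<forall>a\<in>set_decode w. \<forall>b\<in>set_decode w. smul (sdec (psnd (psnd (i div 2^N)))) a b \<in> set_decode w)))" for N i f
  have "cmp (\<lambda>w. G (pfst w) (pfst (psnd w)) (look (pfst (psnd w)) (psnd (psnd w))))"
    unfolding G_def ins_bit_def del_bit_def by (intro cmp_intros) (rule ex_closed)
  then obtain F where F: "cmp (\<lambda>x. F (pfst x) (psnd x))"
    "\<And>N i. F N i = G N i (\<lambda>y. if y < i then F N y else 0)" using course_of_values[of G] by blast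
  have *: "F N (c * 2^N + l) = shom (sdec c) (set_decode l)" if "c \<le> N" "l < 2^N" for N c l
    using that
  proof (induction c arbitrary: l rule: less_induct)
    case (less c)
    let ?i = "c * 2^N + l"
    have dm: "?i div 2^N = c" "?i mod 2^N = l" using less.prems by simp_all
    have sub: "(if c' * 2^N + l' < ?i then F N (c' * 2^N + l') else 0) = shom (sdec c') (set_decode l')"
      if "c' < c" "l' < 2^N" for c' l'
    proof -
      have "Suc c' * 2^N \<le> c * 2^N" using that by (intro mult_le_mono1) simp
      then have "c' * 2^N + l' < ?i" using that by simp
      then show ?thesis using less.IH[of c' l'] that less.prems by simp
    qed
    consider "pfst c = 0" | "pfst c = 1" | "pfst c \<noteq> 0" "pfst c \<noteq> 1" by blast
    then show ?case
    proof cases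
      case 1
      then show ?thesis unfolding F(2)[of N ?i] G_def dm by (simp add: sdec.simps[of c])
    next
      case 2
      then show ?thesis unfolding F(2)[of N ?i] G_def dm
        using sub[of "pfst (psnd c)" l] sub[of "psnd (psnd c)" l] sub_less[of c] less.prems
        by (simp add: sdec.simps[of c])
    next
      case 3
      have X: "pfst (psnd c) < N" using sub_less[OF 3(1)] less.prems by simp
      have b: "set_decode l \<subseteq> {..<N}" using less.prems(2) set_decode_bound by blast
      have "ins_bit (pfst (psnd c)) l < 2^N" "del_bit (pfst (psnd c)) l < 2^N"
        unfolding set_decode_bound set_decode_ins_bit set_decode_del_bit using X b by auto
      from sub[OF conjunct2[OF sub_less[OF 3(1)]] this(1)] sub[OF conjunct2[OF sub_less[OF 3(1)]] this(2)]
      show ?thesis unfolding F(2)[of N ?i] G_def dm using 3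
        by (simp only: sdec.simps[of c] if_False shom.simps gen_Least set_decode_ins_bit set_decode_del_bit)
    qed
  qed
  \<comment> \<open>With \<open>N = c + l\<close> both side conditions hold, because
    \<open>l < 2 ^ l\<close>.\<close>
  have "F (c + l) (c * 2^(c + l) + l) = shom (sdec c) (set_decode l)" for c l
    by (rule *[OF le_add1 less_le_trans[OF less_exp power_increasing[OF le_add2]]]) simp
  moreover have "cmp (\<lambda>x. F (f x + g x) (f x * 2^(f x + g x) + g x))"
    by (rule cmp_compose2[OF F(1)]) (intro cmp_intros assms)+
  ultimately show ?thesis by simp
qed

lemma dec_fvs [cmp_intros]:
  assumes "cmp f" "cmp g" shows "dec (\<lambda>x. f x \<in> fvs (sdec (g x)))"
proof -
  define F :: "nat \<Rightarrow> nat \<Rightarrow> nat" where "F v c = of_bool (v \<in> fvs (sdec c))" for v c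
  define G :: "nat \<Rightarrow> nat \<Rightarrow> (nat \<Rightarrow> nat) \<Rightarrow> nat" where "G v c f = of_bool (
      if pfst c = 0 then v = pfst (psnd c) \<or> v = pfst (psnd (psnd c)) \<or> v = psnd (psnd (psnd c))
      else if pfst c = 1 then f (pfst (psnd c)) = 1 \<or> f (psnd (psnd c)) = 1
      else v \<noteq> pfst (psnd c) \<and> f (psnd (psnd c)) = 1)" for v c f
  have "cmp (\<lambda>x. F (pfst x) (psnd x))"
  proof (rule course_of_values_fun[where G = G])
    show "F p z = G p z (\<lambda>y. if y < z then F p y else 0)" for p z
      using sub_less[of z] by (auto simp: F_def G_def sdec.simps[of z])
    show "cmp (\<lambda>w. G (pfst w) (pfst (psnd w)) (look (pfst (psnd w)) (psnd (psnd w))))"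
      unfolding G_def by (intro cmp_intros)
  qed
  from cmp_compose2[OF this assms] show ?thesis by (simp add: F_def dec_def)
qed

text \<open>Bounds the search for free variables of a decoded formula.\<close>

lemma fvs_less: "v \<in> fvs (sdec c) \<Longrightarrow> v \<le> c"
proof (induction c rule: less_induct)
  case (less c)
  have le: "pfst (psnd c) \<le> c" "pfst (psnd (psnd c)) \<le> c" "psnd (psnd (psnd c)) \<le> c"
    using pfst_le[of "psnd c"] psnd_le[of c] psnd_le[of "psnd c"] pfst_le[of "psnd (psnd c)"]
      psnd_le[of "psnd (psnd c)"] by linarith+
  show ?case
  proof (cases "pfst c = 0")
    case True
    then show ?thesis using less.prems le by (auto simp: sdec.simps[of c])
  next
    case False
    then have "v \<in> fvs (sdec (pfst (psnd c))) \<or> v \<in> fvs (sdec (psnd (psnd c)))"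
      using less.prems by (auto simp: sdec.simps[of c] split: if_splits)
    then show ?thesis using less.IH sub_less[OF False] by fastforce
  qed
qed

subsection \<open>Codes of formulas\<close>

abbreviation cFirst :: "nat \<Rightarrow> nat \<Rightarrow> nat \<Rightarrow> nat" where "cFirst x y z \<equiv> pr 0 (pr x (pr y z))"
abbreviation cNand :: "nat \<Rightarrow> nat \<Rightarrow> nat" where "cNand c d \<equiv> pr 1 (pr c d)"
abbreviation cEx :: "nat \<Rightarrow> nat \<Rightarrow> nat" where "cEx X c \<equiv> pr 2 (pr X c)"
abbreviation cEx1 :: "nat \<Rightarrow> nat \<Rightarrow> nat" where
  "cEx1 x c \<equiv> cEx (2*x+1) (cNand (cNand (cFirst (2*x+1) (2*x+1) (2*x+1)) c) (cNand (cFirst (2*x+1) (2*x+1) (2*x+1)) c))"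

text \<open>The value \<open>0\<close> marks numbers that are not codes of formulas, and the code \<open>c\<close> of a translation is
  represented by \<open>Suc c\<close>.\<close>

definition trG :: "nat \<Rightarrow> (nat \<Rightarrow> nat) \<Rightarrow> nat" where
  "trG n f = (
     if pfst n = 0 then Suc (cNand (cFirst (2 * pfst (psnd n) + 1) (2 * psnd (psnd n) + 1) (2 * psnd (psnd n) + 1))
                                   (cFirst (2 * pfst (psnd n) + 1) (2 * psnd (psnd n) + 1) (2 * psnd (psnd n) + 1)))
     else if pfst n = 1 then Suc (cFirst (2 * psnd (psnd n) + 1) (2 * psnd (psnd n) + 1) (2 * pfst (psnd n)))
     else if pfst n = 2 then if f (psnd n) = 0 then 0 else Suc (cNand (f (psnd n) - 1) (f (psnd n) - 1))
     else if pfst n = 3 then if f (pfst (psnd n)) = 0 \<or> f (psnd (psnd n)) = 0 then 0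
       else Suc (cNand (cNand (f (pfst (psnd n)) - 1) (f (psnd (psnd n)) - 1))
                       (cNand (f (pfst (psnd n)) - 1) (f (psnd (psnd n)) - 1)))
     else if pfst n = 4 then if f (pfst (psnd n)) = 0 \<or> f (psnd (psnd n)) = 0 then 0
       else Suc (cNand (cNand (f (pfst (psnd n)) - 1) (f (pfst (psnd n)) - 1))
                       (cNand (f (psnd (psnd n)) - 1) (f (psnd (psnd n)) - 1)))
     else if pfst n > 8 \<or> f (psnd (psnd n)) = 0 then 0
     else if pfst n = 5 then Suc (cEx1 (pfst (psnd n)) (f (psnd (psnd n)) - 1))
     else if pfst n = 6 then Suc (cNand
       (cEx1 (pfst (psnd n)) (cNand (f (psnd (psnd n)) - 1) (f (psnd (psnd n)) - 1)))
       (cEx1 (pfst (psnd n)) (cNand (f (psnd (psnd n)) - 1) (f (psnd (psnd n)) - 1))))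
     else if pfst n = 7 then Suc (cEx (2 * pfst (psnd n)) (f (psnd (psnd n)) - 1))
     else Suc (cNand
       (cEx (2 * pfst (psnd n)) (cNand (f (psnd (psnd n)) - 1) (f (psnd (psnd n)) - 1)))
       (cEx (2 * pfst (psnd n)) (cNand (f (psnd (psnd n)) - 1) (f (psnd (psnd n)) - 1)))))"

theorem tr_computable:
  obtains T where "cmp T" "\<And>\<phi>. T (mso_encode \<phi>) \<noteq> 0 \<and> sdec (T (mso_encode \<phi>) - 1) = tr \<phi>"
    "\<And>n. T n \<noteq> 0 \<Longrightarrow> \<exists>\<phi>. n = mso_encode \<phi>"
proof -
  have "cmp (\<lambda>w. trG (pfst (psnd w)) (look (pfst (psnd w)) (psnd (psnd w))))"
    unfolding trG_def by (intro cmp_intros)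
  then obtain F :: "nat \<Rightarrow> nat \<Rightarrow> nat" where F: "cmp (\<lambda>x. F (pfst x) (psnd x))"
    "\<And>p n. F p n = trG n (\<lambda>y. if y < n then F p y else 0)" using course_of_values[of "\<lambda>_. trG"] by blast
  define T where "T = F 0"
  have "cmp T" unfolding T_def using cmp_compose2[OF F(1) cmp_const[of 0] cmp_id] by simp
  have T: "T n = trG n T" for n
  proof -
    have "trG n (\<lambda>y. if y < n then F 0 y else 0) = trG n (F 0)"
      using sub_less[of n] psnd_less[of n] by (simp add: trG_def)
    then show ?thesis using F(2)[of 0 n] by (simp add: T_def)
  qed
  have "T (mso_encode \<phi>) \<noteq> 0 \<and> sdec (T (mso_encode \<phi>) - 1) = tr \<phi>" for \<phi>
    by (induction \<phi>) (subst (1 2) T, simp add: trG_def sdec_Nand[unfolded One_nat_def])+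
  moreover have "\<exists>\<phi>. n = mso_encode \<phi>" if "T n \<noteq> 0" for n
    using that
  proof (induction n rule: less_induct)
    case (less n)
    define t x y where "t = pfst n" and "x = pfst (psnd n)" and "y = psnd (psnd n)"
    have n: "n = pr t (pr x y)" by (simp add: t_def x_def y_def)
    have lt: "psnd n < n" "x < n" "y < n" if "t \<noteq> 0" using psnd_less sub_less that by (auto simp: t_def x_def y_def)
    have Tn: "trG n T \<noteq> 0" using less.prems T[of n] by simp
    consider "t = 0" | "t = 1" | "t = 2" "T (psnd n) \<noteq> 0" | "t = 3" "T x \<noteq> 0" "T y \<noteq> 0" | "t = 4" "T x \<noteq> 0" "T y \<noteq> 0"
      | "t = 5" "T y \<noteq> 0" | "t = 6" "T y \<noteq> 0" | "t = 7" "T y \<noteq> 0" | "t = 8" "T y \<noteq> 0"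
      using Tn unfolding trG_def t_def[symmetric] x_def[symmetric] y_def[symmetric]
      by (auto split: if_splits simp del: One_nat_def) linarith?
    then show ?case
    proof cases
      case 1 then show ?thesis using n by (intro exI[of _ "Less x y"]) simp
    next
      case 2 then show ?thesis using n by (intro exI[of _ "Pred x y"]) simp
    next
      case 3
      then obtain \<phi> where "psnd n = mso_encode \<phi>" using less.IH lt by fastforce
      then show ?thesis using 3 n by (intro exI[of _ "Neg \<phi>"]) simp
    next
      case 4
      then obtain \<phi> \<psi> where "x = mso_encode \<phi>" "y = mso_encode \<psi>" using less.IH lt by (metis zero_neq_numeral)
      then show ?thesis using 4 n by (intro exI[of _ "Conj \<phi> \<psi>"]) simp
    next
      case 5
      then obtain \<phi> \<psi> where "x = mso_encode \<phi>" "y = mso_encode \<psi>" using less.IH lt by (metis zero_neq_numeral)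
      then show ?thesis using 5 n by (intro exI[of _ "Disj \<phi> \<psi>"]) simp
    next
      case 6
      then obtain \<phi> where "y = mso_encode \<phi>" using less.IH lt by fastforce
      then show ?thesis using 6 n by (intro exI[of _ "Ex1 x \<phi>"]) simp
    next
      case 7
      then obtain \<phi> where "y = mso_encode \<phi>" using less.IH lt by fastforce
      then show ?thesis using 7 n by (intro exI[of _ "All1 x \<phi>"]) simp
    next
      case 8
      then obtain \<phi> where "y = mso_encode \<phi>" using less.IH lt by fastforce
      then show ?thesis using 8 n by (intro exI[of _ "Ex2 x \<phi>"]) simp
    next
      case 9
      then obtain \<phi> where "y = mso_encode \<phi>" using less.IH lt by fastforce
      then show ?thesis using 9 n by (intro exI[of _ "All2 x \<phi>"]) simp
    qed
  qed
  ultimately show ?thesis using that \<open>cmp T\<close> by blast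
qed

subsection \<open>Codes of alphabets\<close>

text \<open>A non-empty list is coded as the successor of the pair of its head and its coded tail,
  and the empty list as 0. Since \<open>0 - 1 = 0\<close>, the tail of the empty list is again
  empty.\<close>

definition ltl :: "nat \<Rightarrow> nat" where "ltl c = psnd (c - 1)"
definition lnth :: "nat \<Rightarrow> nat \<Rightarrow> nat" where "lnth c i = pfst ((ltl ^^ i) c - 1)"
definition llen :: "nat \<Rightarrow> nat" where "llen c = (LEAST k. (ltl ^^ k) c = 0)"

lemma ltl_list_encode: "(ltl ^^ k) (list_encode xs) = list_encode (drop k xs)"
proof (induction k arbitrary: xs)
  case (Suc k)
  have "ltl (list_encode xs) = list_encode (drop 1 xs)"
    using psnd_le[of 0] by (cases xs) (simp_all add: ltl_def)
  then show ?case using Suc[of "drop 1 xs"] by (simp add: funpow_Suc_right del: funpow.simps)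
qed simp

lemma list_encode_zero: "list_encode xs = 0 \<longleftrightarrow> xs = []"
  by (cases xs) auto

lemma llen_list_encode: "llen (list_encode xs) = length xs"
  unfolding llen_def ltl_list_encode list_encode_zero by (rule Least_equality) auto

lemma lnth_list_encode: "i < length xs \<Longrightarrow> lnth (list_encode xs) i = xs ! i"
  unfolding lnth_def ltl_list_encode by (simp add: Cons_nth_drop_Suc[symmetric])

lemma cmp_ltl [cmp_intros]: "cmp f \<Longrightarrow> cmp (\<lambda>x. ltl (f x))"
  unfolding ltl_def by (intro cmp_intros)

lemma cmp_lnth [cmp_intros]: "cmp f \<Longrightarrow> cmp g \<Longrightarrow> cmp (\<lambda>x. lnth (f x) (g x))"
  unfolding lnth_def by (intro cmp_intros cmp_funpow[OF cmp_ltl[OF cmp_id]])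

lemma cmp_llen [cmp_intros]: assumes "cmp f" shows "cmp (\<lambda>x. llen (f x))"
proof -
  have "\<exists>k. (ltl ^^ k) c = 0" for c
    using ltl_list_encode[of "length (list_decode c)" "list_decode c"] by auto
  then have "cmp llen" unfolding llen_def
    by (intro cmp_Least dec_eq cmp_funpow[OF cmp_ltl[OF cmp_id]] cmp_const cmp_pfst cmp_psnd cmp_id)
  then show ?thesis using assms by (rule cmp_compose)
qed

definition ccoding :: "nat \<Rightarrow> bool" where
  "ccoding n \<longleftrightarrow> llen n \<noteq> 0 \<and> (\<forall>i<llen n. llen (lnth n i) = llen (lnth n 0)) \<and>
     (\<forall>i<llen n. \<forall>j<llen (lnth n i). lnth (lnth n i) j < 2) \<and>
     (\<forall>i<llen n. \<forall>k<i. lnth n i \<noteq> lnth n k)"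

lemma dec_ccoding [cmp_intros]: assumes "cmp f" shows "dec (\<lambda>x. ccoding (f x))"
  by (rule dec_compose[OF _ assms], unfold ccoding_def) (intro cmp_intros)

lemma llen_coding: "llen (coding_encode C) = length C"
  by (simp add: coding_encode_def llen_list_encode)

lemma lnth_coding: "i < length C \<Longrightarrow> lnth (coding_encode C) i = list_encode (map of_bool (C ! i))"
  by (simp add: coding_encode_def lnth_list_encode)

lemma llen_row: "i < length C \<Longrightarrow> llen (lnth (coding_encode C) i) = length (C ! i)"
  by (simp add: lnth_coding llen_list_encode)

lemma bit_coding: "i < length C \<Longrightarrow> j < length (C ! i) \<Longrightarrow> lnth (lnth (coding_encode C) i) j = of_bool (C ! i ! j)"
  by (simp add: lnth_coding lnth_list_encode)

lemma ccoding_iff: "ccoding n \<longleftrightarrow> (\<exists>C. is_coding C \<and> n = coding_encode C)"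
proof
  assume n: "ccoding n"
  define xs where "xs = list_decode n"
  have nx: "n = list_encode xs" by (simp add: xs_def)
  have len: "llen n = length xs" by (simp add: nx llen_list_encode)
  define C where "C = map (\<lambda>r. map (\<lambda>b. b = 1) (list_decode r)) xs"
  have row: "list_encode (map of_bool (map (\<lambda>b. b = 1) (list_decode r))) = r" if r: "r \<in> set xs" for r
  proof -
    obtain i where i: "i < length xs" "r = xs ! i" using r by (auto simp: in_set_conv_nth)
    have "lnth n i = r" using i by (simp add: nx lnth_list_encode)
    then have lt: "lnth r j < 2" if "j < llen r" for j
      using n i len that unfolding ccoding_def by metis
    have "of_bool (b = 1) = b" if b: "b \<in> set (list_decode r)" for b
    proof -
      obtain j where j: "j < length (list_decode r)" "b = list_decode r ! j"
        using b by (metis in_set_conv_nth)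
      then have "b < 2" using lt[of j] llen_list_encode[of "list_decode r"] lnth_list_encode[OF j(1)] by simp
      then show ?thesis by (auto simp: less_2_cases_iff)
    qed
    then have "map of_bool (map (\<lambda>b. b = 1) (list_decode r)) = list_decode r" by (simp add: map_idI)
    then show ?thesis by simp
  qed
  then have enc: "coding_encode C = n" by (simp add: coding_encode_def C_def nx comp_def map_idI)
  have lC: "length C = length xs" by (simp add: C_def)
  have "length (C ! i) = length (C ! 0)" if "i < length C" for i
  proof -
    have "0 < length C" using that by linarith
    moreover have "llen (lnth n i) = llen (lnth n 0)" using n that lC len unfolding ccoding_def by metis
    ultimately show ?thesis using llen_row[OF that] llen_row[of 0 C] by (simp only: enc)
  qed
  moreover have "llen n \<noteq> 0" using n unfolding ccoding_def by blast
  then have "C \<noteq> []" using len lC by auto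
  moreover have "distinct C" unfolding distinct_conv_nth
  proof (intro allI impI)
    fix i j assume ij: "i < length C" "j < length C" "i \<noteq> j"
    then have "lnth n i \<noteq> lnth n j" using n len lC unfolding ccoding_def by (metis linorder_neqE_nat)
    then show "C ! i \<noteq> C ! j" using ij lnth_coding[of i C] lnth_coding[of j C] by (auto simp: enc)
  qed
  ultimately have "is_coding C" unfolding is_coding_def by (metis hd_conv_nth in_set_conv_nth)
  then show "\<exists>C. is_coding C \<and> n = coding_encode C" using enc by blast
next
  assume "\<exists>C. is_coding C \<and> n = coding_encode C"
  then obtain C where C: "is_coding C" "n = coding_encode C" by blast
  have w: "length (C ! i) = length (C ! 0)" if "i < length C" for i
    using C(1) that unfolding is_coding_def by (metis hd_conv_nth nth_mem)
  have "lnth n i \<noteq> lnth n k" if "i < length C" "k < i" for i k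
  proof -
    have "C ! i \<noteq> C ! k" using C(1) that by (auto simp: is_coding_def nth_eq_iff_index_eq)
    moreover have "inj (of_bool :: bool \<Rightarrow> nat)" by (rule injI) (simp add: of_bool_def split: if_splits)
    ultimately show ?thesis using that by (simp add: C(2) lnth_coding list_encode_eq inj_map_eq_map)
  qed
  moreover have "C \<noteq> []" using C(1) by (simp add: is_coding_def)
  moreover have "llen (lnth n i) = llen (lnth n 0)" if "i < length C" for i
    using that w[OF that] llen_row[OF that] llen_row[of 0 C] \<open>C \<noteq> []\<close> unfolding C(2) by (metis length_greater_0_conv)
  moreover have "lnth (lnth n i) j < 2" if "i < length C" "j < llen (lnth n i)" for i j
  proof -
    have "j < length (C ! i)" using that(2) llen_row[OF that(1)] by (simp add: C(2))
    then show ?thesis using bit_coding[OF that(1)] by (simp add: C(2))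
  qed
  moreover have "length C \<noteq> 0" using \<open>C \<noteq> []\<close> by simp
  moreover have "llen n = length C" by (simp add: C(2) llen_coding)
  ultimately show "ccoding n" unfolding ccoding_def by presburger
qed

section \<open>Deciding the synthesis problem\<close>

text \<open>The memory of a certificate may have any countable type; \<open>f\<close> numbers
  it.\<close>

definition cst :: "('z \<Rightarrow> nat) \<Rightarrow> (nat \<times> bool) \<times> 'z \<Rightarrow> nat" where
  "cst f q = pr (pr (fst (fst q)) (of_bool (snd (fst q)))) (f (snd q))"

definition cval :: "nat \<times> bool \<times> bool \<Rightarrow> nat" where
  "cval v = pr (fst v) (pr (of_bool (fst (snd v))) (of_bool (snd (snd v))))"

definition ctri :: "('z \<Rightarrow> nat) \<Rightarrow> ((nat \<times> bool) \<times> 'z) \<times> (nat \<times> bool \<times> bool) \<times> ((nat \<times> bool) \<times> 'z) \<Rightarrow> nat" where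
  "ctri f r = pr (cst f (fst r)) (pr (cval (fst (snd r))) (cst f (snd (snd r))))"

lemma cst_eq: "inj f \<Longrightarrow> cst f q = cst f q' \<longleftrightarrow> q = q'"
  by (auto simp: cst_def prod_eq_iff inj_eq of_bool_eq_iff)

lemma cval_eq: "cval v = cval v' \<longleftrightarrow> v = v'"
  by (auto simp: cval_def prod_eq_iff of_bool_eq_iff)

lemma inj_cst: "inj f \<Longrightarrow> inj (cst f)"
  by (auto intro: injI simp: cst_eq)

lemma inj_ctri: "inj f \<Longrightarrow> inj (ctri f)"
  by (rule injI) (auto simp: ctri_def cst_eq cval_eq prod_eq_iff)

definition gmulc :: "nat \<Rightarrow> nat \<Rightarrow> nat \<Rightarrow> nat" where
  "gmulc c u v = pr (smul (sdec c) (pfst u) (pfst v))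
     (pr (of_bool (pfst (psnd u) = 1 \<or> pfst (psnd v) = 1)) (of_bool (psnd (psnd u) = 1 \<or> psnd (psnd v) = 1)))"

definition gaccc :: "nat \<Rightarrow> nat \<Rightarrow> nat \<Rightarrow> bool" where
  "gaccc c t e \<longleftrightarrow> (if pfst (psnd e) = 1 then sacc (sdec c) (pfst t) (pfst e) else psnd (psnd e) = 1)"

definition letc :: "nat \<Rightarrow> nat \<Rightarrow> nat \<Rightarrow> nat \<Rightarrow> nat" where
  "letc ci co a b = (LEAST w. (\<forall>i<llen (lnth ci 0). lnth (lnth ci a) i = 1 \<longrightarrow> 2 * i \<in> set_decode w) \<and>
     (\<forall>j<llen (lnth co 0). lnth (lnth co b) j = 1 \<longrightarrow> 2 * (llen (lnth ci 0) + j) \<in> set_decode w))"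

definition gvalc :: "nat \<Rightarrow> nat \<Rightarrow> nat \<Rightarrow> nat \<Rightarrow> nat \<Rightarrow> nat \<Rightarrow> nat" where
  "gvalc ci co c q a b = pr (shom (sdec c) (set_decode (letc ci co a b)))
     (pr (of_bool (psnd (pfst q) = 1 \<and> a = pfst (pfst q))) (of_bool (a \<noteq> pfst (pfst q))))"

lemma gmulc_cval: "gmulc c (cval u) (cval v) = cval (gmul (sdec c) u v)"
  by (cases u; cases v) (simp add: gmulc_def cval_def)

lemma gaccc_cval: "gaccc c (cval t) (cval e) = gacc (sdec c) t e"
  by (cases t; cases e) (simp add: gaccc_def cval_def)

lemma cmp_compose4:
  assumes "cmp (\<lambda>z. F (pfst z) (pfst (psnd z)) (pfst (psnd (psnd z))) (psnd (psnd (psnd z))))" "cmp f" "cmp g" "cmp h" "cmp k"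
  shows "cmp (\<lambda>x. F (f x) (g x) (h x) (k x))"
  using cmp_compose[OF assms(1) cmp_pr[OF assms(2) cmp_pr[OF assms(3) cmp_pr[OF assms(4,5)]]]] by simp

lemma cmp_letc [cmp_intros]:
  assumes "cmp f" "cmp g" "cmp h" "cmp k" shows "cmp (\<lambda>x. letc (f x) (g x) (h x) (k x))"
proof (rule cmp_compose4[OF _ assms], unfold letc_def, intro cmp_intros)
  show "\<exists>w. (\<forall>i<m. P i \<longrightarrow> 2 * i \<in> set_decode w) \<and> (\<forall>j<n. R j \<longrightarrow> 2 * (m + j) \<in> set_decode w)"
    for m n :: nat and P R :: "nat \<Rightarrow> bool"
    by (rule exI[of _ "set_encode {..2 * (m + n)}"]) auto
qed

lemma cmp_gmulc [cmp_intros]: "cmp f \<Longrightarrow> cmp g \<Longrightarrow> cmp h \<Longrightarrow> cmp (\<lambda>x. gmulc (f x) (g x) (h x))"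
  unfolding gmulc_def by (intro cmp_intros)

lemma dec_gaccc [cmp_intros]: "cmp f \<Longrightarrow> cmp g \<Longrightarrow> cmp h \<Longrightarrow> dec (\<lambda>x. gaccc (f x) (g x) (h x))"
  unfolding gaccc_def by (intro cmp_intros)

lemma cmp_gvalc [cmp_intros]:
  "cmp f1 \<Longrightarrow> cmp f2 \<Longrightarrow> cmp f3 \<Longrightarrow> cmp f4 \<Longrightarrow> cmp f5 \<Longrightarrow> cmp f6 \<Longrightarrow>
     cmp (\<lambda>x. gvalc (f1 x) (f2 x) (f3 x) (f4 x) (f5 x) (f6 x))"
  unfolding gvalc_def by (intro cmp_intros)

text \<open>\<open>w\<close> packs the start state, the code of the set of states and the code of
  the set of triples; \<open>pr 0 0\<close> codes the position \<open>(0, False)\<close>, and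
  \<open>d < 2\<close> ranges over the codes of the request flag. All quantifiers are
  bounded.\<close>

definition check :: "bool \<Rightarrow> nat \<Rightarrow> nat \<Rightarrow> nat \<Rightarrow> nat \<Rightarrow> bool" where
  "check pl ci co c w \<longleftrightarrow> pfst w \<in> set_decode (pfst (psnd w)) \<and> pfst (pfst w) = pr 0 0 \<and>
     (\<forall>r1\<in>set_decode (psnd (psnd w)). \<forall>r2\<in>set_decode (psnd (psnd w)). psnd (psnd r1) = pfst r2 \<longrightarrow>
        pr (pfst r1) (pr (gmulc c (pfst (psnd r1)) (pfst (psnd r2))) (psnd (psnd r2))) \<in> set_decode (psnd (psnd w))) \<and>
     (if pl then \<forall>q\<in>set_decode (pfst (psnd w)). \<forall>a<llen ci. \<exists>b<llen co. \<exists>d<2. \<exists>q'\<in>set_decode (pfst (psnd w)).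
        pfst q' = pr a d \<and> pr q (pr (gvalc ci co c q a b) q') \<in> set_decode (psnd (psnd w))
      else \<forall>q\<in>set_decode (pfst (psnd w)). \<exists>a<llen ci. \<forall>b<llen co. \<forall>d<2. \<exists>q'\<in>set_decode (pfst (psnd w)).
        pfst q' = pr a d \<and> pr q (pr (gvalc ci co c q a b) q') \<in> set_decode (psnd (psnd w))) \<and>
     (\<forall>r1\<in>set_decode (psnd (psnd w)). \<forall>r2\<in>set_decode (psnd (psnd w)).
        pfst r1 = pfst w \<and> psnd (psnd r1) = pfst r2 \<and> psnd (psnd r2) = pfst r2 \<and>
        gmulc c (pfst (psnd r1)) (pfst (psnd r2)) = pfst (psnd r1) \<and>
        gmulc c (pfst (psnd r2)) (pfst (psnd r2)) = pfst (psnd r2) \<longrightarrow>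
        (gaccc c (pfst (psnd r1)) (pfst (psnd r2)) \<longleftrightarrow> pl))"

lemma dec_check:
  assumes "cmp f" "cmp g" "cmp h" "cmp k" shows "dec (\<lambda>x. check pl (f x) (g x) (h x) (k x))"
  unfolding dec_def
  by (rule cmp_compose4[OF _ assms], unfold check_def) (intro cmp_intros)

context synth
begin

lemma width_llen: "width Cin = llen (lnth (coding_encode Cin) 0)" "width Cout = llen (lnth (coding_encode Cout) 0)"
  using ne by (simp_all add: width_def llen_row hd_conv_nth)

lemma letc_letter:
  assumes "a < length Cin" "b < length Cout"
  shows "letc (coding_encode Cin) (coding_encode Cout) a b = set_encode (letter Cin Cout a b)"
proof -
  have len: "length (Cin ! a) = width Cin" "length (Cout ! b) = width Cout"
    using cin cout nth_mem[OF assms(1)] nth_mem[OF assms(2)] unfolding is_coding_def width_def by blast+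
  have "finite (letter Cin Cout a b)" by (simp add: letter_def)
  moreover have "letter Cin Cout a b \<subseteq> set_decode w \<longleftrightarrow>
      (\<forall>i<width Cin. lnth (lnth (coding_encode Cin) a) i = 1 \<longrightarrow> 2 * i \<in> set_decode w) \<and>
      (\<forall>j<width Cout. lnth (lnth (coding_encode Cout) b) j = 1 \<longrightarrow> 2 * (width Cin + j) \<in> set_decode w)" for w
    using bit_coding[OF assms(1)] bit_coding[OF assms(2)] len by (auto simp: letter_def)
  ultimately show ?thesis using least_superset[of "letter Cin Cout a b"]
    by (simp add: letc_def width_llen)
qed

context
  fixes ci co c :: nat
  assumes ci: "ci = coding_encode Cin" and co: "co = coding_encode Cout" and c: "sdec c = tr \<Psi>"
begin

lemma gvalc_cval:
  assumes "a < length Cin" "b < length Cout"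
  shows "gvalc ci co c (cst f q) a b = cval (gval (fst q) a (b, d))"
proof -
  have "finite (letter Cin Cout a b)" by (simp add: letter_def)
  then show ?thesis
    by (simp add: gvalc_def gval_def cval_def cst_def ci co c letc_letter[OF assms])
qed

lemma cert_check:
  fixes f :: "'z \<Rightarrow> nat"
  assumes f: "inj f" and cert: "is_cert pl Q R (q0 :: (nat \<times> bool) \<times> 'z)"
  shows "\<exists>w. check pl ci co c w"
proof -
  note u = cert[unfolded is_cert_def certificate_def]
  have fin: "finite Q" "finite R" and q0: "q0 \<in> Q" "fst q0 = (0, False)"
    and cl: "\<And>p v q w r. (p, v, q) \<in> R \<Longrightarrow> (q, w, r) \<in> R \<Longrightarrow> (p, gmul (tr \<Psi>) v w, r) \<in> R"
    and win: "\<And>t e q. (q0, t, q) \<in> R \<Longrightarrow> (q, e, q) \<in> R \<Longrightarrow> gmul (tr \<Psi>) t e = t \<Longrightarrow> gmul (tr \<Psi>) e e = e \<Longrightarrow>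
      gacc (tr \<Psi>) t e = pl"
    using u by blast+
  note mv = u[THEN conjunct2, THEN conjunct2, THEN conjunct2, THEN conjunct2, THEN conjunct2, THEN conjunct1]
  define w where "w = pr (cst f q0) (pr (set_encode (cst f ` Q)) (set_encode (ctri f ` R)))"
  have Q: "set_decode (pfst (psnd w)) = cst f ` Q" and R: "set_decode (psnd (psnd w)) = ctri f ` R"
    using fin by (simp_all add: w_def)
  have w0: "pfst w = cst f q0" by (simp add: w_def)
  have move: "\<exists>q'\<in>cst f ` Q. pfst q' = pr a d \<and> pr (cst f q) (pr (gvalc ci co c (cst f q) a b) q') \<in> ctri f ` R"
    if ex: "\<exists>q'\<in>Q. fst q' = pos_step (fst q) a (b, d = 1) \<and> (q, gval (fst q) a (b, d = 1), q') \<in> R"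
      and ab: "a < length Cin" "b < length Cout" and d: "d < 2" for q a b d
  proof -
    obtain q' where q': "q' \<in> Q" "fst q' = (a, d = 1)" "(q, gval (fst q) a (b, d = 1), q') \<in> R"
      using ex by (auto simp: pos_step_def)
    have "of_bool (d = 1) = d" using d by (auto simp: less_2_cases_iff)
    then have "pfst (cst f q') = pr a d" using q'(2) by (simp add: cst_def)
    moreover have "pr (cst f q) (pr (gvalc ci co c (cst f q) a b) (cst f q')) = ctri f (q, gval (fst q) a (b, d = 1), q')"
      using gvalc_cval[OF ab, of f q "d = 1"] by (simp add: ctri_def)
    ultimately show ?thesis using q' by (intro bexI[of _ "cst f q'"]) auto
  qed
  have "check pl ci co c w"
    unfolding check_def Q R w0
  proof (intro conjI)
    show "cst f q0 \<in> cst f ` Q" using q0 by simp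
    show "pfst (cst f q0) = pr 0 0" using q0(2) by (simp add: cst_def)
    show "\<forall>r1\<in>ctri f ` R. \<forall>r2\<in>ctri f ` R. psnd (psnd r1) = pfst r2 \<longrightarrow>
        pr (pfst r1) (pr (gmulc c (pfst (psnd r1)) (pfst (psnd r2))) (psnd (psnd r2))) \<in> ctri f ` R"
    proof (intro ballI impI)
      fix r1 r2 assume r: "r1 \<in> ctri f ` R" "r2 \<in> ctri f ` R" "psnd (psnd r1) = pfst r2"
      obtain p v q where 1: "r1 = ctri f (p, v, q)" "(p, v, q) \<in> R" using r(1) by (metis imageE prod_cases3)
      obtain q' x s where 2: "r2 = ctri f (q', x, s)" "(q', x, s) \<in> R" using r(2) by (metis imageE prod_cases3)
      have "q = q'" using r(3) cst_eq[OF f] by (simp add: 1 2 ctri_def)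
      then have "(p, gmul (tr \<Psi>) v x, s) \<in> R" using cl 1 2 by blast
      then have "ctri f (p, gmul (tr \<Psi>) v x, s) \<in> ctri f ` R" by (rule imageI)
      then show "pr (pfst r1) (pr (gmulc c (pfst (psnd r1)) (pfst (psnd r2))) (psnd (psnd r2))) \<in> ctri f ` R"
        by (simp add: 1 2 ctri_def gmulc_cval c)
    qed
    show "\<forall>r1\<in>ctri f ` R. \<forall>r2\<in>ctri f ` R. pfst r1 = cst f q0 \<and> psnd (psnd r1) = pfst r2 \<and> psnd (psnd r2) = pfst r2 \<and>
        gmulc c (pfst (psnd r1)) (pfst (psnd r2)) = pfst (psnd r1) \<and>
        gmulc c (pfst (psnd r2)) (pfst (psnd r2)) = pfst (psnd r2) \<longrightarrow>
        (gaccc c (pfst (psnd r1)) (pfst (psnd r2)) \<longleftrightarrow> pl)"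
    proof (intro ballI impI, elim conjE)
      fix r1 r2 assume r: "r1 \<in> ctri f ` R" "r2 \<in> ctri f ` R" "pfst r1 = cst f q0" "psnd (psnd r1) = pfst r2"
        "psnd (psnd r2) = pfst r2" "gmulc c (pfst (psnd r1)) (pfst (psnd r2)) = pfst (psnd r1)"
        "gmulc c (pfst (psnd r2)) (pfst (psnd r2)) = pfst (psnd r2)"
      obtain p t q where 1: "r1 = ctri f (p, t, q)" "(p, t, q) \<in> R" using r(1) by (metis imageE prod_cases3)
      obtain q' e s where 2: "r2 = ctri f (q', e, s)" "(q', e, s) \<in> R" using r(2) by (metis imageE prod_cases3)
      have "p = q0" "q' = q" "s = q" using r(3-5) cst_eq[OF f] by (auto simp: 1 2 ctri_def)
      moreover have "gmul (tr \<Psi>) t e = t" "gmul (tr \<Psi>) e e = e"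
        using r(6,7) by (simp_all add: 1 2 ctri_def gmulc_cval cval_eq c)
      ultimately have "gacc (tr \<Psi>) t e = pl" using win[of t q e] 1(2) 2(2) by blast
      then show "gaccc c (pfst (psnd r1)) (pfst (psnd r2)) \<longleftrightarrow> pl" by (simp add: 1 2 ctri_def gaccc_cval c)
    qed
    show "if pl then \<forall>q\<in>cst f ` Q. \<forall>a<llen ci. \<exists>b<llen co. \<exists>d<2. \<exists>q'\<in>cst f ` Q.
        pfst q' = pr a d \<and> pr q (pr (gvalc ci co c q a b) q') \<in> ctri f ` R
      else \<forall>q\<in>cst f ` Q. \<exists>a<llen ci. \<forall>b<llen co. \<forall>d<2. \<exists>q'\<in>cst f ` Q.
        pfst q' = pr a d \<and> pr q (pr (gvalc ci co c q a b) q') \<in> ctri f ` R"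
    proof (cases pl)
      case True
      have "\<exists>b<llen co. \<exists>d<2. \<exists>q'\<in>cst f ` Q. pfst q' = pr a d \<and> pr (cst f q) (pr (gvalc ci co c (cst f q) a b) q') \<in> ctri f ` R"
        if "q \<in> Q" "a < llen ci" for q a
      proof -
        have a: "a < length Cin" using that(2) by (simp add: ci llen_coding)
        then have "\<exists>bd\<in>outsym \<times> UNIV. \<exists>q'\<in>Q. fst q' = pos_step (fst q) a bd \<and> (q, gval (fst q) a bd, q') \<in> R"
          using mv[unfolded if_P[OF True], THEN bspec, OF that(1), THEN bspec, of a] by simp
        then obtain b d where bd: "b < length Cout"
          "\<exists>q'\<in>Q. fst q' = pos_step (fst q) a (b, d) \<and> (q, gval (fst q) a (b, d), q') \<in> R" by auto
        define d' where "d' = (of_bool d :: nat)"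
        have d': "(d' = 1) = d" "d' < 2" by (simp_all add: d'_def)
        show ?thesis
          using move[of q a b d', unfolded d'(1), OF bd(2) a bd(1) d'(2)] bd(1) d'(2) by (auto simp: co llen_coding)
      qed
      then show ?thesis unfolding if_P[OF True] by auto
    next
      case False
      have "\<exists>a<llen ci. \<forall>b<llen co. \<forall>d<2. \<exists>q'\<in>cst f ` Q.
          pfst q' = pr a d \<and> pr (cst f q) (pr (gvalc ci co c (cst f q) a b) q') \<in> ctri f ` R" if "q \<in> Q" for q
      proof -
        obtain a where a: "a < length Cin"
          "\<forall>bd\<in>outsym \<times> UNIV. \<exists>q'\<in>Q. fst q' = pos_step (fst q) a bd \<and> (q, gval (fst q) a bd, q') \<in> R"
          using mv[unfolded if_not_P[OF False], THEN bspec, OF \<open>q \<in> Q\<close>] by auto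
        have "\<exists>q'\<in>cst f ` Q. pfst q' = pr a d \<and> pr (cst f q) (pr (gvalc ci co c (cst f q) a b) q') \<in> ctri f ` R"
          if "b < llen co" "d < 2" for b d
        proof -
          have b: "b < length Cout" using that(1) by (simp add: co llen_coding)
          then have "(b, d = 1) \<in> outsym \<times> UNIV" by simp
          from move[OF bspec[OF a(2) this] a(1) b that(2)] show ?thesis .
        qed
        then show ?thesis using a(1) by (intro exI[of _ a]) (simp add: ci llen_coding)
      qed
      then show ?thesis unfolding if_not_P[OF False] by auto
    qed
  qed
  then show ?thesis by blast
qed

text \<open>The coded sets may contain numbers that code no state or triple; preimages under the
  injective codings leave them out and stay finite.\<close>

lemma check_cert:
  assumes "check pl ci co c w"
  shows "\<exists>Q R (q0 :: (nat \<times> bool) \<times> nat). is_cert pl Q R q0"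
proof -
  note u = assms[unfolded check_def]
  note mv = u[THEN conjunct2, THEN conjunct2, THEN conjunct2, THEN conjunct1]
  note cl = u[THEN conjunct2, THEN conjunct2, THEN conjunct1, rule_format]
  note win = u[THEN conjunct2, THEN conjunct2, THEN conjunct2, THEN conjunct2, rule_format]
  have id: "inj (id :: nat \<Rightarrow> nat)" by simp
  define Q where "Q = {q. cst id q \<in> set_decode (pfst (psnd w))}"
  define R where "R = {r. ctri id r \<in> set_decode (psnd (psnd w))}"
  define q0 where "q0 = ((0 :: nat, False), psnd (pfst w))"
  have q0w: "cst id q0 = pfst w" using u[THEN conjunct2, THEN conjunct1] pr_pfst_psnd[of "pfst w"]
    by (simp add: cst_def q0_def)
  have "finite Q" "finite R"
    unfolding Q_def R_def using finite_vimageI[OF finite_set_decode inj_cst[OF id]]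
      finite_vimageI[OF finite_set_decode inj_ctri[OF id]] by (simp_all add: vimage_def)
  moreover have "q0 \<in> Q" "fst q0 = (0, False)" using u[THEN conjunct1] by (simp_all add: Q_def q0w) (simp add: q0_def)
  moreover have "(p, gmul (tr \<Psi>) v x, s) \<in> R" if "(p, v, q) \<in> R" "(q, x, s) \<in> R" for p v q x s
    using cl[of "ctri id (p, v, q)" "ctri id (q, x, s)"] that
    by (simp add: R_def ctri_def gmulc_cval c)
  moreover have "gacc (tr \<Psi>) t e = pl"
    if "(q0, t, q) \<in> R" "(q, e, q) \<in> R" "gmul (tr \<Psi>) t e = t" "gmul (tr \<Psi>) e e = e" for t e q
    using win[of "ctri id (q0, t, q)" "ctri id (q, e, q)"] that
    by (simp add: R_def ctri_def gmulc_cval gaccc_cval c q0w)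
  moreover have move: "\<exists>q'\<in>Q. fst q' = pos_step (fst q) a (b, d = 1) \<and> (q, gval (fst q) a (b, d = 1), q') \<in> R"
    if ex: "\<exists>q'\<in>set_decode (pfst (psnd w)). pfst q' = pr a d \<and>
        pr (cst id q) (pr (gvalc ci co c (cst id q) a b) q') \<in> set_decode (psnd (psnd w))"
      and ab: "a < length Cin" "b < length Cout" and d: "d < 2" for q a b d
  proof -
    obtain q' where q': "q' \<in> set_decode (pfst (psnd w))" "pfst q' = pr a d"
      "pr (cst id q) (pr (gvalc ci co c (cst id q) a b) q') \<in> set_decode (psnd (psnd w))" using ex by blast
    define q'' where "q'' = ((a, d = 1), psnd q')"
    have "of_bool (d = 1) = d" using d by (auto simp: less_2_cases_iff)
    then have e: "cst id q'' = q'" using q'(2) pr_pfst_psnd[of q'] by (simp add: cst_def q''_def)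
    then have "q'' \<in> Q" using q'(1) by (simp add: Q_def)
    moreover have "(q, gval (fst q) a (b, d = 1), q'') \<in> R"
      using q'(3) gvalc_cval[OF ab, of id q "d = 1"] e by (simp add: R_def ctri_def)
    ultimately show ?thesis by (intro bexI[of _ q'']) (simp_all add: pos_step_def q''_def)
  qed
  moreover have "if pl then \<forall>q\<in>Q. \<forall>a\<in>insym. \<exists>b\<in>outsym \<times> UNIV. \<exists>q'\<in>Q. fst q' = pos_step (fst q) a b \<and> (q, gval (fst q) a b, q') \<in> R
      else \<forall>q\<in>Q. \<exists>a\<in>insym. \<forall>b\<in>outsym \<times> UNIV. \<exists>q'\<in>Q. fst q' = pos_step (fst q) a b \<and> (q, gval (fst q) a b, q') \<in> R"
  proof (cases pl)
    case True
    have "\<exists>b\<in>outsym \<times> UNIV. \<exists>q'\<in>Q. fst q' = pos_step (fst q) a b \<and> (q, gval (fst q) a b, q') \<in> R"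
      if "q \<in> Q" "a \<in> insym" for q a
    proof -
      have "cst id q \<in> set_decode (pfst (psnd w))" "a < llen ci" using that by (simp_all add: Q_def ci llen_coding)
      then obtain b d where bd: "b < llen co" "d < 2" "\<exists>q'\<in>set_decode (pfst (psnd w)). pfst q' = pr a d \<and>
        pr (cst id q) (pr (gvalc ci co c (cst id q) a b) q') \<in> set_decode (psnd (psnd w))"
        using mv[unfolded if_P[OF True]] by blast
      then have b: "b < length Cout" by (simp add: co llen_coding)
      have "a < length Cin" using that(2) by simp
      from move[OF bd(3) this b bd(2)] show ?thesis using b by (intro bexI[of _ "(b, d = 1)"]) simp_all
    qed
    then show ?thesis unfolding if_P[OF True] by blast
  next
    case False
    have "\<exists>a\<in>insym. \<forall>b\<in>outsym \<times> UNIV. \<exists>q'\<in>Q. fst q' = pos_step (fst q) a b \<and> (q, gval (fst q) a b, q') \<in> R"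
      if "q \<in> Q" for q
    proof -
      have "cst id q \<in> set_decode (pfst (psnd w))" using that by (simp add: Q_def)
      then obtain a where a: "a < llen ci" "\<forall>b<llen co. \<forall>d<2. \<exists>q'\<in>set_decode (pfst (psnd w)). pfst q' = pr a d \<and>
        pr (cst id q) (pr (gvalc ci co c (cst id q) a b) q') \<in> set_decode (psnd (psnd w))"
        using mv[unfolded if_not_P[OF False]] by blast
      have a': "a < length Cin" using a(1) by (simp add: ci llen_coding)
      have "\<exists>q'\<in>Q. fst q' = pos_step (fst q) a bd \<and> (q, gval (fst q) a bd, q') \<in> R" if "bd \<in> outsym \<times> UNIV" for bd
      proof -
        obtain b d where bd: "bd = (b, d)" "b < length Cout" using \<open>bd \<in> outsym \<times> UNIV\<close> by auto
        define d' where "d' = (of_bool d :: nat)"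
        have d': "(d' = 1) = d" "d' < 2" by (simp_all add: d'_def)
        have "b < llen co" using bd(2) by (simp add: co llen_coding)
        from move[of a d' q b, unfolded d'(1), OF a(2)[rule_format, OF this d'(2)] a' bd(2) d'(2)]
        show ?thesis unfolding bd(1) .
      qed
      then show ?thesis using a' by (intro bexI[of _ a]) auto
    qed
    then show ?thesis unfolding if_not_P[OF False] by blast
  qed
  ultimately have "is_cert pl Q R q0" unfolding is_cert_def certificate_def
    by (intro conjI) (assumption | blast)+
  then show ?thesis by blast
qed

text \<open>A valid certificate of either kind settles the question, whichever the search meets
  first.\<close>

theorem check_iff:
  "(\<exists>w. check pl ci co c w) \<Longrightarrow> (\<exists>F. C_operator (alphabet Cin) (alphabet Cout) F \<and>
     (\<forall>X\<in>signals (alphabet Cin). Rsig_models Cin Cout \<Psi> X (F X))) \<longleftrightarrow> pl"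
proof -
  assume "\<exists>w. check pl ci co c w"
  then obtain Q R and q0 :: "(nat \<times> bool) \<times> nat" where "is_cert pl Q R q0" using check_cert by blast
  then show ?thesis
  proof (cases pl)
    case True
    then have "is_cert True Q R q0" using \<open>is_cert pl Q R q0\<close> by simp
    from cert_imp_C_operator[OF this] True show ?thesis by simp
  next
    case False
    then have "is_cert False Q R q0" using \<open>is_cert pl Q R q0\<close> by simp
    from cert_imp_no_C_operator[OF this] False show ?thesis by blast
  qed
qed

theorem check_total: "\<exists>pl w. check pl ci co c w"
proof -
  obtain pl Q R and q0 :: "(nat \<times> bool) \<times> ((nat \<times> bool \<times> bool) list \<times> nat)" where "is_cert pl Q R q0"
    using is_cert_exists by blast
  then show ?thesis using cert_check[OF inj_to_nat] by blast
qed

end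

end

section \<open>Recognising instances and running the search\<close>

lemma spec_formula_iff:
  "spec_formula Cin Cout \<Psi> \<longleftrightarrow> (\<forall>v\<in>fvs (tr \<Psi>). even v \<and> v div 2 < width Cin + width Cout)"
proof
  assume *: "\<forall>v\<in>fvs (tr \<Psi>). even v \<and> v div 2 < width Cin + width Cout"
  have "x \<notin> free1 \<Psi>" for x
  proof
    assume "x \<in> free1 \<Psi>"
    then have "2 * x + 1 \<in> fvs (tr \<Psi>)" unfolding fvs_tr by blast
    then have "even (2 * x + 1)" using * by blast
    then show False by simp
  qed
  moreover have "X < width Cin + width Cout" if "X \<in> free2 \<Psi>" for X
  proof -
    have "2 * X \<in> fvs (tr \<Psi>)" unfolding fvs_tr using that by blast
    then have "2 * X div 2 < width Cin + width Cout" using * by blast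
    then show ?thesis by simp
  qed
  ultimately show "spec_formula Cin Cout \<Psi>" unfolding spec_formula_def by blast
next
  assume "spec_formula Cin Cout \<Psi>"
  then show "\<forall>v\<in>fvs (tr \<Psi>). even v \<and> v div 2 < width Cin + width Cout"
    unfolding spec_formula_def fvs_tr by auto
qed

theorem theorem5p19:
  "decidable {instance_encode Cin Cout \<Psi> | Cin Cout \<Psi>.
     is_coding Cin \<and> is_coding Cout \<and> spec_formula Cin Cout \<Psi> \<and>
     (\<exists>F. C_operator (alphabet Cin) (alphabet Cout) F \<and>
          (\<forall>X\<in>signals (alphabet Cin). Rsig_models Cin Cout \<Psi> X (F X)))}"
proof -
  obtain T where T: "cmp T" "\<And>\<phi>. T (mso_encode \<phi>) \<noteq> 0 \<and> sdec (T (mso_encode \<phi>) - 1) = tr \<phi>"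
    "\<And>n. T n \<noteq> 0 \<Longrightarrow> \<exists>\<phi>. n = mso_encode \<phi>"
    using tr_computable by blast
  define c where "c n = T (psnd (psnd n)) - 1" for n
  \<comment> \<open>By \<open>fvs_less\<close> the bound \<open>Suc (c n)\<close> covers all free
    variables.\<close>
  define V where "V n \<longleftrightarrow> ccoding (pfst n) \<and> ccoding (pfst (psnd n)) \<and> T (psnd (psnd n)) \<noteq> 0 \<and>
    (\<forall>v<Suc (c n). v \<in> fvs (sdec (c n)) \<longrightarrow>
      even v \<and> v div 2 < llen (lnth (pfst n) 0) + llen (lnth (pfst (psnd n)) 0))" for n
  define ok where "ok pl n w \<longleftrightarrow> check pl (pfst n) (pfst (psnd n)) (c n) w" for pl n w
  \<comment> \<open>The disjunct \<open>\<not> V n\<close> makes the search halt also on numbers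
    that code no instance.\<close>
  define W where "W n = (LEAST w. \<not> V n \<or> ok True n w \<or> ok False n w)" for n
  define A where "A = {instance_encode Cin Cout \<Psi> | Cin Cout \<Psi>.
     is_coding Cin \<and> is_coding Cout \<and> spec_formula Cin Cout \<Psi> \<and>
     (\<exists>F. C_operator (alphabet Cin) (alphabet Cout) F \<and>
          (\<forall>X\<in>signals (alphabet Cin). Rsig_models Cin Cout \<Psi> X (F X)))}"
  have inst: "V (instance_encode Cin Cout \<Psi>)" "sdec (c (instance_encode Cin Cout \<Psi>)) = tr \<Psi>"
    if "is_coding Cin" "is_coding Cout" "spec_formula Cin Cout \<Psi>" for Cin Cout \<Psi>
  proof -
    interpret synth Cin Cout \<Psi> using that by unfold_locales
    have e: "pfst (instance_encode Cin Cout \<Psi>) = coding_encode Cin"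
      "pfst (psnd (instance_encode Cin Cout \<Psi>)) = coding_encode Cout"
      "psnd (psnd (instance_encode Cin Cout \<Psi>)) = mso_encode \<Psi>" by (simp_all add: instance_encode_def)
    show s: "sdec (c (instance_encode Cin Cout \<Psi>)) = tr \<Psi>" unfolding c_def e using T(2) by blast
    show "V (instance_encode Cin Cout \<Psi>)"
      unfolding V_def e s width_llen[symmetric]
    proof (intro conjI allI impI)
      show "ccoding (coding_encode Cin)" "ccoding (coding_encode Cout)" using that(1,2) ccoding_iff by blast+
      show "T (mso_encode \<Psi>) \<noteq> 0" using T(2) by blast
      show "even v" "v div 2 < width Cin + width Cout" if "v \<in> fvs (tr \<Psi>)" for v
        using spec spec_formula_iff[of Cin Cout \<Psi>] that by blast+
    qed
  qed
  have V: "\<exists>Cin Cout \<Psi>. n = instance_encode Cin Cout \<Psi> \<and> is_coding Cin \<and> is_coding Cout \<and> spec_formula Cin Cout \<Psi>"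
    if v: "V n" for n
  proof -
    have v': "ccoding (pfst n)" "ccoding (pfst (psnd n))" "T (psnd (psnd n)) \<noteq> 0" using v unfolding V_def by blast+
    obtain Cin Cout where C: "is_coding Cin" "pfst n = coding_encode Cin" "is_coding Cout" "pfst (psnd n) = coding_encode Cout"
      using v'(1,2) unfolding ccoding_iff by blast
    obtain \<Psi> where \<Psi>: "psnd (psnd n) = mso_encode \<Psi>" using T(3)[OF v'(3)] by blast
    have n: "n = instance_encode Cin Cout \<Psi>"
      unfolding instance_encode_def C(2)[symmetric] C(4)[symmetric] \<Psi>[symmetric] by simp
    have cn: "sdec (c n) = tr \<Psi>" using T(2) by (simp add: c_def \<Psi>)
    have w: "llen (lnth (pfst n) 0) = width Cin" "llen (lnth (pfst (psnd n)) 0) = width Cout"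
      unfolding C(2,4) using C(1,3) llen_row[of 0 Cin] llen_row[of 0 Cout]
      unfolding is_coding_def width_def by (metis hd_conv_nth length_greater_0_conv)+
    have "even u \<and> u div 2 < width Cin + width Cout" if u: "u \<in> fvs (tr \<Psi>)" for u
    proof -
      have "u \<in> fvs (sdec (c n))" "u < Suc (c n)" using u fvs_less[of u "c n"] by (simp_all add: cn less_Suc_eq_le)
      then show ?thesis using v unfolding V_def w by blast
    qed
    then show ?thesis using n C spec_formula_iff[of Cin Cout \<Psi>] by blast
  qed
  have okI: "(\<exists>w. ok pl (instance_encode Cin Cout \<Psi>) w) \<Longrightarrow> instance_encode Cin Cout \<Psi> \<in> A \<longleftrightarrow> pl"
    "\<exists>pl w. ok pl (instance_encode Cin Cout \<Psi>) w"
    if C: "is_coding Cin" "is_coding Cout" "spec_formula Cin Cout \<Psi>" for Cin Cout \<Psi> pl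
  proof -
    interpret synth Cin Cout \<Psi> using C by unfold_locales
    have e: "pfst (instance_encode Cin Cout \<Psi>) = coding_encode Cin"
      "pfst (psnd (instance_encode Cin Cout \<Psi>)) = coding_encode Cout" by (simp_all add: instance_encode_def)
    have "instance_encode Cin Cout \<Psi> \<in> A \<longleftrightarrow> (\<exists>F. C_operator (alphabet Cin) (alphabet Cout) F \<and>
          (\<forall>X\<in>signals (alphabet Cin). Rsig_models Cin Cout \<Psi> X (F X)))"
      using C unfolding A_def mem_Collect_eq instance_encode_inject by blast
    then show "(\<exists>w. ok pl (instance_encode Cin Cout \<Psi>) w) \<Longrightarrow> instance_encode Cin Cout \<Psi> \<in> A \<longleftrightarrow> pl"
      using check_iff[OF e inst(2)[OF C], of pl] unfolding ok_def by simp
    show "\<exists>pl w. ok pl (instance_encode Cin Cout \<Psi>) w"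
      using check_total[OF e inst(2)[OF C]] unfolding ok_def .
  qed
  have A_iff: "n \<in> A \<longleftrightarrow> V n \<and> ok True n (W n)" and ex: "\<exists>w. \<not> V n \<or> ok True n w \<or> ok False n w" for n
  proof -
    show ex: "\<exists>w. \<not> V n \<or> ok True n w \<or> ok False n w"
    proof (cases "V n")
      case True
      then obtain pl w where "ok pl n w" using V[OF True] okI(2) by blast
      then show ?thesis by (cases pl) auto
    qed simp
    show "n \<in> A \<longleftrightarrow> V n \<and> ok True n (W n)"
    proof (cases "V n")
      case True
      then have W: "ok True n (W n) \<or> ok False n (W n)" using LeastI_ex[OF ex] unfolding W_def by blast
      obtain Cin Cout \<Psi> where n: "n = instance_encode Cin Cout \<Psi>"
        and C: "is_coding Cin" "is_coding Cout" "spec_formula Cin Cout \<Psi>" using V[OF True] by blast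
      show ?thesis using W okI(1)[OF C, of True] okI(1)[OF C, of False] True unfolding n by blast
    next
      case False
      then show ?thesis using inst(1) unfolding A_def by blast
    qed
  qed
  have cT: "cmp (\<lambda>x. T (f x))" if "cmp f" for f using cmp_compose[OF T(1) that] .
  have cc: "cmp (\<lambda>x. c (f x))" if "cmp f" for f unfolding c_def by (intro cmp_intros cT that)
  have dV: "dec V" unfolding V_def by (intro cmp_intros cT cc)
  have dok: "dec (\<lambda>x. ok pl (f x) (g x))" if "cmp f" "cmp g" for pl f g
    unfolding ok_def by (intro dec_check cmp_intros cc that)
  have "cmp W" unfolding W_def by (intro cmp_Least ex dec_disj dec_not dec_compose[OF dV] dok cmp_intros)
  then have "cmp (\<lambda>n. of_bool (n \<in> A))"
    unfolding A_iff by (intro cmp_of_bool dec_conj dV dok cmp_id)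
  from cmp_rec_computes[OF this] have "decidable A" unfolding decidable_def of_bool_def .
  then show ?thesis unfolding A_def .
qed

end
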